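(* Assume $\mathsf{ZF} + \mathsf{AD}$. Let $\Phi : [\omega_1]^\omega \to \mathbb{R}$ be a function. Then there exist an uncountable $X \subseteq \omega_1$, reals $\sigma, w \in \mathbb{R}$, and a formula $\phi$ such that for every $f \in [X]^\omega$: $\Phi(f) \in L[\sigma,w,f]$, and for all $z \in \mathbb{R}$, $z = \Phi(f)$ if and only if $L[\sigma,w,f,z] \models \phi(\sigma,w,f,z)$.
   Context: For a set $A$ of ordinals, $[A]^\omega$ is the set of strictly increasing functions $\omega \to A$. $L[a_1,\dots,a_n]$ denotes the class of sets constructible relative to the parameters $a_1,\dots,a_n$. *)

theory Defs
  imports Main
begin

text \<open>
  HOL has choice, so \<open>ZF + AD\<close> cannot be assumed of an ambient HOL universe of sets. A theorem
  of \<open>ZF + AD\<close> is rendered as a statement about every first-order structure \<open>(V, E)\<close> that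
  satisfies \<open>ZF + AD\<close>, where \<open>V\<close> is an arbitrary type \<open>'v\<close> and \<open>E x y\<close> is read \<open>x \<in> y\<close>.
  The schemas of Separation and Replacement range over formulas only: with arbitrary HOL predicates
  in their place the structure would inherit choice and \<open>AD\<close> would be contradictory.
  Apart from the formulas, every notion below quantifies over elements of \<open>V\<close> only, i.e. it is the
  usual set-theoretic notion computed inside \<open>(V, E)\<close>, which may be ill-founded and may have
  nonstandard natural numbers.
\<close>

section \<open>First-order formulas of set theory\<close>

datatype fm =
    Mem nat nat
  | Eq nat nat
  | Neg fm
  | Conj fm fm
  | Exists nat fm

primrec fv :: "fm \<Rightarrow> nat set" where
  "fv (Mem i j) = {i, j}"
| "fv (Eq i j) = {i, j}"
| "fv (Neg \<phi>) = fv \<phi>"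
| "fv (Conj \<phi> \<psi>) = fv \<phi> \<union> fv \<psi>"
| "fv (Exists i \<phi>) = fv \<phi> - {i}"

text \<open>\<open>sat E D s \<phi>\<close>: the formula \<open>\<phi>\<close> holds in \<open>(D, E)\<close> under the assignment \<open>s\<close>.\<close>

primrec sat :: "('v \<Rightarrow> 'v \<Rightarrow> bool) \<Rightarrow> 'v set \<Rightarrow> (nat \<Rightarrow> 'v) \<Rightarrow> fm \<Rightarrow> bool" where
  "sat E D s (Mem i j) \<longleftrightarrow> E (s i) (s j)"
| "sat E D s (Eq i j) \<longleftrightarrow> s i = s j"
| "sat E D s (Neg \<phi>) \<longleftrightarrow> \<not> sat E D s \<phi>"
| "sat E D s (Conj \<phi> \<psi>) \<longleftrightarrow> sat E D s \<phi> \<and> sat E D s \<psi>"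
| "sat E D s (Exists i \<phi>) \<longleftrightarrow> (\<exists>x\<in>D. sat E D (s(i := x)) \<phi>)"

section \<open>The axioms of ZF\<close>

definition ZF :: "('v \<Rightarrow> 'v \<Rightarrow> bool) \<Rightarrow> bool" where
  "ZF E \<longleftrightarrow>
    \<comment> \<open>Extensionality\<close>
    (\<forall>x y. (\<forall>z. E z x \<longleftrightarrow> E z y) \<longrightarrow> x = y) \<and>
    \<comment> \<open>Foundation\<close>
    (\<forall>x. (\<exists>y. E y x) \<longrightarrow> (\<exists>y. E y x \<and> \<not> (\<exists>z. E z x \<and> E z y))) \<and>
    \<comment> \<open>Pairing\<close>
    (\<forall>x y. \<exists>z. \<forall>u. E u z \<longleftrightarrow> u = x \<or> u = y) \<and>
    \<comment> \<open>Union\<close>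
    (\<forall>x. \<exists>z. \<forall>u. E u z \<longleftrightarrow> (\<exists>y. E y x \<and> E u y)) \<and>
    \<comment> \<open>Power set\<close>
    (\<forall>x. \<exists>z. \<forall>u. E u z \<longleftrightarrow> (\<forall>v. E v u \<longrightarrow> E v x)) \<and>
    \<comment> \<open>Infinity\<close>
    (\<exists>x. (\<exists>e. (\<forall>y. \<not> E y e) \<and> E e x) \<and>
         (\<forall>y. E y x \<longrightarrow> (\<exists>z. E z x \<and> (\<forall>u. E u z \<longleftrightarrow> E u y \<or> u = y)))) \<and>
    \<comment> \<open>Separation; the assignment \<open>s\<close> supplies the parameters\<close>
    (\<forall>\<phi> s a. \<exists>b. \<forall>x. E x b \<longleftrightarrow> E x a \<and> sat E UNIV (s(0 := x)) \<phi>) \<and>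
    \<comment> \<open>Replacement\<close>
    (\<forall>\<phi> s a. (\<forall>x. E x a \<longrightarrow> (\<exists>!y. sat E UNIV (s(0 := x, 1 := y)) \<phi>)) \<longrightarrow>
      (\<exists>b. \<forall>y. E y b \<longleftrightarrow> (\<exists>x. E x a \<and> sat E UNIV (s(0 := x, 1 := y)) \<phi>)))"

section \<open>Basic set theory inside a structure\<close>

definition elts :: "('v \<Rightarrow> 'v \<Rightarrow> bool) \<Rightarrow> 'v \<Rightarrow> 'v set" where
  "elts E x = {y. E y x}"

text \<open>
  \<open>vset E S\<close> is the element of the structure whose extension is \<open>S\<close>. It is meaningful only if there
  is one; it is used below only for \<open>S\<close> for which \<open>ZF E\<close> provides one.
\<close>

definition vset :: "('v \<Rightarrow> 'v \<Rightarrow> bool) \<Rightarrow> 'v set \<Rightarrow> 'v" where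
  "vset E S = (THE x. elts E x = S)"

definition vempty :: "('v \<Rightarrow> 'v \<Rightarrow> bool) \<Rightarrow> 'v" where
  "vempty E = vset E {}"

definition vsucc :: "('v \<Rightarrow> 'v \<Rightarrow> bool) \<Rightarrow> 'v \<Rightarrow> 'v" where
  "vsucc E x = vset E (insert x (elts E x))"

definition vpair :: "('v \<Rightarrow> 'v \<Rightarrow> bool) \<Rightarrow> 'v \<Rightarrow> 'v \<Rightarrow> 'v" where
  "vpair E x y = vset E {vset E {x}, vset E {x, y}}"

definition is_fun :: "('v \<Rightarrow> 'v \<Rightarrow> bool) \<Rightarrow> 'v \<Rightarrow> 'v \<Rightarrow> 'v \<Rightarrow> bool" where
  "is_fun E f A B \<longleftrightarrow>
    (\<forall>p. E p f \<longrightarrow> (\<exists>x y. E x A \<and> E y B \<and> p = vpair E x y)) \<and>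
    (\<forall>x. E x A \<longrightarrow> (\<exists>!y. E (vpair E x y) f))"

definition app :: "('v \<Rightarrow> 'v \<Rightarrow> bool) \<Rightarrow> 'v \<Rightarrow> 'v \<Rightarrow> 'v" where
  "app E f x = (THE y. E (vpair E x y) f)"

definition restr :: "('v \<Rightarrow> 'v \<Rightarrow> bool) \<Rightarrow> 'v \<Rightarrow> 'v \<Rightarrow> 'v" where
  "restr E f A = vset E {p. E p f \<and> (\<exists>x y. E x A \<and> p = vpair E x y)}"

text \<open>By Foundation, a transitive set that is linearly ordered by membership is well-ordered by it.\<close>

definition is_Ord :: "('v \<Rightarrow> 'v \<Rightarrow> bool) \<Rightarrow> 'v \<Rightarrow> bool" where
  "is_Ord E \<alpha> \<longleftrightarrow>
    (\<forall>x y. E x y \<and> E y \<alpha> \<longrightarrow> E x \<alpha>) \<and>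
    (\<forall>x y. E x \<alpha> \<and> E y \<alpha> \<longrightarrow> E x y \<or> x = y \<or> E y x)"

definition is_Limit :: "('v \<Rightarrow> 'v \<Rightarrow> bool) \<Rightarrow> 'v \<Rightarrow> bool" where
  "is_Limit E \<alpha> \<longleftrightarrow> is_Ord E \<alpha> \<and> \<alpha> \<noteq> vempty E \<and> \<not> (\<exists>\<beta>. \<alpha> = vsucc E \<beta>)"

definition omega :: "('v \<Rightarrow> 'v \<Rightarrow> bool) \<Rightarrow> 'v" where
  "omega E = (THE \<alpha>. is_Limit E \<alpha> \<and> (\<forall>\<beta>. E \<beta> \<alpha> \<longrightarrow> \<not> is_Limit E \<beta>))"

definition is_countable :: "('v \<Rightarrow> 'v \<Rightarrow> bool) \<Rightarrow> 'v \<Rightarrow> bool" where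
  "is_countable E A \<longleftrightarrow> (\<exists>f. is_fun E f A (omega E) \<and>
    (\<forall>x y. E x A \<and> E y A \<and> app E f x = app E f y \<longrightarrow> x = y))"

definition omega1 :: "('v \<Rightarrow> 'v \<Rightarrow> bool) \<Rightarrow> 'v" where
  "omega1 E = (THE \<alpha>. is_Ord E \<alpha> \<and> \<not> is_countable E \<alpha> \<and> (\<forall>\<beta>. E \<beta> \<alpha> \<longrightarrow> is_countable E \<beta>))"

text \<open>As usual in the context of determinacy, a real is an element of Baire space.\<close>

definition reals :: "('v \<Rightarrow> 'v \<Rightarrow> bool) \<Rightarrow> 'v" where
  "reals E = vset E {x. is_fun E x (omega E) (omega E)}"

text \<open>\<open>incseqs E A\<close> is $[A]^\omega$.\<close>

definition incseqs :: "('v \<Rightarrow> 'v \<Rightarrow> bool) \<Rightarrow> 'v \<Rightarrow> 'v" where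
  "incseqs E A = vset E {f. is_fun E f (omega E) A \<and>
    (\<forall>m n. E n (omega E) \<and> E m n \<longrightarrow> E (app E f m) (app E f n))}"

section \<open>The axiom of determinacy\<close>

definition finseqs :: "('v \<Rightarrow> 'v \<Rightarrow> bool) \<Rightarrow> 'v" where
  "finseqs E = vset E {s. \<exists>n. E n (omega E) \<and> is_fun E s n (omega E)}"

definition is_even :: "('v \<Rightarrow> 'v \<Rightarrow> bool) \<Rightarrow> 'v \<Rightarrow> bool" where
  "is_even E n \<longleftrightarrow> E n (omega E) \<and>
    (\<forall>e. E (vempty E) e \<and> (\<forall>k. E k e \<longrightarrow> E (vsucc E (vsucc E k)) e) \<longrightarrow> E n e)"

text \<open>
  A strategy is a function from finite sequences of natural numbers to natural numbers. Player I
  moves at even and player II at odd stages; the values of a strategy at positions where the other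
  player is to move are irrelevant. Player I wins the run \<open>x\<close> of the game with payoff set \<open>A\<close> iff
  \<open>x \<in> A\<close>.
\<close>

definition AD :: "('v \<Rightarrow> 'v \<Rightarrow> bool) \<Rightarrow> bool" where
  "AD E \<longleftrightarrow> (\<forall>A. elts E A \<subseteq> elts E (reals E) \<longrightarrow>
    (\<exists>\<tau>. is_fun E \<tau> (finseqs E) (omega E) \<and>
      (\<forall>x. E x (reals E) \<and>
        (\<forall>n. E n (omega E) \<and> is_even E n \<longrightarrow> app E x n = app E \<tau> (restr E x n)) \<longrightarrow> E x A)) \<or>
    (\<exists>\<tau>. is_fun E \<tau> (finseqs E) (omega E) \<and>
      (\<forall>x. E x (reals E) \<and>
        (\<forall>n. E n (omega E) \<and> \<not> is_even E n \<longrightarrow> app E x n = app E \<tau> (restr E x n)) \<longrightarrow> \<not> E x A)))"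

section \<open>Relative constructibility\<close>

text \<open>
  Definability over \<open>(A, \<in>, a \<inter> A)\<close> for \<open>a \<in> set as\<close> has to be expressed inside the structure, hence
  by internal (possibly nonstandard) formulas. As in Kunen's ``Set Theory'', the definable
  relations are generated from the atomic ones by complement, intersection and projection.
  \<open>def_closed E as A F\<close> says that the set \<open>F\<close> of pairs \<open>(n, R)\<close>, with \<open>R\<close> an \<open>n\<close>-ary relation on
  \<open>A\<close>, is closed under this; an \<open>n\<close>-tuple is a function from \<open>n\<close> to \<open>A\<close>.
\<close>

definition def_closed :: "('v \<Rightarrow> 'v \<Rightarrow> bool) \<Rightarrow> 'v list \<Rightarrow> 'v \<Rightarrow> 'v \<Rightarrow> bool" where
  "def_closed E as A F \<longleftrightarrow> (\<forall>n. E n (omega E) \<longrightarrow>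
    (\<forall>i j. E i n \<and> E j n \<longrightarrow>
      E (vpair E n (vset E {s. is_fun E s n A \<and> E (app E s i) (app E s j)})) F) \<and>
    (\<forall>i j. E i n \<and> E j n \<longrightarrow>
      E (vpair E n (vset E {s. is_fun E s n A \<and> app E s i = app E s j})) F) \<and>
    (\<forall>a\<in>set as. \<forall>i. E i n \<longrightarrow>
      E (vpair E n (vset E {s. is_fun E s n A \<and> E (app E s i) a})) F) \<and>
    (\<forall>R. E (vpair E n R) F \<longrightarrow>
      E (vpair E n (vset E {s. is_fun E s n A \<and> \<not> E s R})) F) \<and>
    (\<forall>R S. E (vpair E n R) F \<and> E (vpair E n S) F \<longrightarrow>
      E (vpair E n (vset E (elts E R \<inter> elts E S))) F) \<and>
    (\<forall>R. E (vpair E (vsucc E n) R) F \<longrightarrow>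
      E (vpair E n (vset E {s. is_fun E s n A \<and> (\<exists>t. E t R \<and> restr E t n = s)})) F))"

definition definable_rel :: "('v \<Rightarrow> 'v \<Rightarrow> bool) \<Rightarrow> 'v list \<Rightarrow> 'v \<Rightarrow> 'v \<Rightarrow> 'v \<Rightarrow> bool" where
  "definable_rel E as A n R \<longleftrightarrow> (\<forall>F. def_closed E as A F \<longrightarrow> E (vpair E n R) F)"

text \<open>The subsets of \<open>A\<close> definable with parameters; the tuple \<open>s\<close> lists the parameters.\<close>

definition Def :: "('v \<Rightarrow> 'v \<Rightarrow> bool) \<Rightarrow> 'v list \<Rightarrow> 'v \<Rightarrow> 'v" where
  "Def E as A = vset E {X. \<exists>n s R. E n (omega E) \<and> is_fun E s n A \<and>
    definable_rel E as A (vsucc E n) R \<and>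
    elts E X = {x. E x A \<and> E (vset E (insert (vpair E n x) (elts E s))) R}}"

text \<open>\<open>is_level E as \<alpha> B\<close>: \<open>B\<close> is the level $L_\alpha[as]$ of the hierarchy; \<open>g\<close> is the recursion up to \<open>\<alpha>\<close>.\<close>

definition is_level :: "('v \<Rightarrow> 'v \<Rightarrow> bool) \<Rightarrow> 'v list \<Rightarrow> 'v \<Rightarrow> 'v \<Rightarrow> bool" where
  "is_level E as \<alpha> B \<longleftrightarrow> is_Ord E \<alpha> \<and>
    (\<exists>g C. is_fun E g (vsucc E \<alpha>) C \<and>
      app E g (vempty E) = vempty E \<and>
      (\<forall>\<beta>. E \<beta> \<alpha> \<longrightarrow> app E g (vsucc E \<beta>) = Def E as (app E g \<beta>)) \<and>
      (\<forall>\<beta>. E \<beta> (vsucc E \<alpha>) \<and> is_Limit E \<beta> \<longrightarrow>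
        elts E (app E g \<beta>) = (\<Union>\<gamma>\<in>elts E \<beta>. elts E (app E g \<gamma>))) \<and>
      app E g \<alpha> = B)"

text \<open>The class $L[a_1,\dots,a_n]$ of the structure.\<close>

definition L :: "('v \<Rightarrow> 'v \<Rightarrow> bool) \<Rightarrow> 'v list \<Rightarrow> 'v set" where
  "L E as = {x. \<exists>\<alpha> B. is_level E as \<alpha> B \<and> E x B}"

end

theory Submission
  imports Defs
begin

text \<open>
  Under \<open>AD\<close>, every \<open>\<Phi> : [\<omega>\<^sub>1]\<^sup>\<omega> \<rightarrow> \<real>\<close> is even constant on \<open>[X]\<^sup>\<omega>\<close> for some uncountable \<open>X\<close>; if \<open>r\<close>
  is the constant value, then \<open>\<sigma> = w = r\<close> and the formula \<open>z = \<sigma>\<close> do, because \<open>r \<in> L[r]\<close>.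

  For a single bit of \<open>\<Phi>(f)\<close> the players of Martin's game build relations on \<open>\<omega>\<close> with designated
  nodes \<open>(k, j)\<close>; the player whose relation is the first, in the lexicographic order of the nodes,
  to be ill-founded below a node loses. If both relations are well-founded below all of them, the
  players have produced the sequence \<open>f\<close> in which \<open>f(k)\<close> is the supremum over \<open>j\<close> of the ranks of
  \<open>(k, j)\<close> in the two relations, and the bit of \<open>\<Phi>(f)\<close> decides. By the boundedness lemma, a
  winning strategy keeps the rank of \<open>(k, j)\<close> below a countable bound computed from the ranks of
  the opponent's nodes up to \<open>(k, j)\<close>. If all \<open>f(k)\<close> are closed under these bounds, then the
  opponent can force the outcome \<open>f\<close>, so the bit depends only on who has a winning strategy.
  Countable choice for reals, itself a consequence of \<open>AD\<close>, treats all bits at once.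

  As separation and replacement hold for formulas only, every set formation needs a proof of
  definability: \<open>pd P\<close> says that \<open>P\<close> is definable with parameters in the variables \<open>s 0, s 1, \<dots>\<close>,
  and \<open>ft t\<close> that the graph of \<open>t\<close> is. Both classes are closed under the rules \<open>dfi\<close>, where a bound
  variable becomes \<open>s 0\<close> and the other variables are shifted.
\<close>

section \<open>Definability with parameters\<close>

text \<open>The lexicographic order of the nodes is what makes the outcome controllable. Up to
  \<open>(k, j)\<close> a player has shown the complete rows before \<open>k\<close>, but only
  finitely many nodes of row \<open>k\<close>. If \<open>f\<close> is increasing with limit values,
  an opponent who plays copies of the orders \<open>f(k)\<close> has therefore shown only ranks
  bounded by some \<open>a < f(k)\<close>. The strategy answers below a bound computed from
  \<open>a\<close>, hence below \<open>f(k)\<close>, while the opponent's own row, taken over all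
  \<open>j\<close>, leads to exactly \<open>f(k)\<close>.

  The bound exists because a run, a ranking and a descending path can all be approximated by finite
  sequences: a tree of such attempts has no infinite branch, since a winning strategy never fails at
  a node up to which the opponent is well-founded.

  As \<omega> may be nonstandard, induction and recursion exist for definable predicates and terms
  only.\<close>

lemma finite_fv: "finite (fv \<phi>)"
  by (induction \<phi>) auto

lemma sat_cong:
  "(\<And>i. i \<in> fv \<phi> \<Longrightarrow> s i = t i) \<Longrightarrow> sat E D s \<phi> = sat E D t \<phi>"
proof (induction \<phi> arbitrary: s t)
  case (Exists i \<phi>)
  have "sat E D (s(i := x)) \<phi> = sat E D (t(i := x)) \<phi>" for x
    by (rule Exists.IH) (use Exists.prems in auto)
  then show ?case by simp
next
  case (Conj \<phi> \<psi>)
  have "sat E D s \<phi> = sat E D t \<phi>" by (rule Conj.IH(1)) (simp add: Conj.prems)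
  moreover have "sat E D s \<psi> = sat E D t \<psi>" by (rule Conj.IH(2)) (simp add: Conj.prems)
  ultimately show ?case by simp
next
  case (Neg \<phi>)
  have "sat E D s \<phi> = sat E D t \<phi>" by (rule Neg.IH) (simp add: Neg.prems)
  then show ?case by simp
next
  case (Mem i j)
  show ?case by (simp add: Mem)
next
  case (Eq i j)
  show ?case by (simp add: Eq)
qed

text \<open>Capture is the only obstacle, as \<open>r\<close> may identify variables: the bound
  variable is sent to an index \<open>k\<close> outside the image under \<open>r\<close> of the free
  variables of the body, which is finite.\<close>

lemma sat_rename: "\<exists>\<psi>. \<forall>s. sat E D s \<psi> = sat E D (\<lambda>n. s (r n)) \<phi>"
proof (induction \<phi> arbitrary: r)
  case (Mem i j)
  show ?case by (rule exI[of _ "Mem (r i) (r j)"]) simp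
next
  case (Eq i j)
  show ?case by (rule exI[of _ "Eq (r i) (r j)"]) simp
next
  case (Neg \<phi>)
  then obtain \<psi> where "\<forall>s. sat E D s \<psi> = sat E D (\<lambda>n. s (r n)) \<phi>" by blast
  then show ?case by (intro exI[of _ "Neg \<psi>"]) simp
next
  case (Conj \<phi>1 \<phi>2)
  obtain \<psi>1 where 1: "\<forall>s. sat E D s \<psi>1 = sat E D (\<lambda>n. s (r n)) \<phi>1" using Conj by blast
  obtain \<psi>2 where 2: "\<forall>s. sat E D s \<psi>2 = sat E D (\<lambda>n. s (r n)) \<phi>2" using Conj by blast
  show ?case using 1 2 by (intro exI[of _ "Conj \<psi>1 \<psi>2"]) simp
next
  case (Exists i \<phi>)
  have "finite (r ` fv \<phi>)" by (simp add: finite_fv)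
  then obtain k where k: "k \<notin> r ` fv \<phi>" using ex_new_if_finite infinite_UNIV_nat by blast
  obtain \<psi> where \<psi>: "\<forall>s. sat E D s \<psi> = sat E D (\<lambda>n. s ((r(i := k)) n)) \<phi>"
    using Exists by blast
  have "sat E D s (Exists k \<psi>) = sat E D (\<lambda>n. s (r n)) (Exists i \<phi>)" for s
  proof -
    have "sat E D (s(k := x)) \<psi> = sat E D ((\<lambda>n. s (r n))(i := x)) \<phi>" for x
      unfolding \<psi>[rule_format] by (rule sat_cong) (use k in auto)
    then show ?thesis by simp
  qed
  then show ?case by blast
qed

text \<open>Interleaving keeps infinitely many even places for parameters and the odd ones for
  variables; the parameters of two formulas can be merged by \<open>mrg\<close> again.\<close>

definition mrg :: "(nat \<Rightarrow> 'a) \<Rightarrow> (nat \<Rightarrow> 'a) \<Rightarrow> nat \<Rightarrow> 'a" where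
  "mrg p s n = (if even n then p (n div 2) else s (n div 2))"

lemma mrg_simps [simp]: "mrg p s (2 * n) = p n" "mrg p s (Suc (2 * n)) = s n"
  by (simp_all add: mrg_def)

named_theorems dfi

locale zf =
  fixes E :: "'v \<Rightarrow> 'v \<Rightarrow> bool"
  assumes ZF: "ZF E"
begin

text \<open>\<open>p\<close> is an arbitrary external sequence, but a formula reads only finitely
  many of its values. These are first-order parameters, so separation and replacement can be used
  for such predicates.\<close>

definition pd :: "((nat \<Rightarrow> 'v) \<Rightarrow> bool) \<Rightarrow> bool" where
  "pd P \<longleftrightarrow> (\<exists>\<phi> p. \<forall>s. P s \<longleftrightarrow> sat E UNIV (mrg p s) \<phi>)"

definition ft :: "((nat \<Rightarrow> 'v) \<Rightarrow> 'v) \<Rightarrow> bool" where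
  "ft t \<longleftrightarrow> pd (\<lambda>s. s 0 = t (\<lambda>n. s (Suc n)))"

lemma pd_iffI: "(\<And>s. P s \<longleftrightarrow> Q s) \<Longrightarrow> pd Q \<Longrightarrow> pd P"
  by (simp add: pd_def)

lemma pd_inst: "pd Q \<Longrightarrow> pd (\<lambda>s. Q (\<lambda>n. if b n then s (r n) else s0 n))"
proof -
  assume "pd Q"
  then obtain \<phi> p where Q: "\<And>s. Q s \<longleftrightarrow> sat E UNIV (mrg p s) \<phi>" unfolding pd_def by blast
  \<comment> \<open>Variables with \<open>b n\<close> false become parameters: their values
    \<open>s0 n\<close> occupy the odd places of the new parameter sequence \<open>mrg p s0\<close>,
    the old parameters the even ones.\<close>
  let ?r = "\<lambda>n. if even n then 2 * (2 * (n div 2)) else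
    if b (n div 2) then Suc (2 * r (n div 2)) else 2 * Suc (2 * (n div 2))"
  obtain \<psi> where \<psi>: "\<And>s. sat E UNIV s \<psi> = sat E UNIV (\<lambda>n. s (?r n)) \<phi>"
    using sat_rename[of E UNIV ?r \<phi>] by blast
  have "(\<lambda>n. mrg (mrg p s0) s (?r n)) = mrg p (\<lambda>n. if b n then s (r n) else s0 n)" for s
  proof
    fix n
    show "mrg (mrg p s0) s (?r n) = mrg p (\<lambda>n. if b n then s (r n) else s0 n) n"
      by (simp only: mrg_simps if_distrib[of "mrg (mrg p s0) s"]) (simp add: mrg_def)
  qed
  then show ?thesis unfolding pd_def Q
    by (intro exI[of _ \<psi>] exI[of _ "mrg p s0"]) (simp only: \<psi> simp_thms)
qed

lemma pd_rename: "pd P \<Longrightarrow> pd (\<lambda>s. P (\<lambda>n. s (r n)))"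
  using pd_inst[of P "\<lambda>_. True" r undefined] by simp

lemma ft_rename: "ft t \<Longrightarrow> ft (\<lambda>s. t (\<lambda>n. s (r n)))"
  unfolding ft_def
  using pd_rename[of "\<lambda>s. s 0 = t (\<lambda>n. s (Suc n))" "\<lambda>n. case n of 0 \<Rightarrow> 0 | Suc m \<Rightarrow> Suc (r m)"]
  by simp

section \<open>Closure of the definable predicates and terms\<close>

lemma pd_neg [dfi]: "pd P \<Longrightarrow> pd (\<lambda>s. \<not> P s)"
proof -
  assume "pd P"
  then obtain \<phi> p where "\<And>s. P s \<longleftrightarrow> sat E UNIV (mrg p s) \<phi>" unfolding pd_def by blast
  then show ?thesis unfolding pd_def by (intro exI[of _ "Neg \<phi>"] exI[of _ p]) simp
qed

lemma pd_conj [dfi]: "pd P \<Longrightarrow> pd Q \<Longrightarrow> pd (\<lambda>s. P s \<and> Q s)"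
proof -
  assume "pd P" "pd Q"
  then obtain \<phi> p \<chi> q where P: "\<And>s. P s \<longleftrightarrow> sat E UNIV (mrg p s) \<phi>"
    and Q: "\<And>s. Q s \<longleftrightarrow> sat E UNIV (mrg q s) \<chi>" unfolding pd_def by blast
  let ?r1 = "\<lambda>n. if even n then 2 * (2 * (n div 2)) else n"
  let ?r2 = "\<lambda>n. if even n then 2 * Suc (2 * (n div 2)) else n"
  obtain \<psi>1 where 1: "\<And>s. sat E UNIV s \<psi>1 = sat E UNIV (\<lambda>n. s (?r1 n)) \<phi>"
    using sat_rename[of E UNIV ?r1 \<phi>] by blast
  obtain \<psi>2 where 2: "\<And>s. sat E UNIV s \<psi>2 = sat E UNIV (\<lambda>n. s (?r2 n)) \<chi>"
    using sat_rename[of E UNIV ?r2 \<chi>] by blast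
  have e1: "(\<lambda>n. mrg (mrg p q) s (?r1 n)) = mrg p s" for s
    by (rule ext, simp only: if_distrib[of "mrg (mrg p q) s"] mrg_simps) (simp add: mrg_def)
  have e2: "(\<lambda>n. mrg (mrg p q) s (?r2 n)) = mrg q s" for s
    by (rule ext, simp only: if_distrib[of "mrg (mrg p q) s"] mrg_simps) (simp add: mrg_def)
  show ?thesis unfolding pd_def P Q
    by (intro exI[of _ "Conj \<psi>1 \<psi>2"] exI[of _ "mrg p q"]) (simp add: 1 2 e1 e2)
qed

lemma pd_ex [dfi]: "pd (\<lambda>s. P (\<lambda>n. s (Suc n)) (s 0)) \<Longrightarrow> pd (\<lambda>s. \<exists>x. P s x)"
proof -
  assume "pd (\<lambda>s. P (\<lambda>n. s (Suc n)) (s 0))"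
  then obtain \<phi> p where P: "\<And>s. P (\<lambda>n. s (Suc n)) (s 0) \<longleftrightarrow> sat E UNIV (mrg p s) \<phi>"
    unfolding pd_def by blast
  have P': "P s x \<longleftrightarrow> sat E UNIV (mrg p (case_nat x s)) \<phi>" for s x
    using P[of "case_nat x s"] by simp
  \<comment> \<open>The bound variable moves from place 1, which holds \<open>s 0\<close>, to a
    place \<open>k\<close> above all those that the formula reads; the other variables shift down by
    one, that is by two places of \<open>mrg\<close>.\<close>
  define k where "k = Suc (Max (insert 0 (fv \<phi>)))"
  have k: "i < k" if "i \<in> fv \<phi>" for i
    using that finite_fv[of \<phi>] by (simp add: k_def less_Suc_eq_le)
  let ?r = "\<lambda>n. if even n then n else if n = 1 then k else n - 2"
  obtain \<psi> where \<psi>: "\<And>s. sat E UNIV s \<psi> = sat E UNIV (\<lambda>n. s (?r n)) \<phi>"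
    using sat_rename[of E UNIV ?r \<phi>] by blast
  have "sat E UNIV ((mrg p s)(k := x)) \<psi> = sat E UNIV (mrg p (case_nat x s)) \<phi>" for s x
    unfolding \<psi>
  proof (rule sat_cong)
    fix i assume i: "i \<in> fv \<phi>"
    show "((mrg p s)(k := x)) (?r i) = mrg p (case_nat x s) i"
    proof (cases "even i")
      case True
      then show ?thesis using k[OF i] by (simp add: mrg_def)
    next
      case False
      then obtain m where m: "i = Suc (2 * m)" by (metis oddE Suc_eq_plus1)
      show ?thesis
      proof (cases m)
        case 0
        then show ?thesis using m by (simp add: mrg_def)
      next
        case (Suc m')
        then show ?thesis using m k[OF i] by (simp add: mrg_def)
      qed
    qed
  qed
  then show ?thesis unfolding pd_def P'
    by (intro exI[of _ "Exists k \<psi>"] exI[of _ p]) simp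
qed

text \<open>A statement that ignores the assignment is simply true or false, however it is
  formulated: definability constrains only the dependence on \<open>s\<close>.\<close>

lemma pd_const [dfi]: "pd (\<lambda>s. c)"
  unfolding pd_def
  by (rule exI[of _ "if c then Eq 0 0 else Neg (Eq 0 0)"], rule exI[of _ undefined]) simp

lemma pd_disj [dfi]: "pd P \<Longrightarrow> pd Q \<Longrightarrow> pd (\<lambda>s. P s \<or> Q s)"
  by (rule pd_iffI[of _ "\<lambda>s. \<not> (\<not> P s \<and> \<not> Q s)"]) (blast, intro pd_neg pd_conj)

lemma pd_imp [dfi]: "pd P \<Longrightarrow> pd Q \<Longrightarrow> pd (\<lambda>s. P s \<longrightarrow> Q s)"
  by (rule pd_iffI[of _ "\<lambda>s. \<not> (P s \<and> \<not> Q s)"]) (blast, intro pd_neg pd_conj)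

lemma pd_iff [dfi]: "pd P \<Longrightarrow> pd Q \<Longrightarrow> pd (\<lambda>s. P s \<longleftrightarrow> Q s)"
  by (rule pd_iffI[of _ "\<lambda>s. (P s \<longrightarrow> Q s) \<and> (Q s \<longrightarrow> P s)"]) (blast, intro pd_imp pd_conj)

lemma pd_all [dfi]: "pd (\<lambda>s. P (\<lambda>n. s (Suc n)) (s 0)) \<Longrightarrow> pd (\<lambda>s. \<forall>x. P s x)"
  by (rule pd_iffI[of _ "\<lambda>s. \<not> (\<exists>x. \<not> P s x)"]) (blast, intro pd_neg pd_ex)

lemma pd_mem0: "pd (\<lambda>s. E (s i) (s j))"
  unfolding pd_def
  by (intro exI[of _ "Mem (Suc (2 * i)) (Suc (2 * j))"] exI[of _ undefined]) simp

lemma pd_eq0: "pd (\<lambda>s. s i = s j)"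
  unfolding pd_def
  by (intro exI[of _ "Eq (Suc (2 * i)) (Suc (2 * j))"] exI[of _ undefined]) simp

lemma pd_eqc: "pd (\<lambda>s. s i = c)"
  unfolding pd_def by (intro exI[of _ "Eq (Suc (2 * i)) 0"] exI[of _ "\<lambda>_. c"]) (simp add: mrg_def)

lemma ft_var [dfi]: "ft (\<lambda>s. s i)"
  unfolding ft_def by (rule pd_eq0)

lemma ft_const [dfi]: "ft (\<lambda>s. c)"
  unfolding ft_def by (rule pd_eqc)

text \<open>Terms are known through their graphs only, so substitution becomes an existential
  quantifier over the value. It reduces relations between terms to relations between
  variables.\<close>

lemma pd_subst: "pd (\<lambda>s. P (\<lambda>n. s (Suc n)) (s 0)) \<Longrightarrow> ft t \<Longrightarrow> pd (\<lambda>s. P s (t s))"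
  unfolding ft_def
  by (rule pd_iffI[of _ "\<lambda>s. \<exists>x. x = t s \<and> P s x"]) (blast, intro pd_ex pd_conj)

lemma pd_1: "pd (\<lambda>s. R (s 0)) \<Longrightarrow> ft a \<Longrightarrow> pd (\<lambda>s. R (a s))"
  by (rule pd_subst[of "\<lambda>s x. R x"])

lemma pd_2:
  assumes "pd (\<lambda>s. R (s 0) (s 1))" "ft a" "ft b" shows "pd (\<lambda>s. R (a s) (b s))"
proof (rule pd_subst[of "\<lambda>s x. R x (b s)" a])
  show "pd (\<lambda>s. R (s 0) (b (\<lambda>n. s (Suc n))))"
  proof (rule pd_subst[of "\<lambda>s x. R (s 0) x" "\<lambda>s. b (\<lambda>n. s (Suc n))"])
    show "pd (\<lambda>s. R (s (Suc 0)) (s 0))"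
      using pd_rename[OF assms(1), of "\<lambda>n. if n = 0 then 1 else 0"] by simp
    show "ft (\<lambda>s. b (\<lambda>n. s (Suc n)))" by (rule ft_rename) fact
  qed
qed fact

lemma pd_3:
  assumes "pd (\<lambda>s. R (s 0) (s 1) (s 2))" "ft a" "ft b" "ft c"
  shows "pd (\<lambda>s. R (a s) (b s) (c s))"
proof (rule pd_subst[of "\<lambda>s x. R x (b s) (c s)" a])
  show "pd (\<lambda>s. R (s 0) (b (\<lambda>n. s (Suc n))) (c (\<lambda>n. s (Suc n))))"
  proof (rule pd_subst[of "\<lambda>s x. R (s 0) x (c (\<lambda>n. s (Suc n)))" "\<lambda>s. b (\<lambda>n. s (Suc n))"])
    show "pd (\<lambda>s. R (s (Suc 0)) (s 0) (c (\<lambda>n. s (Suc (Suc n)))))"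
    proof (rule pd_subst[of "\<lambda>s x. R (s (Suc 0)) (s 0) x" "\<lambda>s. c (\<lambda>n. s (Suc (Suc n)))"])
      show "pd (\<lambda>s. R (s (Suc (Suc 0))) (s (Suc 0)) (s 0))"
        using pd_rename[OF assms(1), of "\<lambda>n. 2 - n"] by (simp add: numeral_2_eq_2)
      show "ft (\<lambda>s. c (\<lambda>n. s (Suc (Suc n))))" by (rule ft_rename) fact
    qed
    show "ft (\<lambda>s. b (\<lambda>n. s (Suc n)))" by (rule ft_rename) fact
  qed
qed fact

lemma pd_4:
  assumes "pd (\<lambda>s. R (s 0) (s 1) (s 2) (s 3))" "ft a" "ft b" "ft c" "ft d"
  shows "pd (\<lambda>s. R (a s) (b s) (c s) (d s))"
proof (rule pd_subst[of "\<lambda>s x. R x (b s) (c s) (d s)" a])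
  show "pd (\<lambda>s. R (s 0) (b (\<lambda>n. s (Suc n))) (c (\<lambda>n. s (Suc n))) (d (\<lambda>n. s (Suc n))))"
  proof (rule pd_subst[of "\<lambda>s x. R (s 0) x (c (\<lambda>n. s (Suc n))) (d (\<lambda>n. s (Suc n)))"
          "\<lambda>s. b (\<lambda>n. s (Suc n))"])
    show "pd (\<lambda>s. R (s (Suc 0)) (s 0) (c (\<lambda>n. s (Suc (Suc n)))) (d (\<lambda>n. s (Suc (Suc n)))))"
    proof (rule pd_subst[of "\<lambda>s x. R (s (Suc 0)) (s 0) x (d (\<lambda>n. s (Suc (Suc n))))"
            "\<lambda>s. c (\<lambda>n. s (Suc (Suc n)))"])
      show "pd (\<lambda>s. R (s (Suc (Suc 0))) (s (Suc 0)) (s 0) (d (\<lambda>n. s (Suc (Suc (Suc n))))))"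
      proof (rule pd_subst[of "\<lambda>s x. R (s (Suc (Suc 0))) (s (Suc 0)) (s 0) x"
              "\<lambda>s. d (\<lambda>n. s (Suc (Suc (Suc n))))"])
        show "pd (\<lambda>s. R (s (Suc (Suc (Suc 0)))) (s (Suc (Suc 0))) (s (Suc 0)) (s 0))"
          using pd_rename[OF assms(1), of "\<lambda>n. 3 - n"]
          by (simp add: numeral_2_eq_2 numeral_3_eq_3)
        show "ft (\<lambda>s. d (\<lambda>n. s (Suc (Suc (Suc n)))))" by (rule ft_rename) fact
      qed
      show "ft (\<lambda>s. c (\<lambda>n. s (Suc (Suc n))))" by (rule ft_rename) fact
    qed
    show "ft (\<lambda>s. b (\<lambda>n. s (Suc n)))" by (rule ft_rename) fact
  qed
qed fact

lemma ft_1: "ft (\<lambda>s. F (s 0)) \<Longrightarrow> ft a \<Longrightarrow> ft (\<lambda>s. F (a s))"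
  unfolding ft_def[of "\<lambda>s. F (a s)"] ft_def[of "\<lambda>s. F (s 0)"]
  by (rule pd_2[of "\<lambda>x y. x = F y"]) (unfold One_nat_def, assumption, rule ft_var, erule ft_rename)

lemma ft_2: "ft (\<lambda>s. F (s 0) (s 1)) \<Longrightarrow> ft a \<Longrightarrow> ft b \<Longrightarrow> ft (\<lambda>s. F (a s) (b s))"
  unfolding ft_def[of "\<lambda>s. F (a s) (b s)"] ft_def[of "\<lambda>s. F (s 0) (s 1)"]
  by (rule pd_3[of "\<lambda>x y z. x = F y z"])
    (unfold One_nat_def numeral_2_eq_2, assumption, rule ft_var, (erule ft_rename)+)

lemma pd_mem [dfi]: "ft a \<Longrightarrow> ft b \<Longrightarrow> pd (\<lambda>s. E (a s) (b s))"
  by (rule pd_2[of E]) (rule pd_mem0)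

lemma pd_eq [dfi]: "ft a \<Longrightarrow> ft b \<Longrightarrow> pd (\<lambda>s. a s = b s)"
  by (rule pd_2[of "(=)"]) (rule pd_eq0)

lemma pd_ex1 [dfi]: "pd (\<lambda>s. P (\<lambda>n. s (Suc n)) (s 0)) \<Longrightarrow> pd (\<lambda>s. \<exists>!x. P s x)"
proof (rule pd_iffI[of _ "\<lambda>s. \<exists>x. P s x \<and> (\<forall>y. P s y \<longrightarrow> y = x)"])
  assume *: "pd (\<lambda>s. P (\<lambda>n. s (Suc n)) (s 0))"
  have "pd (\<lambda>s. P (\<lambda>n. s (Suc (Suc n))) (s 0))"
    using pd_rename[OF *, of "\<lambda>n. case n of 0 \<Rightarrow> 0 | Suc m \<Rightarrow> Suc n"] by simp
  then show "pd (\<lambda>s. \<exists>x. P s x \<and> (\<forall>y. P s y \<longrightarrow> y = x))"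
    by (intro pd_ex pd_conj pd_all pd_imp pd_eq * ft_var)
qed blast

lemma pd_if [dfi]: "pd P \<Longrightarrow> pd Q \<Longrightarrow> pd R \<Longrightarrow> pd (\<lambda>s. if P s then Q s else R s)"
  by (rule pd_iffI[of _ "\<lambda>s. (P s \<and> Q s) \<or> (\<not> P s \<and> R s)"]) (simp, intro pd_disj pd_conj pd_neg)

lemma ft_if [dfi]: "pd P \<Longrightarrow> ft a \<Longrightarrow> ft b \<Longrightarrow> ft (\<lambda>s. if P s then a s else b s)"
  unfolding ft_def[of "\<lambda>s. if P s then a s else b s"]
  by (rule pd_iffI[of _ "\<lambda>s. if P (\<lambda>n. s (Suc n)) then s 0 = a (\<lambda>n. s (Suc n))
       else s 0 = b (\<lambda>n. s (Suc n))"])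
    (simp, unfold ft_def, rule pd_if, erule pd_rename)

text \<open>The list is external, hence of standard finite length: the quantifier is a finite
  conjunction.\<close>

lemma pd_ball_list [dfi]:
  assumes "\<And>a. a \<in> set as \<Longrightarrow> pd (\<lambda>s. P s a)" shows "pd (\<lambda>s. \<forall>a\<in>set as. P s a)"
  using assms
proof (induction as)
  case (Cons a as)
  then have "pd (\<lambda>s. P s a \<and> (\<forall>a\<in>set as. P s a))" by (intro pd_conj) simp_all
  then show ?case by simp
qed (simp add: pd_const)

text \<open>The default value makes the graph definable everywhere. Where there is no unique
  witness, the value of \<open>THE\<close> could depend on the assignment in an undefinable
  way.\<close>

definition dd :: "('v \<Rightarrow> bool) \<Rightarrow> 'v" where
  "dd P = (if \<exists>!y. P y then THE y. P y else vempty E)"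

lemma dd_eq: "P y \<Longrightarrow> (\<And>z. P z \<Longrightarrow> z = y) \<Longrightarrow> dd P = y"
  unfolding dd_def by (metis (mono_tags) the_equality)

lemma dd_prop: "\<exists>!y. P y \<Longrightarrow> P (dd P)"
  unfolding dd_def by (simp add: theI')

lemma ft_dd [dfi]:
  assumes *: "pd (\<lambda>s. P (\<lambda>n. s (Suc n)) (s 0))" shows "ft (\<lambda>s. dd (P s))"
  unfolding ft_def
proof (rule pd_iffI[of _ "\<lambda>s. if \<exists>!y. P (\<lambda>n. s (Suc n)) y then P (\<lambda>n. s (Suc n)) (s 0)
      else s 0 = vempty E"])
  have 1: "pd (\<lambda>s. P (\<lambda>n. s (Suc (Suc n))) (s 0))"
    using pd_rename[OF *, of "\<lambda>n. case n of 0 \<Rightarrow> 0 | Suc m \<Rightarrow> Suc n"] by simp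
  show "pd (\<lambda>s. if \<exists>!y. P (\<lambda>n. s (Suc n)) y then P (\<lambda>n. s (Suc n)) (s 0) else s 0 = vempty E)"
    by (rule pd_if, rule pd_ex1, rule 1, rule *, rule pd_eqc)
next
  fix s
  show "(s 0 = dd (P (\<lambda>n. s (Suc n)))) = (if \<exists>!y. P (\<lambda>n. s (Suc n)) y
     then P (\<lambda>n. s (Suc n)) (s 0) else s 0 = vempty E)"
  proof (cases "\<exists>!y. P (\<lambda>n. s (Suc n)) y")
    case True
    from dd_prop[OF this] True show ?thesis by auto
  qed (simp add: dd_def)
qed

text \<open>The axiom keeps place 0 for the element and the other places for parameters. As
  \<open>P\<close> sees only \<open>s 0\<close>, all variables may be collapsed to place 0, while
  parameter \<open>i\<close> goes to place \<open>i + 1\<close>.\<close>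

lemma sep_ex:
  assumes "pd (\<lambda>s. P (s 0))" shows "\<exists>b. \<forall>x. E x b \<longleftrightarrow> E x a \<and> P x"
proof -
  obtain \<phi> p where P: "\<And>s. P (s 0) \<longleftrightarrow> sat E UNIV (mrg p s) \<phi>" using assms unfolding pd_def by blast
  let ?r = "\<lambda>n. if even n then Suc (n div 2) else 0"
  obtain \<psi> where \<psi>: "\<And>s. sat E UNIV s \<psi> = sat E UNIV (\<lambda>n. s (?r n)) \<phi>"
    using sat_rename[of E UNIV ?r \<phi>] by blast
  have "(\<lambda>n. ((case_nat x p)(0 := x)) (?r n)) = mrg p (\<lambda>_. x)" for x
    by (auto simp: mrg_def fun_eq_iff)
  then have "sat E UNIV ((case_nat undefined p)(0 := x)) \<psi> \<longleftrightarrow> P x" for x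
    using P[of "\<lambda>_. x"] unfolding \<psi> by (simp add: mrg_def[abs_def] if_distrib cong: if_cong)
  moreover have "\<exists>b. \<forall>x. E x b \<longleftrightarrow> E x a \<and> sat E UNIV ((case_nat undefined p)(0 := x)) \<psi>"
    using ZF unfolding ZF_def by blast
  ultimately show ?thesis by simp
qed

lemma rep_ex:
  assumes "ft (\<lambda>s. F (s 0))" shows "\<exists>b. \<forall>y. E y b \<longleftrightarrow> (\<exists>x. E x a \<and> y = F x)"
proof -
  obtain \<phi> p where P: "\<And>s. s 0 = F (s (Suc 0)) \<longleftrightarrow> sat E UNIV (mrg p s) \<phi>"
    using assms unfolding ft_def pd_def by blast
  let ?r = "\<lambda>n. if even n then Suc (Suc (n div 2)) else if n = 1 then 1 else 0"
  obtain \<psi> where \<psi>: "\<And>s. sat E UNIV s \<psi> = sat E UNIV (\<lambda>n. s (?r n)) \<phi>"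
    using sat_rename[of E UNIV ?r \<phi>] by blast
  define q where "q = (\<lambda>n. p (n - 2))"
  have "(\<lambda>n. (q(0 := x, 1 := y)) (?r n)) = mrg p (case_nat y (\<lambda>_. x))" for x y
  proof
    fix n
    show "(q(0 := x, 1 := y)) (?r n) = mrg p (case_nat y (\<lambda>_. x)) n"
      by (auto simp: mrg_def q_def split: nat.split elim!: oddE)
  qed
  then have s: "sat E UNIV (q(0 := x, 1 := y)) \<psi> \<longleftrightarrow> y = F x" for x y
    using P[of "case_nat y (\<lambda>_. x)"] unfolding \<psi> by simp
  have "(\<forall>x. E x a \<longrightarrow> (\<exists>!y. sat E UNIV (q(0 := x, 1 := y)) \<psi>)) \<longrightarrow>
      (\<exists>b. \<forall>y. E y b \<longleftrightarrow> (\<exists>x. E x a \<and> sat E UNIV (q(0 := x, 1 := y)) \<psi>))"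
    using ZF unfolding ZF_def by blast
  then show ?thesis unfolding s by simp
qed

lemma ext: "(\<And>z. E z x \<longleftrightarrow> E z y) \<Longrightarrow> x = y"
  using ZF[unfolded ZF_def, THEN conjunct1] by blast

lemma foundation: "E y x \<Longrightarrow> \<exists>y. E y x \<and> (\<forall>z. E z x \<longrightarrow> \<not> E z y)"
  using ZF[unfolded ZF_def, THEN conjunct2, THEN conjunct1] by blast

lemma dd_setI:
  assumes "\<exists>b. \<forall>x. E x b \<longleftrightarrow> P x" shows "E x (dd (\<lambda>b. \<forall>x. E x b \<longleftrightarrow> P x)) \<longleftrightarrow> P x"
proof -
  have "\<exists>!b. \<forall>x. E x b \<longleftrightarrow> P x" using assms by (metis ext)
  from dd_prop[OF this] show ?thesis by blast
qed

definition sep where "sep a P = dd (\<lambda>b. \<forall>x. E x b \<longleftrightarrow> E x a \<and> P x)"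
definition rep where "rep a F = dd (\<lambda>b. \<forall>x. E x b \<longleftrightarrow> (\<exists>y. E y a \<and> x = F y))"

lemma mem_sep: "pd (\<lambda>s. P (s 0)) \<Longrightarrow> E x (sep a P) \<longleftrightarrow> E x a \<and> P x"
  unfolding sep_def by (rule dd_setI) (rule sep_ex)

lemma mem_rep: "ft (\<lambda>s. F (s 0)) \<Longrightarrow> E x (rep a F) \<longleftrightarrow> (\<exists>y. E y a \<and> x = F y)"
  unfolding rep_def by (rule dd_setI) (rule rep_ex)

lemma ft_sep [dfi]:
  assumes a: "ft a" and P: "pd (\<lambda>s. P (\<lambda>n. s (Suc n)) (s 0))" shows "ft (\<lambda>s. sep (a s) (P s))"
  unfolding sep_def
proof (rule ft_dd, intro pd_all pd_iff pd_conj pd_mem ft_var)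
  show "ft (\<lambda>s. a (\<lambda>n. s (Suc (Suc n))))" by (rule ft_rename[OF a])
  show "pd (\<lambda>s. P (\<lambda>n. s (Suc (Suc n))) (s 0))"
    using pd_rename[OF P, of "\<lambda>n. case n of 0 \<Rightarrow> 0 | Suc m \<Rightarrow> Suc n"] by simp
qed

lemma ft_rep [dfi]:
  assumes a: "ft a" and F: "ft (\<lambda>s. F (\<lambda>n. s (Suc n)) (s 0))" shows "ft (\<lambda>s. rep (a s) (F s))"
  unfolding rep_def
proof (rule ft_dd, intro pd_all pd_iff pd_ex pd_conj pd_mem ft_var pd_eq)
  show "ft (\<lambda>s. a (\<lambda>n. s (Suc (Suc (Suc n)))))" by (rule ft_rename[OF a])
  show "ft (\<lambda>s. F (\<lambda>n. s (Suc (Suc (Suc n)))) (s 0))"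
    using ft_rename[OF F, of "\<lambda>n. case n of 0 \<Rightarrow> 0 | Suc m \<Rightarrow> Suc (Suc n)"] by simp
qed

section \<open>Elementary set operations\<close>

abbreviation zero where "zero \<equiv> vempty E"
abbreviation pr where "pr \<equiv> vpair E"
abbreviation sc where "sc \<equiv> vsucc E"
abbreviation W where "W \<equiv> omega E"
abbreviation Ord where "Ord \<equiv> is_Ord E"

lemmas ax = ZF[unfolded ZF_def, THEN conjunct2, THEN conjunct2]
lemmas pairing_ax = ax[THEN conjunct1]
lemmas union_ax = ax[THEN conjunct2, THEN conjunct1]
lemmas power_ax = ax[THEN conjunct2, THEN conjunct2, THEN conjunct1]
lemmas infinity_ax = ax[THEN conjunct2, THEN conjunct2, THEN conjunct2, THEN conjunct1]

definition upair where "upair a b = dd (\<lambda>z. \<forall>u. E u z \<longleftrightarrow> u = a \<or> u = b)"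
definition un where "un a = dd (\<lambda>z. \<forall>u. E u z \<longleftrightarrow> (\<exists>y. E y a \<and> E u y))"
definition pow where "pow a = dd (\<lambda>z. \<forall>u. E u z \<longleftrightarrow> (\<forall>v. E v u \<longrightarrow> E v a))"

lemma mem_upair [simp]: "E u (upair a b) \<longleftrightarrow> u = a \<or> u = b"
  unfolding upair_def by (rule dd_setI) (use pairing_ax in blast)

lemma mem_un [simp]: "E u (un a) \<longleftrightarrow> (\<exists>y. E y a \<and> E u y)"
  unfolding un_def by (rule dd_setI) (use union_ax in blast)

lemma mem_pow [simp]: "E u (pow a) \<longleftrightarrow> (\<forall>v. E v u \<longrightarrow> E v a)"
  unfolding pow_def by (rule dd_setI) (use power_ax in blast)

lemma vset_eq: "(\<And>z. E z x \<longleftrightarrow> z \<in> S) \<Longrightarrow> vset E S = x"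
  unfolding vset_def elts_def by (rule the_equality) (auto intro!: ext)

lemma not_mem_zero [simp]: "\<not> E y zero"
proof -
  obtain b where "\<forall>x. \<not> E x b" using sep_ex[of "\<lambda>_. False"] pd_const by auto
  then have "zero = b" unfolding vempty_def by (intro vset_eq) auto
  then show ?thesis using \<open>\<forall>x. \<not> E x b\<close> by simp
qed

lemma zero_eqI: "(\<And>y. \<not> E y x) \<Longrightarrow> x = zero"
  by (rule ext) simp

lemma nonzero_mem: "x \<noteq> zero \<Longrightarrow> \<exists>y. E y x"
  using zero_eqI by blast

lemma pr_upair: "pr a b = upair (upair a a) (upair a b)"
proof -
  have "vset E {a} = upair a a" by (rule vset_eq) simp
  moreover have "vset E {a, b} = upair a b" by (rule vset_eq) simp
  ultimately show ?thesis unfolding vpair_def by (intro vset_eq) simp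
qed

lemma sc_un: "sc x = un (upair x (upair x x))"
  unfolding vsucc_def by (intro vset_eq) (auto simp: elts_def)

lemma mem_sc [simp]: "E u (sc x) \<longleftrightarrow> E u x \<or> u = x"
  unfolding sc_un by auto

lemma upair_eq: "upair a b = upair c d \<longleftrightarrow> a = c \<and> b = d \<or> a = d \<and> b = c"
proof
  assume "upair a b = upair c d"
  then have "\<And>u. (u = a \<or> u = b) \<longleftrightarrow> (u = c \<or> u = d)" by (metis mem_upair)
  then show "a = c \<and> b = d \<or> a = d \<and> b = c" by metis
qed (auto intro: ext)

lemma pr_inj [simp]: "pr a b = pr c d \<longleftrightarrow> a = c \<and> b = d"
  unfolding pr_upair upair_eq by auto

lemma ft_upair0: "ft (\<lambda>s. upair (s 0) (s 1))" unfolding upair_def by (intro dfi)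
lemmas ft_upair [dfi] = ft_2[where F = upair, OF ft_upair0]
lemma ft_un0: "ft (\<lambda>s. un (s 0))" unfolding un_def by (intro dfi)
lemmas ft_un [dfi] = ft_1[where F = un, OF ft_un0]
lemma ft_pow0: "ft (\<lambda>s. pow (s 0))" unfolding pow_def by (intro dfi)
lemmas ft_pow [dfi] = ft_1[where F = pow, OF ft_pow0]
lemma ft_pr [dfi]: "ft a \<Longrightarrow> ft b \<Longrightarrow> ft (\<lambda>s. pr (a s) (b s))"
  unfolding pr_upair by (intro dfi)
lemma ft_sc [dfi]: "ft a \<Longrightarrow> ft (\<lambda>s. sc (a s))"
  unfolding sc_un by (intro dfi)

definition bun where "bun a b = un (upair a b)"

lemma mem_bun [simp]: "E u (bun a b) \<longleftrightarrow> E u a \<or> E u b"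
  unfolding bun_def by auto

lemma ft_bun [dfi]: "ft a \<Longrightarrow> ft b \<Longrightarrow> ft (\<lambda>s. bun (a s) (b s))"
  unfolding bun_def by (intro dfi)

definition prd where "prd A B = un (rep A (\<lambda>x. rep B (\<lambda>y. pr x y)))"

lemma mem_prd: "E p (prd A B) \<longleftrightarrow> (\<exists>x y. E x A \<and> E y B \<and> p = pr x y)"
proof -
  have 1: "ft (\<lambda>s. rep B (\<lambda>y. pr (s 0) y))" by (intro dfi)
  have 2: "ft (\<lambda>s. pr x (s 0))" for x by (intro dfi)
  show ?thesis unfolding prd_def mem_un mem_rep[where F = "\<lambda>x. rep B (\<lambda>y. pr x y)", OF 1]
    by (auto simp: mem_rep[where F = "\<lambda>y. pr x y" for x, OF 2])
qed

lemma pr_mem_prd [simp]: "E (pr x y) (prd A B) \<longleftrightarrow> E x A \<and> E y B"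
  unfolding mem_prd by auto

lemma ft_prd0: "ft (\<lambda>s. prd (s 0) (s 1))" unfolding prd_def by (intro dfi)
lemmas ft_prd [dfi] = ft_2[where F = prd, OF ft_prd0]

section \<open>Functions\<close>

text \<open>A definable counterpart of \<open>app\<close>: both agree on functions inside their
  domain, and elsewhere \<open>ap\<close> has the default value of \<open>dd\<close>.\<close>

definition ap where "ap f x = dd (\<lambda>y. E (pr x y) f)"
definition lam where "lam A F = rep A (\<lambda>x. pr x (F x))"
text \<open>A function with domain \<open>A\<close> and unspecified codomain. The equation excludes
  elements that are not pairs, so that equality of functions is equality of values.\<close>

definition fn where "fn f A \<longleftrightarrow> f = lam A (ap f)"

lemma ft_ap0: "ft (\<lambda>s. ap (s 0) (s 1))" unfolding ap_def by (intro dfi)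
lemmas ft_ap [dfi] = ft_2[where F = ap, OF ft_ap0]

lemma ft_lam [dfi]:
  assumes "ft a" "ft (\<lambda>s. F (\<lambda>n. s (Suc n)) (s 0))" shows "ft (\<lambda>s. lam (a s) (F s))"
  unfolding lam_def by (intro dfi assms)

lemma pd_fn0: "pd (\<lambda>s. fn (s 0) (s 1))" unfolding fn_def by (intro dfi)
lemmas pd_fn [dfi] = pd_2[where R = fn, OF pd_fn0]

lemma pd_is_fun0: "pd (\<lambda>s. is_fun E (s 0) (s 1) (s 2))" unfolding is_fun_def by (intro dfi)
lemmas pd_is_fun [dfi] = pd_3[where R = "is_fun E", OF pd_is_fun0]

lemma mem_lam:
  assumes "ft (\<lambda>s. F (s 0))" shows "E p (lam A F) \<longleftrightarrow> (\<exists>x. E x A \<and> p = pr x (F x))"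
proof -
  have "ft (\<lambda>s. pr (s 0) (F (s 0)))" by (intro dfi assms)
  from mem_rep[where F = "\<lambda>x. pr x (F x)", OF this] show ?thesis unfolding lam_def .
qed

lemma ap_lam:
  assumes "ft (\<lambda>s. F (s 0))" "E x A" shows "ap (lam A F) x = F x"
  unfolding ap_def by (rule dd_eq) (use assms in \<open>auto simp: mem_lam\<close>)

lemma ft_apc: "ft (\<lambda>s. ap f (s 0))" by (intro dfi)

lemma lam_cong:
  assumes "ft (\<lambda>s. F (s 0))" "ft (\<lambda>s. G (s 0))" "\<And>x. E x A \<Longrightarrow> F x = G x"
  shows "lam A F = lam A G"
  by (rule ext) (use assms in \<open>auto simp: mem_lam\<close>)

lemma fn_lam: "ft (\<lambda>s. F (s 0)) \<Longrightarrow> fn (lam A F) A"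
  unfolding fn_def by (rule lam_cong) (auto simp: ft_apc ap_lam)

lemma mem_fn: "fn f A \<Longrightarrow> E p f \<longleftrightarrow> (\<exists>x. E x A \<and> p = pr x (ap f x))"
  unfolding fn_def using mem_lam[OF ft_apc] by metis

lemma fn_eqI:
  assumes "fn f A" "fn g A" "\<And>x. E x A \<Longrightarrow> ap f x = ap g x" shows "f = g"
  by (rule ext) (use assms in \<open>simp add: mem_fn, metis\<close>)

lemma is_fun_iff: "is_fun E f A B \<longleftrightarrow> fn f A \<and> (\<forall>x. E x A \<longrightarrow> E (ap f x) B)"
proof
  assume f: "is_fun E f A B"
  have 1: "E (pr x (ap f x)) f" if "E x A" for x
    unfolding ap_def by (rule dd_prop) (use f that in \<open>simp add: is_fun_def\<close>)
  have 2: "E x A \<and> E y B \<and> y = ap f x" if "E (pr x y) f" for x y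
  proof -
    have "E x A" "E y B" using f that unfolding is_fun_def by fastforce+
    moreover from this have "y = ap f x" using f that 1[of x] unfolding is_fun_def by blast
    ultimately show ?thesis by simp
  qed
  have "fn f A" unfolding fn_def
  proof (rule ext)
    fix p
    show "E p f \<longleftrightarrow> E p (lam A (ap f))"
      unfolding mem_lam[OF ft_apc] using f 1 2 unfolding is_fun_def by metis
  qed
  then show "fn f A \<and> (\<forall>x. E x A \<longrightarrow> E (ap f x) B)" using 1 2 by blast
next
  assume f: "fn f A \<and> (\<forall>x. E x A \<longrightarrow> E (ap f x) B)"
  then show "is_fun E f A B" unfolding is_fun_def by (auto simp: mem_fn)
qed

lemma app_ap: "is_fun E f A B \<Longrightarrow> E x A \<Longrightarrow> app E f x = ap f x"
proof -
  assume "is_fun E f A B" "E x A"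
  then have "\<exists>!y. E (pr x y) f" unfolding is_fun_def by blast
  then show ?thesis unfolding app_def ap_def dd_def by simp
qed

lemma is_fun_lam:
  "ft (\<lambda>s. F (s 0)) \<Longrightarrow> (\<And>x. E x A \<Longrightarrow> E (F x) B) \<Longrightarrow> is_fun E (lam A F) A B"
  by (simp add: is_fun_iff fn_lam ap_lam)

lemma is_fun_ap: "is_fun E f A B \<Longrightarrow> E x A \<Longrightarrow> E (ap f x) B"
  by (simp add: is_fun_iff)

lemma is_fun_fn: "is_fun E f A B \<Longrightarrow> fn f A"
  by (simp add: is_fun_iff)

lemma is_fun_sub_prd: "is_fun E f A B \<Longrightarrow> E f (pow (prd A B))"
  unfolding is_fun_def by auto

lemma restr_lam:
  assumes "fn f A" "\<And>x. E x B \<Longrightarrow> E x A" shows "restr E f B = lam B (ap f)"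
  unfolding restr_def
  by (rule vset_eq) (use assms in \<open>auto simp: mem_lam[OF ft_apc] mem_fn\<close>)

section \<open>Ordinals\<close>

lemma mem_irrefl [simp]: "\<not> E x x"
  using foundation[of x "upair x x"] by auto

lemma mem_asym: "E x y \<Longrightarrow> \<not> E y x"
  using foundation[of x "upair x y"] by auto

lemma no_3cycle: "E x y \<Longrightarrow> E y z \<Longrightarrow> \<not> E z x"
  using foundation[of x "bun (upair x y) (upair z z)"] by auto

lemma sc_inj [simp]: "sc x = sc y \<longleftrightarrow> x = y"
  by (metis mem_sc mem_asym)

lemma sc_nonzero [simp]: "sc x \<noteq> zero" "zero \<noteq> sc x"
  by (metis mem_sc not_mem_zero)+

lemma min_elem:
  assumes "pd (\<lambda>s. P (s 0))" "E a A" "P a"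
  obtains m where "E m A" "P m" "\<And>u. E u A \<Longrightarrow> P u \<Longrightarrow> \<not> E u m"
proof -
  have "E a (sep A P)" using assms by (simp add: mem_sep)
  from foundation[OF this] show thesis using that by (auto simp: mem_sep[OF assms(1)])
qed

lemma pd_Ord0: "pd (\<lambda>s. Ord (s 0))" unfolding is_Ord_def by (intro dfi)
lemmas pd_Ord [dfi] = pd_1[where R = Ord, OF pd_Ord0]

lemma Ord_trans: "Ord a \<Longrightarrow> E b a \<Longrightarrow> E c b \<Longrightarrow> E c a"
  unfolding is_Ord_def by blast

lemma Ord_mem: "Ord a \<Longrightarrow> E b a \<Longrightarrow> Ord b"
proof -
  assume a: "Ord a" "E b a"
  have "E x b" if "E x y" "E y b" for x y
  proof -
    have "E y a" "E x a" using a that Ord_trans by blast+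
    then have "E x b \<or> x = b \<or> E b x" using a unfolding is_Ord_def by blast
    then show ?thesis using that mem_asym no_3cycle by blast
  qed
  then show ?thesis using a Ord_trans unfolding is_Ord_def by metis
qed

text \<open>The least element of \<open>a\<close> outside \<open>c\<close>, if there is one, has
  exactly the elements of \<open>c\<close> as members.\<close>

lemma Ord_initial:
  assumes "Ord a" "\<And>x. E x c \<Longrightarrow> E x a" "\<And>x y. E x y \<Longrightarrow> E y c \<Longrightarrow> E x c"
  shows "c = a \<or> E c a"
proof (cases "\<exists>x. E x a \<and> \<not> E x c")
  case True
  then obtain x where x: "E x a" "\<not> E x c" by blast
  have p: "pd (\<lambda>s. \<not> E (s 0) c)" by (intro dfi)
  obtain m where m: "E m a" "\<not> E m c" "\<And>u. E u a \<Longrightarrow> \<not> E u c \<Longrightarrow> \<not> E u m"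
    by (rule min_elem[of "\<lambda>x. \<not> E x c", OF p x]) blast
  have "c = m"
  proof (rule ext)
    fix z
    have "E z m" if "E z c"
    proof -
      have "E z m \<or> z = m \<or> E m z" using assms(1,2) m(1) that unfolding is_Ord_def by blast
      then show ?thesis using m(2) that assms(3) by blast
    qed
    moreover have "E z c" if "E z m" using m that Ord_trans[OF assms(1)] by blast
    ultimately show "E z c \<longleftrightarrow> E z m" by blast
  qed
  then show ?thesis using m by simp
next
  case False
  then show ?thesis using assms(2) by (metis ext)
qed

text \<open>The intersection is an initial segment of both ordinals, so it equals or belongs to
  each; if it belonged to both, it would belong to itself.\<close>

lemma Ord_lin: "Ord a \<Longrightarrow> Ord b \<Longrightarrow> E a b \<or> a = b \<or> E b a"
proof -
  assume o: "Ord a" "Ord b"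
  define c where "c = sep a (\<lambda>x. E x b)"
  have pdc: "pd (\<lambda>s. E (s 0) b)" by (intro dfi)
  have c: "E x c \<longleftrightarrow> E x a \<and> E x b" for x unfolding c_def using mem_sep[OF pdc] .
  have "c = a \<or> E c a" by (rule Ord_initial) (use o c Ord_trans in blast)+
  moreover have "c = b \<or> E c b" by (rule Ord_initial) (use o c Ord_trans in blast)+
  moreover have "\<not> (E c a \<and> E c b)" using c mem_irrefl by blast
  ultimately show ?thesis by metis
qed

lemma Ord_zero [simp]: "Ord zero"
  unfolding is_Ord_def by simp

lemma Ord_sc [simp]: "Ord (sc a) \<longleftrightarrow> Ord a"
proof
  assume "Ord a"
  then show "Ord (sc a)" unfolding is_Ord_def by auto
next
  assume "Ord (sc a)"
  then show "Ord a" by (rule Ord_mem) simp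
qed

lemma OrdI:
  assumes "\<And>x. E x A \<Longrightarrow> Ord x" "\<And>x y. E x y \<Longrightarrow> E y A \<Longrightarrow> E x A" shows "Ord A"
  using assms Ord_lin unfolding is_Ord_def[of E A] by blast

lemma Ord_un: "(\<And>x. E x A \<Longrightarrow> Ord x) \<Longrightarrow> Ord (un A)"
  by (rule OrdI) (auto intro: Ord_mem dest: Ord_trans)

lemma Ord_bun [simp]: "Ord a \<Longrightarrow> Ord b \<Longrightarrow> Ord (bun a b)"
  unfolding bun_def by (rule Ord_un) auto

lemma Ord_sub_iff: "Ord a \<Longrightarrow> Ord b \<Longrightarrow> (\<forall>x. E x a \<longrightarrow> E x b) \<longleftrightarrow> E a (sc b)"
  using Ord_lin[of a b] by (auto dest: Ord_trans)

lemma Ord_le_trans: "Ord c \<Longrightarrow> E a (sc b) \<Longrightarrow> E b c \<Longrightarrow> E a c"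
  by (auto dest: Ord_trans)

lemma Ord_not_mem: "Ord a \<Longrightarrow> Ord b \<Longrightarrow> \<not> E a b \<longleftrightarrow> E b (sc a)"
  using Ord_lin[of a b] mem_asym by auto

text \<open>Seen from outside, \<open>E\<close> may be ill-founded, so arbitrary HOL predicates
  admit no induction; a definable one has a minimal counterexample by Foundation.\<close>

lemma Ord_induct:
  assumes "pd (\<lambda>s. P (s 0))" "\<And>a. Ord a \<Longrightarrow> (\<And>b. E b a \<Longrightarrow> P b) \<Longrightarrow> P a" "Ord a"
  shows "P a"
proof (rule ccontr)
  assume "\<not> P a"
  moreover have "pd (\<lambda>s. \<not> P (s 0))" by (intro dfi assms(1))
  ultimately obtain m where m: "E m (sc a)" "\<not> P m" "\<And>u. E u (sc a) \<Longrightarrow> \<not> P u \<Longrightarrow> \<not> E u m"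
    using min_elem[of "\<lambda>x. \<not> P x" a "sc a"] by auto
  have "Ord m" using m(1) assms(3) Ord_mem by auto
  then have "P m"
  proof (rule assms(2))
    fix b assume "E b m"
    moreover have "E b (sc a)" using \<open>E b m\<close> m(1) assms(3) Ord_trans[of "sc a"] by simp
    ultimately show "P b" using m(3) by blast
  qed
  then show False using m(2) by blast
qed

definition mu where "mu P = dd (\<lambda>a. Ord a \<and> P a \<and> (\<forall>b. E b a \<longrightarrow> \<not> P b))"

lemma ft_mu [dfi]:
  assumes "pd (\<lambda>s. P (\<lambda>n. s (Suc n)) (s 0))" shows "ft (\<lambda>s. mu (P s))"
proof -
  have 1: "pd (\<lambda>s. P (\<lambda>n. s (Suc (Suc n))) (s 0))"
    using pd_rename[OF assms, of "\<lambda>n. case n of 0 \<Rightarrow> 0 | Suc m \<Rightarrow> Suc n"] by simp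
  show ?thesis unfolding mu_def by (intro dfi assms 1)
qed

lemma mu_props:
  assumes "pd (\<lambda>s. P (s 0))" "Ord a" "P a"
  shows "Ord (mu P)" "P (mu P)" "E b (mu P) \<Longrightarrow> \<not> P b" "E (mu P) (sc a)"
proof -
  obtain m where m: "E m (sc a)" "P m" "\<And>u. E u (sc a) \<Longrightarrow> P u \<Longrightarrow> \<not> E u m"
    using min_elem[OF assms(1), of a "sc a"] assms(3) by auto
  have o: "Ord m" using m(1) assms(2) Ord_mem[of "sc a" m] by simp
  have l: "\<not> P b" if "E b m" for b
    using m that Ord_trans[of "sc a" m b] assms(2) by auto
  have "mu P = m" unfolding mu_def
    by (rule dd_eq) (use o l m(2) in \<open>auto dest: Ord_lin\<close>)
  then show "Ord (mu P)" "P (mu P)" "E b (mu P) \<Longrightarrow> \<not> P b" "E (mu P) (sc a)"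
    using o l m by simp_all
qed

lemma mu_eq:
  assumes "Ord a" "P a" "\<And>b. E b a \<Longrightarrow> \<not> P b" shows "mu P = a"
  unfolding mu_def by (rule dd_eq) (use assms in \<open>auto dest: Ord_lin\<close>)

section \<open>Natural numbers\<close>

abbreviation "Lim \<equiv> is_Limit E"

text \<open>Burali-Forti: the ordinals in such a set would form an ordinal that contains
  itself.\<close>

lemma no_set_of_all_Ord: "\<exists>a. Ord a \<and> \<not> E a A"
proof (rule ccontr)
  assume "\<not> ?thesis"
  then have *: "E a A" if "Ord a" for a using that by blast
  have p: "pd (\<lambda>s. Ord (s 0))" by (intro dfi)
  have "Ord (sep A Ord)"
    by (rule OrdI) (use * Ord_mem in \<open>auto simp: mem_sep[OF p]\<close>)
  then have "E (sep A Ord) (sep A Ord)" using mem_sep[OF p] * by blast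
  then show False by simp
qed

lemma pd_Lim0: "pd (\<lambda>s. Lim (s 0))" unfolding is_Limit_def by (intro dfi)
lemmas pd_Lim [dfi] = pd_1[where R = Lim, OF pd_Lim0]

text \<open>If every nonzero ordinal were a successor, the inductive set from the axiom of infinity
  would contain all ordinals.\<close>

lemma Lim_ex: "\<exists>a. Lim a"
proof (rule ccontr)
  assume "\<not> ?thesis"
  then have nl: "a = zero \<or> (\<exists>b. a = sc b)" if "Ord a" for a
    using that unfolding is_Limit_def by blast
  obtain I where I0: "\<exists>e. (\<forall>y. \<not> E y e) \<and> E e I"
    and IS: "\<And>y. E y I \<Longrightarrow> (\<exists>z. E z I \<and> (\<forall>u. E u z \<longleftrightarrow> E u y \<or> u = y))"
    using infinity_ax by blast
  have I0: "E zero I" using I0 zero_eqI by metis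
  have IS: "E (sc y) I" if y: "E y I" for y
  proof -
    obtain z where z: "E z I" "\<forall>u. E u z \<longleftrightarrow> E u y \<or> u = y" using IS[OF y] by blast
    have "z = sc y" by (rule ext) (simp add: z(2))
    then show ?thesis using z(1) by simp
  qed
  have "E a I" if "Ord a" for a
  proof (rule Ord_induct[of "\<lambda>a. E a I", OF _ _ that])
    show "pd (\<lambda>s. E (s 0) I)" by (intro dfi)
    fix a assume "Ord a" "\<And>b. E b a \<Longrightarrow> E b I"
    then show "E a I" using nl[of a] I0 IS by auto
  qed
  then show False using no_set_of_all_Ord[of I] by blast
qed

lemma W_props: "Lim W" "E b W \<Longrightarrow> \<not> Lim b"
proof -
  obtain a where a: "Lim a" using Lim_ex by blast
  have p: "pd (\<lambda>s. Lim (s 0))" by (intro dfi)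
  have o: "Ord a" using a unfolding is_Limit_def by blast
  note m = mu_props[OF p o a]
  have "W = mu Lim" unfolding omega_def
  proof (rule the_equality)
    show "Lim (mu Lim) \<and> (\<forall>b. E b (mu Lim) \<longrightarrow> \<not> Lim b)" using m by blast
    fix c assume c: "Lim c \<and> (\<forall>b. E b c \<longrightarrow> \<not> Lim b)"
    then have "Ord c" unfolding is_Limit_def by blast
    then show "c = mu Lim" using c m Ord_lin[of c "mu Lim"] by blast
  qed
  then show "Lim W" "E b W \<Longrightarrow> \<not> Lim b" using m by simp_all
qed

lemma Ord_W [simp]: "Ord W"
  using W_props(1) unfolding is_Limit_def by blast

lemma W_Ord: "E n W \<Longrightarrow> Ord n"
  using Ord_mem Ord_W by blast

lemma W_trans: "E n W \<Longrightarrow> E m n \<Longrightarrow> E m W"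
  using Ord_trans Ord_W by blast

lemma Lim_sc:
  assumes "Lim a" "E b a" shows "E (sc b) a"
proof -
  have "Ord a" "a \<noteq> sc b" using assms unfolding is_Limit_def by blast+
  moreover have "Ord (sc b)" using Ord_mem[OF \<open>Ord a\<close> assms(2)] by simp
  ultimately show ?thesis using Ord_lin[of a "sc b"] assms(2) mem_asym[of a b] by auto
qed

lemma W_zero [simp]: "E zero W"
  using W_props(1) nonzero_mem[of W] Ord_lin[of zero W] unfolding is_Limit_def by auto

lemma W_sc [simp]: "E (sc n) W \<longleftrightarrow> E n W"
  using Lim_sc[OF W_props(1)] W_trans[of "sc n" n] by auto

lemma W_cases:
  assumes "E n W" obtains "n = zero" | m where "E m W" "n = sc m"
  using W_props(2)[OF assms] W_Ord[OF assms] assms unfolding is_Limit_def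
  by (metis W_sc)

lemma W_induct [consumes 2, case_names zero sc]:
  assumes "E n W" "pd (\<lambda>s. P (s 0))" "P zero" "\<And>n. E n W \<Longrightarrow> P n \<Longrightarrow> P (sc n)" shows "P n"
proof -
  have "E a W \<longrightarrow> P a" if "Ord a" for a
  proof (rule Ord_induct[of "\<lambda>a. E a W \<longrightarrow> P a", OF _ _ that])
    show "pd (\<lambda>s. E (s 0) W \<longrightarrow> P (s 0))" by (intro dfi assms(2))
    fix a assume "\<And>b. E b a \<Longrightarrow> E b W \<longrightarrow> P b"
    then show "E a W \<longrightarrow> P a" using assms(3,4) W_cases[of a] by (metis mem_sc)
  qed
  then show ?thesis using assms(1) W_Ord by blast
qed

lemma un_sc [simp]: "Ord n \<Longrightarrow> un (sc n) = n"
  by (rule ext) (auto dest: Ord_trans)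

lemma Ord_zero_mem: "Ord a \<Longrightarrow> a \<noteq> zero \<Longrightarrow> E zero a"
  using Ord_lin[of zero a] by auto

lemma sc_mem_sc: "Ord b \<Longrightarrow> E (sc a) (sc b) \<longleftrightarrow> E a b"
  using Ord_trans[of b] mem_asym by (metis Ord_lin Ord_mem Ord_sc mem_sc)

section \<open>Recursion\<close>

text \<open>Only sets \<open>S\<close> of the structure are tested, so this is well-foundedness as
  seen inside; \<open>R\<close> may be a class relation such as \<open>E\<close>.\<close>

definition wfon where
  "wfon A R \<longleftrightarrow> (\<forall>S. (\<forall>x. E x S \<longrightarrow> E x A) \<and> (\<exists>x. E x S) \<longrightarrow>
    (\<exists>m. E m S \<and> (\<forall>u. E u S \<longrightarrow> \<not> R u m)))"

definition pred where "pred A R v = sep A (\<lambda>u. R u v)"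

lemma wfon_min:
  assumes "wfon A R" "pd (\<lambda>s. P (s 0))" "E a A" "P a"
  shows "\<exists>m. E m A \<and> P m \<and> (\<forall>u. E u A \<and> R u m \<longrightarrow> \<not> P u)"
  using assms(1)[unfolded wfon_def, rule_format, of "sep A P"] assms(3,4)
  unfolding mem_sep[OF assms(2)] by blast

lemma wfon_induct:
  assumes "wfon A R" "pd (\<lambda>s. P (s 0))"
    "\<And>v. E v A \<Longrightarrow> (\<And>u. E u A \<Longrightarrow> R u v \<Longrightarrow> P u) \<Longrightarrow> P v" "E a A"
  shows "P a"
proof (rule ccontr)
  assume n: "\<not> P a"
  have "pd (\<lambda>s. \<not> P (s 0))" by (intro dfi assms(2))
  from wfon_min[of A R "\<lambda>x. \<not> P x", OF assms(1) this assms(4) n] assms(3) show False by blast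
qed

context
  fixes A :: 'v and R :: "'v \<Rightarrow> 'v \<Rightarrow> bool" and G :: "'v \<Rightarrow> 'v \<Rightarrow> 'v"
  assumes wf: "wfon A R" and pdR: "pd (\<lambda>s. R (s 0) (s 1))" and ftG: "ft (\<lambda>s. G (s 0) (s 1))"
begin

lemmas pdR' = pd_2[where R = R, OF pdR]
lemmas ftG' = ft_2[where F = G, OF ftG]

lemma mem_pred: "E u (pred A R v) \<longleftrightarrow> E u A \<and> R u v"
proof -
  have "pd (\<lambda>s. R (s 0) v)" by (intro dfi pdR')
  from mem_sep[OF this] show ?thesis unfolding pred_def .
qed

lemma ft_pred: "ft v \<Longrightarrow> ft (\<lambda>s. pred A R (v s))"
  by (rule ft_1[where F = "pred A R"]) (unfold pred_def, intro dfi pdR')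

definition attempt where
  "attempt p D \<longleftrightarrow> (\<forall>v. E v D \<longrightarrow> E v A \<and> (\<forall>u. E u A \<and> R u v \<longrightarrow> E u D)) \<and> fn p D \<and>
     (\<forall>v. E v D \<longrightarrow> ap p v = G v (lam (pred A R v) (ap p)))"

lemma pd_attempt0: "pd (\<lambda>s. attempt (s 0) (s 1))" unfolding attempt_def by (intro dfi pdR' ftG' ft_pred)
lemmas pd_attempt = pd_2[where R = attempt, OF pd_attempt0]

lemma attemptD:
  assumes "attempt p D"
  shows "E v D \<Longrightarrow> E v A" "E v D \<Longrightarrow> E u A \<Longrightarrow> R u v \<Longrightarrow> E u D" "fn p D"
    "E v D \<Longrightarrow> ap p v = G v (lam (pred A R v) (ap p))"
  using assms unfolding attempt_def by blast+

lemma attempt_unique: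
  assumes "attempt p D" "attempt q D'" "E v D" "E v D'" shows "ap p v = ap q v"
proof -
  have "E v D \<longrightarrow> E v D' \<longrightarrow> ap p v = ap q v"
  proof (rule wfon_induct[where P = "\<lambda>v. E v D \<longrightarrow> E v D' \<longrightarrow> ap p v = ap q v", OF wf])
    show "pd (\<lambda>s. E (s 0) D \<longrightarrow> E (s 0) D' \<longrightarrow> ap p (s 0) = ap q (s 0))" by (intro dfi pdR' ftG' ft_pred pd_attempt)
    show "E v A" using attemptD(1) assms by blast
    fix v assume v: "E v A" "\<And>u. E u A \<Longrightarrow> R u v \<Longrightarrow> E u D \<longrightarrow> E u D' \<longrightarrow> ap p u = ap q u"
    show "E v D \<longrightarrow> E v D' \<longrightarrow> ap p v = ap q v"
    proof (intro impI)
      assume d: "E v D" "E v D'"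
      have "lam (pred A R v) (ap p) = lam (pred A R v) (ap q)"
        by (rule lam_cong[OF ft_apc ft_apc]) (use v(2) attemptD(2)[OF assms(1) d(1)] attemptD(2)[OF assms(2) d(2)]
            in \<open>simp add: mem_pred\<close>)
      then show "ap p v = ap q v"
        using attemptD(4)[OF assms(1) d(1)] attemptD(4)[OF assms(2) d(2)] by simp
    qed
  qed
  then show ?thesis using assms by blast
qed

text \<open>Partial solutions on domains closed under predecessors agree where both are defined, so
  their union is again a partial solution. It is total, because at a point whose predecessors all
  lie in its domain it could be extended by one more value.\<close>

lemma wf_recursion:
  "\<exists>!p. fn p A \<and> (\<forall>v. E v A \<longrightarrow> ap p v = G v (lam (pred A R v) (ap p)))"
proof -
  define Q where "Q v y \<longleftrightarrow> (\<exists>p D. attempt p D \<and> E v D \<and> y = ap p v)" for v y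
  define F where "F v = dd (Q v)" for v
  define D where "D = sep A (\<lambda>v. \<exists>y. Q v y)"
  have pdQ0: "pd (\<lambda>s. Q (s 0) (s 1))" unfolding Q_def by (intro dfi pdR' ftG' ft_pred pd_attempt)
  note pdQ = pd_2[where R = Q, OF pdQ0]
  have ftF0: "ft (\<lambda>s. F (s 0))" unfolding F_def by (intro dfi pdR' ftG' ft_pred pd_attempt pdQ)
  note ftF = ft_1[where F = F, OF ftF0]
  have "pd (\<lambda>s. \<exists>y. Q (s 0) y)" by (intro dfi pdR' ftG' ft_pred pd_attempt pdQ)
  note D = mem_sep[where P = "\<lambda>v. \<exists>y. Q v y", OF this, where a = A, folded D_def]
  have F: "F v = ap p v" if "attempt p D'" "E v D'" for p D' v
    unfolding F_def
  proof (rule dd_eq)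
    show "Q v (ap p v)" using that unfolding Q_def by blast
    show "z = ap p v" if "Q v z" for z
      using that attempt_unique \<open>attempt p D'\<close> \<open>E v D'\<close> unfolding Q_def by blast
  qed
  define P where "P = lam D F"
  have P: "ap P v = F v" if "E v D" for v unfolding P_def by (rule ap_lam[OF ftF0 that])
  have sub: "E v D" if "attempt p D'" "E v D'" for p D' v
    using that attemptD(1) unfolding D Q_def by blast
  have PG: "ap P v = G v (lam (pred A R v) (ap P))" "\<And>u. E u A \<Longrightarrow> R u v \<Longrightarrow> E u D" if v: "E v D" for v
  proof -
    obtain p D' where p: "attempt p D'" "E v D'" using v unfolding D Q_def by blast
    have s: "E u D'" if "E u A" "R u v" for u using attemptD(2)[OF p that] .
    then show "\<And>u. E u A \<Longrightarrow> R u v \<Longrightarrow> E u D" using sub[OF p(1)] by blast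
    have "ap P v = ap p v" using P[OF v] F[OF p] by simp
    also have "\<dots> = G v (lam (pred A R v) (ap p))" using attemptD(4)[OF p] .
    also have "lam (pred A R v) (ap p) = lam (pred A R v) (ap P)"
      by (rule lam_cong[OF ft_apc ft_apc]) (use s sub[OF p(1)] P F[OF p(1)] in \<open>simp add: mem_pred\<close>)
    finally show "ap P v = G v (lam (pred A R v) (ap P))" .
  qed
  have DA: "E v D" if vA: "E v A" for v
  proof (rule wfon_induct[where P = "\<lambda>v. E v D", OF wf _ _ vA])
    show "pd (\<lambda>s. E (s 0) D)" by (intro dfi pdR' ftG' ft_pred pd_attempt)
    fix v assume v: "E v A" "\<And>u. E u A \<Longrightarrow> R u v \<Longrightarrow> E u D"
    show "E v D"
    proof (rule ccontr)
      assume vD: "\<not> E v D"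
      define D' where "D' = bun D (upair v v)"
      define F' where "F' x = (if x = v then G v (lam (pred A R v) (ap P)) else ap P x)" for x
      have ftF': "ft (\<lambda>s. F' (s 0))" unfolding F'_def by (intro dfi pdR' ftG' ft_pred pd_attempt)
      define p where "p = lam D' F'"
      have p: "ap p x = F' x" if "E x D'" for x unfolding p_def by (rule ap_lam[OF ftF' that])
      have eq: "lam (pred A R x) (ap p) = lam (pred A R x) (ap P)" if "E x D'" for x
        by (rule lam_cong[OF ft_apc ft_apc])
          (use that p vD v PG(2)[of x] in \<open>auto simp: mem_pred D'_def F'_def\<close>)
      have "attempt p D'" unfolding attempt_def
      proof (intro conjI allI impI)
        show "fn p D'" unfolding p_def by (rule fn_lam[OF ftF'])
        fix x assume x: "E x D'"
        show "ap p x = G x (lam (pred A R x) (ap p))"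
          unfolding p[OF x] F'_def eq[OF x] using x PG(1)[of x] by (auto simp: D'_def)
        show "E x A" using x v by (auto simp: D'_def D)
        fix u assume "E u A \<and> R u x"
        then show "E u D'" using x v PG(2) by (auto simp: D'_def)
      qed
      then have "E v D" by (rule sub) (simp add: D'_def)
      then show False using vD by simp
    qed
  qed
  then have "D = A" by (intro ext) (auto simp: D)
  then have ex: "fn P A \<and> (\<forall>v. E v A \<longrightarrow> ap P v = G v (lam (pred A R v) (ap P)))"
    using PG(1) fn_lam[OF ftF0, of D] unfolding P_def by simp
  show ?thesis
  proof (rule ex1I[of _ P])
    show "fn P A \<and> (\<forall>v. E v A \<longrightarrow> ap P v = G v (lam (pred A R v) (ap P)))" by (rule ex)
    fix q assume q: "fn q A \<and> (\<forall>v. E v A \<longrightarrow> ap q v = G v (lam (pred A R v) (ap q)))"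
    have "attempt P A" "attempt q A" using ex q unfolding attempt_def by blast+
    then show "q = P" using q ex attempt_unique by (intro fn_eqI[of q A P]) blast+
  qed
qed

end

lemma wfon_Ord: "wfon A E"
  unfolding wfon_def using foundation by blast

lemma pred_Ord: "Ord a \<Longrightarrow> E v a \<Longrightarrow> pred a E v = v"
proof (rule ext)
  fix z assume "Ord a" "E v a"
  moreover have "pd (\<lambda>s. E (s 0) v)" by (intro dfi)
  ultimately show "E z (pred a E v) \<longleftrightarrow> E z v"
    unfolding pred_def by (auto simp: mem_sep dest: Ord_trans)
qed

lemma ord_recursion:
  assumes "Ord a" "ft (\<lambda>s. G (s 0) (s 1))"
  shows "\<exists>!p. fn p a \<and> (\<forall>v. E v a \<longrightarrow> ap p v = G v (lam v (ap p)))"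
proof -
  have "\<exists>!p. fn p a \<and> (\<forall>v. E v a \<longrightarrow> ap p v = G v (lam (pred a E v) (ap p)))"
    by (rule wf_recursion[OF wfon_Ord _ assms(2)]) (intro dfi)
  moreover have "(\<forall>v. E v a \<longrightarrow> ap p v = G v (lam (pred a E v) (ap p))) \<longleftrightarrow>
     (\<forall>v. E v a \<longrightarrow> ap p v = G v (lam v (ap p)))" for p
    using pred_Ord[OF assms(1)] by auto
  ultimately show ?thesis by simp
qed

lemma nat_recursion:
  assumes "ft (\<lambda>s. H (s 0) (s 1))"
  shows "\<exists>!p. fn p W \<and> ap p zero = c \<and> (\<forall>n. E n W \<longrightarrow> ap p (sc n) = H n (ap p n))"
proof -
  note ftH = ft_2[where F = H, OF assms]
  \<comment> \<open>\<open>un\<close> is the predecessor on nonzero natural numbers; the value there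
    is read from the restriction \<open>q\<close>.\<close>
  let ?G = "\<lambda>n q. if n = zero then c else H (un n) (ap q (un n))"
  have ftG: "ft (\<lambda>s. ?G (s 0) (s 1))" by (intro dfi ftH)
  from ord_recursion[where G = ?G, OF Ord_W this]
  have *: "\<exists>!p. fn p W \<and> (\<forall>v. E v W \<longrightarrow> ap p v = ?G v (lam v (ap p)))" .
  have "(\<forall>v. E v W \<longrightarrow> ap p v = ?G v (lam v (ap p))) \<longleftrightarrow>
    ap p zero = c \<and> (\<forall>n. E n W \<longrightarrow> ap p (sc n) = H n (ap p n))" for p
  proof -
    have *: "?G (sc n) (lam (sc n) (ap p)) = H n (ap p n)" if "E n W" for n
      using W_Ord[OF that] by (simp add: ap_lam[OF ft_apc])
    show ?thesis
    proof (intro iffI conjI allI impI)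
      assume l: "\<forall>v. E v W \<longrightarrow> ap p v = ?G v (lam v (ap p))"
      show "ap p zero = c" using l[rule_format, OF W_zero] by simp
      fix n assume "E n W"
      then show "ap p (sc n) = H n (ap p n)" using l[rule_format, of "sc n"] *[of n] by simp
    next
      fix v assume r: "ap p zero = c \<and> (\<forall>n. E n W \<longrightarrow> ap p (sc n) = H n (ap p n))" "E v W"
      from r(2) show "ap p v = ?G v (lam v (ap p))"
      proof (cases rule: W_cases)
        case (2 m)
        show ?thesis unfolding 2(2) *[OF 2(1)] using r(1) 2(1) by simp
      qed (simp add: r(1))
    qed
  qed
  then show ?thesis using * by simp
qed

section \<open>A pairing function on the natural numbers\<close>

lemma mu_W:
  assumes "pd (\<lambda>s. P (s 0))" "E n W" "P n"
  shows "E (mu P) W" "P (mu P)"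
proof -
  note m = mu_props[OF assms(1) W_Ord[OF assms(2)] assms(3)]
  show "P (mu P)" using m(2) .
  show "E (mu P) W" using m(4) W_trans[OF assms(2)] assms(2) by auto
qed

definition pfst where "pfst p = dd (\<lambda>x. \<exists>y. p = pr x y)"
definition psnd where "psnd p = dd (\<lambda>y. \<exists>x. p = pr x y)"

lemma pfst_pr [simp]: "pfst (pr x y) = x" unfolding pfst_def by (rule dd_eq) auto
lemma psnd_pr [simp]: "psnd (pr x y) = y" unfolding psnd_def by (rule dd_eq) auto
lemma ft_pfst0: "ft (\<lambda>s. pfst (s 0))" unfolding pfst_def by (intro dfi)
lemmas ft_pfst [dfi] = ft_1[where F = pfst, OF ft_pfst0]
lemma ft_psnd0: "ft (\<lambda>s. psnd (s 0))" unfolding psnd_def by (intro dfi)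
lemmas ft_psnd [dfi] = ft_1[where F = psnd, OF ft_psnd0]

text \<open>The walk runs through the shells \<open>max(a, b) = c\<close>: first \<open>(0, c), \<dots>, (c - 1, c)\<close>,
  then \<open>(c, 0), \<dots>, (c, c)\<close>.\<close>

definition walk_step where
  "walk_step p = (let a = pfst p; b = psnd p in
    if E a b then if E (sc a) b then pr (sc a) b else pr b zero
    else if E b a then pr a (sc b) else pr zero (sc a))"

definition walk where
  "walk = dd (\<lambda>g. fn g W \<and> ap g zero = pr zero zero \<and> (\<forall>n. E n W \<longrightarrow> ap g (sc n) = walk_step (ap g n)))"

lemma walk_props: "ap walk zero = pr zero zero" "E n W \<Longrightarrow> ap walk (sc n) = walk_step (ap walk n)"
proof -
  have "ft (\<lambda>s. walk_step (s 1))" unfolding walk_step_def Let_def by (intro dfi)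
  from dd_prop[OF nat_recursion[of "\<lambda>n x. walk_step x", OF this, of "pr zero zero"]]
  have "fn walk W \<and> ap walk zero = pr zero zero \<and> (\<forall>n. E n W \<longrightarrow> ap walk (sc n) = walk_step (ap walk n))"
    unfolding walk_def .
  then show "ap walk zero = pr zero zero" "E n W \<Longrightarrow> ap walk (sc n) = walk_step (ap walk n)" by simp_all
qed

definition reached where "reached p \<longleftrightarrow> (\<exists>n. E n W \<and> ap walk n = p)"

lemma pd_reached0: "pd (\<lambda>s. reached (s 0))" unfolding reached_def by (intro dfi)
lemmas pd_reached [dfi] = pd_1[where R = reached, OF pd_reached0]

lemma reached_step: "reached p \<Longrightarrow> reached (walk_step p)"
  unfolding reached_def using walk_props(2) W_sc by metis

lemma reached_row:
  assumes "E c W" "reached (pr zero c)" "E a c" shows "reached (pr a c)"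
proof -
  have "E a W" using assms W_trans by blast
  moreover have "pd (\<lambda>s. E (s 0) c \<longrightarrow> reached (pr (s 0) c))" by (intro dfi)
  ultimately have "E a c \<longrightarrow> reached (pr a c)"
  proof (induction a rule: W_induct)
    case zero
    show ?case using assms by simp
  next
    case (sc n)
    show ?case
    proof
      assume s: "E (sc n) c"
      then have "E n c" using Ord_trans[OF W_Ord[OF assms(1)], of "sc n" n] by simp
      then show "reached (pr (sc n) c)"
        using s sc reached_step[of "pr n c"] by (simp add: walk_step_def)
    qed
  qed
  then show ?thesis using assms by blast
qed

lemma reached_column:
  assumes "E c W" "reached (pr c zero)" "E b (sc c)" shows "reached (pr c b)"
proof -
  have "E b W" using assms W_trans by auto
  moreover have "pd (\<lambda>s. E (s 0) (sc c) \<longrightarrow> reached (pr c (s 0)))" by (intro dfi)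
  ultimately have "E b (sc c) \<longrightarrow> reached (pr c b)"
  proof (induction b rule: W_induct)
    case zero
    show ?case using assms by simp
  next
    case (sc n)
    show ?case
    proof
      assume "E (sc n) (sc c)"
      then have n: "E n c" using sc_mem_sc W_Ord[OF assms(1)] by blast
      then show "reached (pr c (sc n))"
        using sc reached_step[of "pr c n"] mem_asym[OF n] by (auto simp: walk_step_def)
    qed
  qed
  then show ?thesis using assms by blast
qed

text \<open>The walk goes from \<open>(n, n)\<close> to \<open>(0, n + 1)\<close>, along the row to
  \<open>(n, n + 1)\<close>, and from there to \<open>(n + 1, 0)\<close>; so both corners of a shell
  are reached in one induction.\<close>

lemma reached_shell: "E c W \<Longrightarrow> reached (pr zero c) \<and> reached (pr c zero)"
proof -
  assume "E c W"
  moreover have "pd (\<lambda>s. reached (pr zero (s 0)) \<and> reached (pr (s 0) zero))" by (intro dfi)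
  ultimately show ?thesis
  proof (induction c rule: W_induct)
    case zero
    have "reached (pr zero zero)" unfolding reached_def using walk_props(1) W_zero by blast
    then show ?case by simp
  next
    case (sc n)
    have "reached (pr n n)" using reached_column[of n n] sc by simp
    from reached_step[OF this] have 1: "reached (pr zero (sc n))" by (simp add: walk_step_def)
    have "reached (pr n (sc n))" using reached_row[OF _ 1, of n] sc by simp
    from reached_step[OF this] have 2: "reached (pr (sc n) zero)" by (simp add: walk_step_def)
    show ?case using 1 2 by blast
  qed
qed

lemma reached_all: "E a W \<Longrightarrow> E b W \<Longrightarrow> reached (pr a b)"
  using reached_row[of b a] reached_column[of a b] reached_shell[of a] reached_shell[of b]
    Ord_lin[of a b] W_Ord by auto

text \<open>A pair is coded by the first index at which the walk meets it. Injectivity is automatic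
  because \<open>walk\<close> recovers the pair, so no arithmetic has to be developed inside the
  structure.\<close>

definition npair where "npair a b = mu (\<lambda>n. E n W \<and> ap walk n = pr a b)"

lemma ft_npair0: "ft (\<lambda>s. npair (s 0) (s 1))" unfolding npair_def by (intro dfi)
lemmas ft_npair [dfi] = ft_2[where F = npair, OF ft_npair0]

lemma npair_props: "E a W \<Longrightarrow> E b W \<Longrightarrow> E (npair a b) W \<and> ap walk (npair a b) = pr a b"
proof -
  assume "E a W" "E b W"
  then obtain n where n: "E n W" "ap walk n = pr a b" using reached_all unfolding reached_def by blast
  have "pd (\<lambda>s. E (s 0) W \<and> ap walk (s 0) = pr a b)" by (intro dfi)
  from mu_W[of "\<lambda>n. E n W \<and> ap walk n = pr a b", OF this n(1)] n show ?thesis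
    unfolding npair_def by blast
qed

lemma npair_W [simp]: "E a W \<Longrightarrow> E b W \<Longrightarrow> E (npair a b) W"
  using npair_props by blast

lemma npair_inj:
  "E a W \<Longrightarrow> E b W \<Longrightarrow> E c W \<Longrightarrow> E d W \<Longrightarrow> npair a b = npair c d \<longleftrightarrow> a = c \<and> b = d"
  using npair_props[of a b] npair_props[of c d] by (metis pr_inj)

section \<open>Even and odd numbers\<close>

definition dbls where
  "dbls = dd (\<lambda>g. fn g W \<and> ap g zero = zero \<and> (\<forall>n. E n W \<longrightarrow> ap g (sc n) = sc (sc (ap g n))))"
definition dbl where "dbl n = ap dbls n"

lemma ft_dbl [dfi]: "ft a \<Longrightarrow> ft (\<lambda>s. dbl (a s))"
  unfolding dbl_def by (intro dfi)

lemma dbl_simps [simp]: "dbl zero = zero" "E n W \<Longrightarrow> dbl (sc n) = sc (sc (dbl n))"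
proof -
  have "ft (\<lambda>s. sc (sc (s 1)))" by (intro dfi)
  from dd_prop[OF nat_recursion[of "\<lambda>n x. sc (sc x)", OF this, of zero]]
  have "fn dbls W \<and> ap dbls zero = zero \<and> (\<forall>n. E n W \<longrightarrow> ap dbls (sc n) = sc (sc (ap dbls n)))"
    unfolding dbls_def .
  then show "dbl zero = zero" "E n W \<Longrightarrow> dbl (sc n) = sc (sc (dbl n))" unfolding dbl_def by simp_all
qed

lemma dbl_W [simp]: "E n W \<Longrightarrow> E (dbl n) W"
proof -
  assume "E n W"
  moreover have "pd (\<lambda>s. E (dbl (s 0)) W)" by (intro dfi)
  ultimately show ?thesis by (induction n rule: W_induct) auto
qed

lemma dbl_inj: "E n W \<Longrightarrow> E m W \<Longrightarrow> dbl n = dbl m \<longleftrightarrow> n = m"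
proof -
  assume n: "E n W" and m: "E m W"
  note n
  moreover have "pd (\<lambda>s. \<forall>m. E m W \<longrightarrow> dbl (s 0) = dbl m \<longrightarrow> s 0 = m)" by (intro dfi)
  ultimately have "\<forall>m. E m W \<longrightarrow> dbl n = dbl m \<longrightarrow> n = m"
  proof (induction n rule: W_induct)
    case zero
    show ?case
    proof (intro allI impI)
      fix m assume "E m W" "dbl zero = dbl m"
      then show "zero = m" by (cases rule: W_cases) auto
    qed
  next
    case (sc n)
    show ?case
    proof (intro allI impI)
      fix m assume m: "E m W" "dbl (sc n) = dbl m"
      from m(1) show "sc n = m"
      proof (cases rule: W_cases)
        case 1
        then show ?thesis using m sc(1) by simp
      next
        case (2 k)
        then have "dbl n = dbl k" using m sc(1) by simp
        then have "n = k" using sc(2) 2(1) by blast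
        then show ?thesis using 2(2) by simp
      qed
    qed
  qed
  then show ?thesis using m by blast
qed

lemma dbl_neq: "E n W \<Longrightarrow> E m W \<Longrightarrow> sc (dbl n) \<noteq> dbl m"
proof -
  assume n: "E n W" and m: "E m W"
  note n
  moreover have "pd (\<lambda>s. \<forall>m. E m W \<longrightarrow> sc (dbl (s 0)) \<noteq> dbl m)" by (intro dfi)
  ultimately have "\<forall>m. E m W \<longrightarrow> sc (dbl n) \<noteq> dbl m"
  proof (induction n rule: W_induct)
    case zero
    show ?case
    proof (intro allI impI)
      fix m assume "E m W"
      then show "sc (dbl zero) \<noteq> dbl m" by (cases rule: W_cases) auto
    qed
  next
    case (sc n)
    show ?case
    proof (intro allI impI notI)
      fix m assume m: "E m W" "sc (dbl (sc n)) = dbl m"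
      from m(1) show False
      proof (cases rule: W_cases)
        case 1
        then show ?thesis using m sc(1) by simp
      next
        case (2 k)
        then have "sc (dbl n) = dbl k" using m sc(1) by simp
        then show ?thesis using sc(2) 2(1) by blast
      qed
    qed
  qed
  then show ?thesis using m by blast
qed

abbreviation "Even \<equiv> is_even E"

lemma pd_Even0: "pd (\<lambda>s. Even (s 0))" unfolding is_even_def by (intro dfi)
lemmas pd_Even [dfi] = pd_1[where R = Even, OF pd_Even0]

lemma Even_dbl: "E n W \<Longrightarrow> Even (dbl n)"
proof -
  assume "E n W"
  moreover have "pd (\<lambda>s. Even (dbl (s 0)))" by (intro dfi)
  ultimately show ?thesis by (induction n rule: W_induct) (auto simp: is_even_def)
qed

text \<open>The set of all doubles is one of the sets quantified over in \<open>Even\<close>, and it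
  contains no successor of a double.\<close>

lemma not_Even_sc_dbl: "E n W \<Longrightarrow> \<not> Even (sc (dbl n))"
proof
  assume n: "E n W" and e: "Even (sc (dbl n))"
  have "ft (\<lambda>s. dbl (s 0))" by (intro dfi)
  note r = mem_rep[of dbl, OF this, of _ W]
  have "E zero (rep W dbl)" unfolding r by (metis W_zero dbl_simps(1))
  moreover have "E (sc (sc k)) (rep W dbl)" if "E k (rep W dbl)" for k
    using that unfolding r by (metis W_sc dbl_simps(2))
  ultimately have "E (sc (dbl n)) (rep W dbl)" using e unfolding is_even_def by blast
  then show False unfolding r using dbl_neq n by blast
qed

section \<open>Countable sets\<close>

definition inj_W where
  "inj_W g A \<longleftrightarrow> (\<forall>x. E x A \<longrightarrow> E (ap g x) W) \<and> (\<forall>x y. E x A \<and> E y A \<and> ap g x = ap g y \<longrightarrow> x = y)"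
definition cble where "cble A \<longleftrightarrow> (\<exists>g. fn g A \<and> inj_W g A)"

lemma pd_inj_W0: "pd (\<lambda>s. inj_W (s 0) (s 1))" unfolding inj_W_def by (intro dfi)
lemmas pd_inj_W [dfi] = pd_2[where R = inj_W, OF pd_inj_W0]
lemma pd_cble0: "pd (\<lambda>s. cble (s 0))" unfolding cble_def by (intro dfi)
lemmas pd_cble [dfi] = pd_1[where R = cble, OF pd_cble0]

lemma countable_iff: "is_countable E A \<longleftrightarrow> cble A"
proof -
  have "is_fun E f A W \<and> (\<forall>x y. E x A \<and> E y A \<and> app E f x = app E f y \<longrightarrow> x = y)
    \<longleftrightarrow> fn f A \<and> inj_W f A" for f
  proof (cases "is_fun E f A W")
    case True
    have "(\<forall>x y. E x A \<and> E y A \<and> app E f x = app E f y \<longrightarrow> x = y) \<longleftrightarrow>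
      (\<forall>x y. E x A \<and> E y A \<and> ap f x = ap f y \<longrightarrow> x = y)"
      by (simp add: app_ap[OF True] cong: conj_cong)
    with True show ?thesis unfolding inj_W_def is_fun_iff by blast
  next
    case False
    then show ?thesis unfolding inj_W_def is_fun_iff by blast
  qed
  then show ?thesis unfolding is_countable_def cble_def by simp
qed

lemma cbleI:
  assumes "ft (\<lambda>s. F (s 0))" "\<And>x. E x A \<Longrightarrow> E (F x) W"
    "\<And>x y. E x A \<Longrightarrow> E y A \<Longrightarrow> F x = F y \<Longrightarrow> x = y"
  shows "cble A"
  unfolding cble_def inj_W_def
  by (rule exI[of _ "lam A F"]) (use assms in \<open>auto simp: fn_lam ap_lam\<close>)

lemma cble_subset: "cble B \<Longrightarrow> (\<And>x. E x A \<Longrightarrow> E x B) \<Longrightarrow> cble A"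
  by (unfold cble_def[of B], elim exE conjE, rule cbleI[OF ft_apc]) (auto simp: inj_W_def)

text \<open>Instead of choosing a preimage, an element of the image receives the least code of its
  preimages.\<close>

lemma cble_rep:
  assumes "cble A" "ft (\<lambda>s. F (s 0))" shows "cble (rep A F)"
proof -
  obtain g where g: "inj_W g A" using assms(1) unfolding cble_def by blast
  note ftF = ft_1[where F = F, OF assms(2)]
  define c where "c y = mu (\<lambda>n. \<exists>x. E x A \<and> y = F x \<and> n = ap g x)" for y
  have ftc: "ft (\<lambda>s. c (s 0))" unfolding c_def by (intro dfi ftF)
  have c: "\<exists>x. E x A \<and> y = F x \<and> c y = ap g x" if y: "E y (rep A F)" for y
  proof -
    obtain x where x: "E x A" "y = F x" using y unfolding mem_rep[OF assms(2)] by blast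
    have p: "pd (\<lambda>s. \<exists>x. E x A \<and> y = F x \<and> s 0 = ap g x)" by (intro dfi ftF)
    have "Ord (ap g x)" using g x W_Ord unfolding inj_W_def by blast
    from mu_props(2)[where P = "\<lambda>n. \<exists>x. E x A \<and> y = F x \<and> n = ap g x", OF p this] x
    show ?thesis unfolding c_def by blast
  qed
  show ?thesis
  proof (rule cbleI[OF ftc])
    fix y assume "E y (rep A F)"
    with c obtain x where "E x A" "y = F x" "c y = ap g x" by blast
    then show "E (c y) W" using g unfolding inj_W_def by simp
    fix z assume "E z (rep A F)" "c y = c z"
    with c obtain x' where "E x' A" "z = F x'" "c z = ap g x'" by blast
    then have "x = x'" using g \<open>E x A\<close> \<open>c y = ap g x\<close> \<open>c y = c z\<close> unfolding inj_W_def by metis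
    then show "y = z" using \<open>y = F x\<close> \<open>z = F x'\<close> by simp
  qed
qed

lemma cble_W: "cble W"
  by (rule cbleI[of "\<lambda>x. x"]) (auto intro: dfi)

lemma cble_mem_W: "E n W \<Longrightarrow> cble n"
  using cble_subset[OF cble_W] W_trans by blast

lemma cble_prd:
  assumes "cble A" "cble B" shows "cble (prd A B)"
proof -
  obtain g where g: "inj_W g A" using assms(1) unfolding cble_def by blast
  obtain h where h: "inj_W h B" using assms(2) unfolding cble_def by blast
  have "ft (\<lambda>s. npair (ap g (pfst (s 0))) (ap h (psnd (s 0))))" by (intro dfi)
  then show ?thesis
  proof (rule cbleI[where F = "\<lambda>p. npair (ap g (pfst p)) (ap h (psnd p))"])
    fix p assume "E p (prd A B)"
    then obtain x y where p: "E x A" "E y B" "p = pr x y" unfolding mem_prd by blast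
    then have w: "E (ap g x) W" "E (ap h y) W" using g h unfolding inj_W_def by blast+
    then show "E (npair (ap g (pfst p)) (ap h (psnd p))) W" using p by simp
    fix q assume "E q (prd A B)"
      and e: "npair (ap g (pfst p)) (ap h (psnd p)) = npair (ap g (pfst q)) (ap h (psnd q))"
    then obtain x' y' where q: "E x' A" "E y' B" "q = pr x' y'" unfolding mem_prd by blast
    then have w': "E (ap g x') W" "E (ap h y') W" using g h unfolding inj_W_def by blast+
    have "ap g x = ap g x' \<and> ap h y = ap h y'" using e p q npair_inj[OF w w'] by simp
    then have "x = x'" "y = y'" using g h p q unfolding inj_W_def by blast+
    then show "p = q" using p q by simp
  qed
qed

section \<open>Reals and finite sequences\<close>

lemma mem_reals [simp]: "E x (reals E) \<longleftrightarrow> is_fun E x W W"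
proof -
  have p: "pd (\<lambda>s. is_fun E (s 0) W W)" by (intro dfi)
  have "reals E = sep (pow (prd W W)) (\<lambda>x. is_fun E x W W)"
    unfolding reals_def
    by (rule vset_eq) (use is_fun_sub_prd in \<open>unfold mem_sep[OF p] mem_Collect_eq, blast\<close>)
  then show ?thesis using is_fun_sub_prd mem_sep[OF p] by metis
qed

definition FS where "FS A = sep (pow (prd W A)) (\<lambda>t. \<exists>n. E n W \<and> is_fun E t n A)"

lemma mem_FS: "E t (FS A) \<longleftrightarrow> (\<exists>n. E n W \<and> is_fun E t n A)"
proof -
  have p: "pd (\<lambda>s. \<exists>n. E n W \<and> is_fun E (s 0) n A)" by (intro dfi)
  have "E t (pow (prd W A))" if "E n W" "is_fun E t n A" for n
    using is_fun_sub_prd[OF that(2)] W_trans[OF that(1)] by (fastforce simp: mem_prd)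
  then show ?thesis unfolding FS_def mem_sep[OF p] by blast
qed

lemma finseqs_FS: "finseqs E = FS W"
  unfolding finseqs_def by (rule vset_eq) (simp add: mem_FS)

lemma mem_incseqs:
  "E f (incseqs E A) \<longleftrightarrow> is_fun E f W A \<and> (\<forall>m n. E n W \<and> E m n \<longrightarrow> E (ap f m) (ap f n))"
proof -
  let ?P = "\<lambda>f. is_fun E f W A \<and> (\<forall>m n. E n W \<and> E m n \<longrightarrow> E (ap f m) (ap f n))"
  have eq: "is_fun E f W A \<and> (\<forall>m n. E n W \<and> E m n \<longrightarrow> E (app E f m) (app E f n)) \<longleftrightarrow> ?P f" for f
  proof (rule conj_cong[OF refl])
    assume f: "is_fun E f W A"
    have "app E f m = ap f m \<and> app E f n = ap f n" if "E n W" "E m n" for m n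
      using app_ap[OF f] that W_trans by blast
    then show "(\<forall>m n. E n W \<and> E m n \<longrightarrow> E (app E f m) (app E f n)) \<longleftrightarrow>
      (\<forall>m n. E n W \<and> E m n \<longrightarrow> E (ap f m) (ap f n))" by metis
  qed
  have p: "pd (\<lambda>s. ?P (s 0))" by (intro dfi)
  have "incseqs E A = sep (pow (prd W A)) ?P"
    unfolding incseqs_def eq
    by (rule vset_eq) (use is_fun_sub_prd in \<open>unfold mem_sep[OF p] mem_Collect_eq, blast\<close>)
  then have "E f (incseqs E A) \<longleftrightarrow> E f (pow (prd W A)) \<and> ?P f" by (simp only: mem_sep[OF p])
  then show ?thesis using is_fun_sub_prd by blast
qed

lemma fn_dom: "fn t n \<Longrightarrow> E x n \<longleftrightarrow> (\<exists>y. E (pr x y) t)"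
  by (simp add: mem_fn)

lemma fn_dom_unique: "fn t n \<Longrightarrow> fn t m \<Longrightarrow> n = m"
  by (rule ext) (simp add: fn_dom)

section \<open>Coding finite sequences by natural numbers\<close>

context
  fixes k A :: 'v
  assumes k: "inj_W k A"
begin

text \<open>\<open>ap (cod t) i\<close> codes the first \<open>i\<close> entries by iterated
  pairing. The successor reserves the code 0 for the empty sequence, which makes the length
  recoverable.\<close>

definition cod where
  "cod t = dd (\<lambda>c. fn c W \<and> ap c zero = zero \<and>
     (\<forall>i. E i W \<longrightarrow> ap c (sc i) = sc (npair (ap c i) (ap k (ap t i)))))"

lemma ft_cod0: "ft (\<lambda>s. cod (s 0))" unfolding cod_def by (intro dfi)
lemmas ft_cod = ft_1[where F = cod, OF ft_cod0]

lemma cod_props: "ap (cod t) zero = zero"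
  "E i W \<Longrightarrow> ap (cod t) (sc i) = sc (npair (ap (cod t) i) (ap k (ap t i)))"
proof -
  have "ft (\<lambda>s. sc (npair (s 1) (ap k (ap t (s 0)))))" by (intro dfi)
  from dd_prop[OF nat_recursion[of "\<lambda>i x. sc (npair x (ap k (ap t i)))", OF this, of zero]]
  have "fn (cod t) W \<and> ap (cod t) zero = zero \<and>
     (\<forall>i. E i W \<longrightarrow> ap (cod t) (sc i) = sc (npair (ap (cod t) i) (ap k (ap t i))))"
    unfolding cod_def .
  then show "ap (cod t) zero = zero"
    "E i W \<Longrightarrow> ap (cod t) (sc i) = sc (npair (ap (cod t) i) (ap k (ap t i)))" by simp_all
qed

lemma k_W: "E x A \<Longrightarrow> E (ap k x) W" and k_inj: "E x A \<Longrightarrow> E y A \<Longrightarrow> ap k x = ap k y \<Longrightarrow> x = y"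
  using k unfolding inj_W_def by blast+

lemma cod_W:
  assumes t: "is_fun E t n A" and n: "E n W" and i: "E i (sc n)" shows "E (ap (cod t) i) W"
proof -
  have iW: "E i W" using i n W_trans by auto
  have p: "pd (\<lambda>s. E (s 0) (sc n) \<longrightarrow> E (ap (cod t) (s 0)) W)" by (intro dfi ft_cod)
  from iW p have "E i (sc n) \<longrightarrow> E (ap (cod t) i) W"
  proof (induction i rule: W_induct)
    case zero
    then show ?case by (simp add: cod_props)
  next
    case (sc i)
    show ?case
    proof
      assume "E (sc i) (sc n)"
      then have i: "E i n" using sc_mem_sc W_Ord[OF n] by blast
      then have "E (ap (cod t) i) W" using sc by simp
      moreover have "E (ap k (ap t i)) W" using k_W is_fun_ap[OF t i] by blast
      ultimately show "E (ap (cod t) (sc i)) W" using cod_props(2)[OF sc(1)] by simp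
    qed
  qed
  then show ?thesis using i by blast
qed

text \<open>Decoding starts at the last entry. The second length stays universally quantified in the
  induction over the first, so equal codes force equal lengths as well.\<close>

lemma cod_inj:
  assumes t: "is_fun E t n A" "E n W" and u: "is_fun E u m A" "E m W"
    and i: "E i (sc n)" "E j (sc m)" "ap (cod t) i = ap (cod u) j"
  shows "i = j \<and> (\<forall>l. E l i \<longrightarrow> ap t l = ap u l)"
proof -
  let ?P = "\<lambda>i. E i (sc n) \<longrightarrow> (\<forall>j. E j (sc m) \<and> ap (cod t) i = ap (cod u) j \<longrightarrow>
    i = j \<and> (\<forall>l. E l i \<longrightarrow> ap t l = ap u l))"
  have iW: "E i W" using i t W_trans by auto
  have p: "pd (\<lambda>s. ?P (s 0))" by (intro dfi ft_cod)
  from iW p have "?P i"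
  proof (induction i rule: W_induct)
    case zero
    show ?case
    proof (intro impI allI)
      fix j assume j: "E j (sc m) \<and> ap (cod t) zero = ap (cod u) j"
      then have "E j W" using u W_trans by auto
      then show "zero = j \<and> (\<forall>l. E l zero \<longrightarrow> ap t l = ap u l)"
        by (cases rule: W_cases) (use j in \<open>simp_all add: cod_props\<close>)
    qed
  next
    case (sc i)
    show ?case
    proof (intro impI allI)
      fix j assume s: "E (sc i) (sc n)" and j: "E j (sc m) \<and> ap (cod t) (sc i) = ap (cod u) j"
      have i: "E i n" using s sc_mem_sc W_Ord[OF t(2)] by blast
      have "E j W" using u j W_trans by auto
      then show "sc i = j \<and> (\<forall>l. E l (sc i) \<longrightarrow> ap t l = ap u l)"
      proof (cases rule: W_cases)
        case 1
        then show ?thesis using j cod_props sc(1) by simp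
      next
        case (2 h)
        have h: "E h m" using j 2 sc_mem_sc W_Ord[OF u(2)] by blast
        have w: "E (ap (cod t) i) W" "E (ap k (ap t i)) W" "E (ap (cod u) h) W" "E (ap k (ap u h)) W"
          using cod_W[OF t] cod_W[OF u] i h k_W is_fun_ap[OF t(1) i] is_fun_ap[OF u(1) h] by simp_all
        have "npair (ap (cod t) i) (ap k (ap t i)) = npair (ap (cod u) h) (ap k (ap u h))"
          using j 2 cod_props(2)[OF sc(1)] cod_props(2)[OF 2(1)] by simp
        then have e: "ap (cod t) i = ap (cod u) h" "ap k (ap t i) = ap k (ap u h)"
          using npair_inj[OF w] by blast+
        have "E i (sc n)" "E h (sc m)" using i h by simp_all
        then have "i = h \<and> (\<forall>l. E l i \<longrightarrow> ap t l = ap u l)" using sc(2) e(1) by blast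
        moreover have "ap t i = ap u h"
          using e(2) k_inj is_fun_ap[OF t(1) i] is_fun_ap[OF u(1) h] by blast
        ultimately show ?thesis using 2(2) by auto
      qed
    qed
  qed
  then show ?thesis using i by blast
qed

lemma cble_FS': "cble (FS A)"
proof -
  define enc where "enc t = dd (\<lambda>y. \<exists>n. E n W \<and> fn t n \<and> y = ap (cod t) n)" for t
  have ftE: "ft (\<lambda>s. enc (s 0))" unfolding enc_def by (intro dfi ft_cod)
  have enc: "enc t = ap (cod t) n" if "E n W" "is_fun E t n A" for t n
    unfolding enc_def
  proof (rule dd_eq)
    show "\<exists>n'. E n' W \<and> fn t n' \<and> ap (cod t) n = ap (cod t) n'" using that is_fun_fn by blast
    show "z = ap (cod t) n" if "\<exists>n'. E n' W \<and> fn t n' \<and> z = ap (cod t) n'" for z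
      using that fn_dom_unique is_fun_fn[OF \<open>is_fun E t n A\<close>] by blast
  qed
  show ?thesis
  proof (rule cbleI[OF ftE])
    fix t assume "E t (FS A)"
    then obtain n where n: "E n W" "is_fun E t n A" unfolding mem_FS by blast
    show "E (enc t) W" unfolding enc[OF n] by (rule cod_W[OF n(2,1)]) simp
    fix u assume "E u (FS A)" and e: "enc t = enc u"
    then obtain m where m: "E m W" "is_fun E u m A" unfolding mem_FS by blast
    have "n = m \<and> (\<forall>l. E l n \<longrightarrow> ap t l = ap u l)"
      by (rule cod_inj[OF n(2,1) m(2,1)]) (use e enc[OF n] enc[OF m] in simp_all)
    then show "t = u" using fn_eqI[of t n u] is_fun_fn[OF n(2)] is_fun_fn[OF m(2)] by blast
  qed
qed

end

lemma cble_FS: "cble A \<Longrightarrow> cble (FS A)"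
  using cble_FS' unfolding cble_def[of A] by blast

section \<open>Strategies and runs\<close>

text \<open>The truth value \<open>b\<close> names the player who uses the strategy,
  \<open>True\<close> for player I; both players are then treated by the same arguments.\<close>

definition own where "own b n \<longleftrightarrow> (Even n \<longleftrightarrow> b)"
definition run where
  "run \<tau> b z \<longleftrightarrow> is_fun E z W W \<and> (\<forall>n. E n W \<and> own b n \<longrightarrow> ap z n = ap \<tau> (lam n (ap z)))"

lemma pd_own [dfi]: "ft a \<Longrightarrow> pd (\<lambda>s. own b (a s))"
  unfolding own_def by (intro dfi)

lemma pd_run0: "pd (\<lambda>s. run (s 0) b (s 1))" unfolding run_def by (intro dfi)
lemmas pd_run [dfi] = pd_2[where R = "\<lambda>t. run t b" for b, OF pd_run0]

text \<open>The opponent of \<open>b\<close> plays by the script \<open>y\<close>, which is indexed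
  by the stages of the whole run and does not react to the moves of \<open>b\<close>.\<close>

definition follow where
  "follow \<tau> b y z \<longleftrightarrow> fn z W \<and> (\<forall>n. E n W \<longrightarrow> ap z n = (if own b n then ap \<tau> (lam n (ap z)) else y n))"

lemma follow_ex1:
  assumes "ft (\<lambda>s. y (s 0))" shows "\<exists>!z. follow \<tau> b y z"
proof -
  note fty = ft_1[where F = y, OF assms]
  have "ft (\<lambda>s. if own b (s 0) then ap \<tau> (s 1) else y (s 0))" by (intro dfi fty)
  from ord_recursion[where G = "\<lambda>n p. if own b n then ap \<tau> p else y n", OF Ord_W this]
  show ?thesis unfolding follow_def .
qed

lemma follow_run:
  assumes \<tau>: "is_fun E \<tau> (FS W) W" and z: "follow \<tau> b y z" and y: "\<And>n. E n W \<Longrightarrow> E (y n) W"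
  shows "run \<tau> b z"
proof -
  have f: "fn z W" and eq: "\<And>n. E n W \<Longrightarrow> ap z n = (if own b n then ap \<tau> (lam n (ap z)) else y n)"
    using z unfolding follow_def by blast+
  have "E n W \<longrightarrow> E (ap z n) W" if "Ord n" for n
  proof (rule Ord_induct[of "\<lambda>n. E n W \<longrightarrow> E (ap z n) W", OF _ _ that])
    show "pd (\<lambda>s. E (s 0) W \<longrightarrow> E (ap z (s 0)) W)" by (intro dfi)
    fix n assume IH: "\<And>m. E m n \<Longrightarrow> E m W \<longrightarrow> E (ap z m) W"
    show "E n W \<longrightarrow> E (ap z n) W"
    proof
      assume n: "E n W"
      have "is_fun E (lam n (ap z)) n W"
        by (rule is_fun_lam[OF ft_apc]) (use IH W_trans[OF n] in blast)
      then have "E (lam n (ap z)) (FS W)" unfolding mem_FS using n by blast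
      then show "E (ap z n) W" using eq[OF n] is_fun_ap[OF \<tau>] y[OF n] by simp
    qed
  qed
  then have "is_fun E z W W" unfolding is_fun_iff using f W_Ord by blast
  then show ?thesis unfolding run_def using eq by simp
qed

lemma lam_zero: "lam zero F = zero"
  unfolding lam_def rep_def by (rule dd_eq) (auto intro: zero_eqI)

lemma Even_zero: "Even zero"
  using Even_dbl[OF W_zero] by simp

end

section \<open>Determinacy and countable choice for reals\<close>

locale zf_ad = zf +
  assumes AD: "AD E"
begin

text \<open>With the winner as a truth value, the two alternatives of determinacy become one: along
  the runs of a winning strategy the payoff predicate has the constant value
  \<open>b\<close>.\<close>

lemma determinacy:
  assumes "pd (\<lambda>s. Q (s 0))"
  shows "\<exists>\<tau> b. is_fun E \<tau> (FS W) W \<and> (\<forall>z. run \<tau> b z \<longrightarrow> (Q z \<longleftrightarrow> b))"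
proof -
  define A where "A = sep (reals E) Q"
  have A: "E x A \<longleftrightarrow> is_fun E x W W \<and> Q x" for x unfolding A_def by (simp add: mem_sep[OF assms])
  have c: "is_fun E z W W \<and> (\<forall>n. E n W \<and> own b n \<longrightarrow> app E z n = app E \<tau> (restr E z n)) \<longleftrightarrow> run \<tau> b z"
    if \<tau>: "is_fun E \<tau> (FS W) W" for \<tau> z b
    unfolding run_def
  proof (rule conj_cong[OF refl])
    assume z: "is_fun E z W W"
    have "app E z n = ap z n \<and> app E \<tau> (restr E z n) = ap \<tau> (lam n (ap z))" if n: "E n W" for n
    proof -
      have r: "restr E z n = lam n (ap z)"
        by (rule restr_lam[OF is_fun_fn[OF z]]) (use W_trans n in blast)
      have "is_fun E (lam n (ap z)) n W"
        by (rule is_fun_lam[OF ft_apc]) (use is_fun_ap[OF z] W_trans[OF n] in blast)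
      then have "E (lam n (ap z)) (FS W)" unfolding mem_FS using n by blast
      then show ?thesis using r app_ap[OF z n] app_ap[OF \<tau>] by simp
    qed
    then show "(\<forall>n. E n W \<and> own b n \<longrightarrow> app E z n = app E \<tau> (restr E z n)) \<longleftrightarrow>
      (\<forall>n. E n W \<and> own b n \<longrightarrow> ap z n = ap \<tau> (lam n (ap z)))" by auto
  qed
  have "elts E A \<subseteq> elts E (reals E)" by (auto simp: elts_def A)
  with AD[unfolded AD_def, rule_format, of A] consider
    \<tau> where "is_fun E \<tau> (FS W) W" "\<forall>x. E x (reals E) \<and>
        (\<forall>n. E n W \<and> Even n \<longrightarrow> app E x n = app E \<tau> (restr E x n)) \<longrightarrow> E x A" |
    \<tau> where "is_fun E \<tau> (FS W) W" "\<forall>x. E x (reals E) \<and>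
        (\<forall>n. E n W \<and> \<not> Even n \<longrightarrow> app E x n = app E \<tau> (restr E x n)) \<longrightarrow> \<not> E x A"
    unfolding finseqs_FS by blast
  then show ?thesis
  proof cases
    case 1
    have "Q z" if "run \<tau> True z" for z
      using 1(2) that unfolding c[OF 1(1), of z True, symmetric] own_def A by simp
    then show ?thesis using 1(1) by (intro exI[of _ \<tau>] exI[of _ True]) simp
  next
    case 2
    have "\<not> Q z" if "run \<tau> False z" for z
      using 2(2) that unfolding c[OF 2(1), of z False, symmetric] own_def A by simp
    then show ?thesis using 2(1) by (intro exI[of _ \<tau>] exI[of _ False]) simp
  qed
qed

text \<open>In the game, player I names \<open>n\<close> and player II then has to play \<open>x\<close> with \<open>P n x\<close>; a winning
  strategy of I would fix \<open>n\<close>.\<close>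

lemma countable_choice:
  assumes B: "cble B" and P0: "pd (\<lambda>s. P (s 0) (s 1))"
    and ex: "\<And>n. E n W \<Longrightarrow> \<exists>x. is_fun E x B W \<and> P n x"
  shows "\<exists>F. ft (\<lambda>s. F (s 0)) \<and> (\<forall>n. E n W \<longrightarrow> is_fun E (F n) B W \<and> P n (F n))"
proof -
  note pdP = pd_2[where R = P, OF P0]
  obtain k where k: "\<And>x. E x B \<Longrightarrow> E (ap k x) W"
    "\<And>x y. E x B \<Longrightarrow> E y B \<Longrightarrow> ap k x = ap k y \<Longrightarrow> x = y"
    using B unfolding cble_def inj_W_def by blast
  \<comment> \<open>Player II writes \<open>x\<close> at odd stages only, one for each element of
    \<open>B\<close>, located by the injection \<open>k\<close>.\<close>
  define pos where "pos x = sc (dbl (ap k x))" for x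
  have ft_pos [dfi]: "ft a \<Longrightarrow> ft (\<lambda>s. pos (a s))" for a unfolding pos_def by (intro dfi)
  have pos_W: "E (pos x) W" and pos_odd: "\<not> Even (pos x)" if "E x B" for x
    using k(1)[OF that] not_Even_sc_dbl unfolding pos_def by simp_all
  have pos_inj: "x = y" if "E x B" "E y B" "pos x = pos y" for x y
    using that k dbl_inj unfolding pos_def by simp
  define dec where "dec z = lam B (\<lambda>x. ap z (pos x))" for z
  have ft_dec [dfi]: "ft a \<Longrightarrow> ft (\<lambda>s. dec (a s))" for a
    by (rule ft_1[where F = dec]) (unfold dec_def, intro dfi ft_pos)
  have decf: "ft (\<lambda>s. ap z (pos (s 0)))" for z by (intro dfi ft_pos)
  have dec_ap: "ap (dec z) x = ap z (pos x)" if "E x B" for x z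
    unfolding dec_def by (rule ap_lam[OF decf that])
  have dec_fun: "is_fun E (dec z) B W" if "is_fun E z W W" for z
    unfolding dec_def by (rule is_fun_lam[OF decf]) (use is_fun_ap[OF that] pos_W in blast)
  have "pd (\<lambda>s. \<not> P (ap (s 0) zero) (dec (s 0)))" by (intro dfi pdP ft_dec)
  from determinacy[where Q = "\<lambda>z. \<not> P (ap z zero) (dec z)", OF this] obtain \<tau> b
    where \<tau>: "is_fun E \<tau> (FS W) W" and w: "\<And>z. run \<tau> b z \<Longrightarrow> (\<not> P (ap z zero) (dec z)) \<longleftrightarrow> b"
    by blast
  show ?thesis
  proof (cases b)
    case True
    \<comment> \<open>Player I's first move is made at the empty position, so player II can copy a
      suitable \<open>x\<close> into the remaining stages.\<close>
    define n where "n = ap \<tau> zero"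
    have "is_fun E zero zero W" unfolding is_fun_def by simp
    then have "E zero (FS W)" unfolding mem_FS using W_zero by blast
    then have "E n W" unfolding n_def by (rule is_fun_ap[OF \<tau>])
    then obtain x where x: "is_fun E x B W" "P n x" using ex by blast
    define y where "y i = dd (\<lambda>v. \<exists>u. E u B \<and> i = pos u \<and> v = ap x u)" for i
    have fty: "ft (\<lambda>s. y (s 0))" unfolding y_def by (intro dfi ft_pos)
    have y: "y (pos u) = ap x u" if "E u B" for u
      unfolding y_def by (rule dd_eq) (use that pos_inj in blast)+
    have yW: "E (y i) W" for i
    proof (cases "\<exists>u. E u B \<and> i = pos u")
      case True
      then show ?thesis using y is_fun_ap[OF x(1)] by auto
    next
      case False
      then have "y i = zero" unfolding y_def dd_def by auto
      then show ?thesis by simp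
    qed
    obtain z where z: "follow \<tau> b y z" using follow_ex1[OF fty] by blast
    have r: "run \<tau> b z" by (rule follow_run[OF \<tau> z]) (rule yW)
    have zf: "is_fun E z W W" using r unfolding run_def by blast
    have "ap z zero = n" using r True W_zero Even_zero unfolding run_def own_def n_def
      by (metis lam_zero)
    moreover have "dec z = x"
    proof (rule fn_eqI[OF is_fun_fn[OF dec_fun[OF zf]] is_fun_fn[OF x(1)]])
      fix u assume u: "E u B"
      have "ap z (pos u) = y (pos u)"
        using z pos_W[OF u] pos_odd[OF u] True unfolding follow_def own_def by simp
      then show "ap (dec z) u = ap x u" using dec_ap[OF u] y[OF u] by simp
    qed
    ultimately show ?thesis using w[OF r] x True by simp
  next
    case False
    \<comment> \<open>Player II's strategy is played against the opening \<open>n\<close> followed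
      by zeros. The answer is definable from \<open>n\<close>, which turns one strategy into a
      choice function.\<close>
    define F where "F n = dec (dd (follow \<tau> b (\<lambda>i. if i = zero then n else zero)))" for n
    have "ft (\<lambda>s. F (s 0))" unfolding F_def follow_def by (intro dfi ft_dec)
    moreover have "is_fun E (F n) B W \<and> P n (F n)" if n: "E n W" for n
    proof -
      have fty: "ft (\<lambda>s. if s 0 = zero then n else zero)" by (intro dfi)
      let ?z = "dd (follow \<tau> b (\<lambda>i. if i = zero then n else zero))"
      have z: "follow \<tau> b (\<lambda>i. if i = zero then n else zero) ?z"
        by (rule dd_prop[OF follow_ex1[OF fty]])
      have r: "run \<tau> b ?z" by (rule follow_run[OF \<tau> z]) (use n in simp)
      have "ap ?z zero = n" using z False W_zero Even_zero unfolding follow_def own_def by simp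
      then have "P n (F n)" using w[OF r] False unfolding F_def by simp
      moreover have "is_fun E (F n) B W" unfolding F_def by (rule dec_fun) (use r in \<open>simp add: run_def\<close>)
      ultimately show ?thesis by blast
    qed
    ultimately show ?thesis by blast
  qed
qed

end

context zf
begin

section \<open>The first uncountable ordinal\<close>

text \<open>\<open>R\<close> is the image under \<open>g\<close> of the order of \<open>a\<close>.
  The order is reflexive, so that \<open>R\<close> determines the range of \<open>g\<close>; a
  strict order would not distinguish the ordinals 0 and 1.\<close>

definition codes where
  "codes g a R \<longleftrightarrow> fn g a \<and> inj_W g a \<and>
    (\<forall>p. E p R \<longleftrightarrow> (\<exists>x y. E y a \<and> E x (sc y) \<and> p = pr (ap g x) (ap g y)))"

lemma pd_codes0: "pd (\<lambda>s. codes (s 0) (s 1) (s 2))" unfolding codes_def by (intro dfi)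
lemmas pd_codes [dfi] = pd_3[where R = codes, OF pd_codes0]

lemma codesD:
  assumes "codes g a R" "Ord a"
  shows "E y a \<Longrightarrow> E x (sc y) \<Longrightarrow> E (pr (ap g x) (ap g y)) R"
    and "E (pr u v) R \<Longrightarrow> \<exists>x y. E x a \<and> E y a \<and> E x (sc y) \<and> u = ap g x \<and> v = ap g y"
    and "E x a \<Longrightarrow> E y a \<Longrightarrow> ap g x = ap g y \<Longrightarrow> x = y"
    and "E x a \<Longrightarrow> E (ap g x) W" and "fn g a"
proof -
  have R: "E p R \<longleftrightarrow> (\<exists>x y. E y a \<and> E x (sc y) \<and> p = pr (ap g x) (ap g y))" for p
    using assms(1) unfolding codes_def by blast
  show "E y a \<Longrightarrow> E x (sc y) \<Longrightarrow> E (pr (ap g x) (ap g y)) R" unfolding R by blast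
  have "E x a" if "E y a" "E x (sc y)" for x y using Ord_le_trans[OF assms(2) that(2,1)] .
  then show "E (pr u v) R \<Longrightarrow> \<exists>x y. E x a \<and> E y a \<and> E x (sc y) \<and> u = ap g x \<and> v = ap g y"
    unfolding R pr_inj by blast
  show "E x a \<Longrightarrow> E y a \<Longrightarrow> ap g x = ap g y \<Longrightarrow> x = y" "E x a \<Longrightarrow> E (ap g x) W" "fn g a"
    using assms(1) unfolding codes_def inj_W_def by blast+
qed

text \<open>Isomorphisms of well-orders are unique: if the maps agree below \<open>x\<close>, then
  both \<open>ap g x\<close> and \<open>ap h x\<close> are the first point of \<open>R\<close>
  outside the common part.\<close>

lemma codes_agree:
  assumes g: "codes g a R" "Ord a" and h: "codes h b R" "Ord b" and x: "E x a" "E x b"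
  shows "ap g x = ap h x"
proof -
  note G = codesD[OF g] and H = codesD[OF h]
  have "E x a \<longrightarrow> E x b \<longrightarrow> ap g x = ap h x" if "Ord x" for x
  proof (rule Ord_induct[of "\<lambda>x. E x a \<longrightarrow> E x b \<longrightarrow> ap g x = ap h x", OF _ _ that])
    show "pd (\<lambda>s. E (s 0) a \<longrightarrow> E (s 0) b \<longrightarrow> ap g (s 0) = ap h (s 0))" by (intro dfi)
    fix x assume o: "Ord x" and IH: "\<And>y. E y x \<Longrightarrow> E y a \<longrightarrow> E y b \<longrightarrow> ap g y = ap h y"
    show "E x a \<longrightarrow> E x b \<longrightarrow> ap g x = ap h x"
    proof (intro impI)
      assume x: "E x a" "E x b"
      have below: "ap g y = ap h y" "E y a" "E y b" if "E y x" for y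
        using IH[OF that] Ord_trans[OF g(2) x(1) that] Ord_trans[OF h(2) x(2) that] by blast+
      have "E (pr (ap g x) (ap g x)) R" using G(1)[OF x(1)] by simp
      then obtain v where v: "E v b" "ap g x = ap h v" using H(2) by blast
      have "E (pr (ap h x) (ap h x)) R" using H(1)[OF x(2)] by simp
      then obtain w where w: "E w a" "ap h x = ap g w" using G(2) by blast
      have vx: "\<not> E v x" using below[of v] v x G(3)[of x v] by auto
      have wx: "\<not> E w x" using below[of w] w x H(3)[of x w] by auto
      show "ap g x = ap h x"
      proof (rule ccontr)
        assume n: "ap g x \<noteq> ap h x"
        then have "E x v" "E x w"
          using vx wx v w Ord_lin[OF o Ord_mem[OF h(2) v(1)]] Ord_lin[OF o Ord_mem[OF g(2) w(1)]]
          by auto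
        have "E (pr (ap h x) (ap h v)) R" using H(1)[OF v(1), of x] \<open>E x v\<close> by simp
        then have "E (pr (ap g w) (ap g x)) R" using v w by simp
        then obtain w' x' where "E w' a" "E x' a" "E w' (sc x')" "ap g w = ap g w'" "ap g x = ap g x'"
          using G(2) by blast
        then have "E w (sc x)" using G(3)[of w w'] G(3)[of x x'] w x by simp
        then show False using \<open>E x w\<close> wx by auto
      qed
    qed
  qed
  then show ?thesis using x Ord_mem[OF g(2)] by blast
qed

text \<open>Otherwise \<open>ap h a\<close> would lie in the field of \<open>R\<close>, hence be a
  value of \<open>g\<close> at a point below \<open>a\<close>, where \<open>g\<close> and
  \<open>h\<close> agree, against the injectivity of \<open>h\<close>.\<close>

lemma codes_no_longer:
  assumes g: "codes g a R" "Ord a" and h: "codes h b R" "Ord b" shows "\<not> E a b"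
proof
  assume a: "E a b"
  have "E (pr (ap h a) (ap h a)) R" using codesD(1)[OF h a] by simp
  then obtain w where w: "E w a" "ap h a = ap g w" using codesD(2)[OF g] by blast
  have "E w b" using Ord_trans[OF h(2) a w(1)] .
  then have "ap g w = ap h w" using codes_agree[OF g h w(1)] by blast
  then have "a = w" using codesD(3)[OF h a \<open>E w b\<close>] w by simp
  then show False using w by simp
qed

lemma codes_unique:
  assumes g: "codes g a R" "Ord a" and h: "codes h b R" "Ord b" shows "a = b \<and> g = h"
proof -
  have ab: "a = b" using codes_no_longer[OF g h] codes_no_longer[OF h g] Ord_lin[OF g(2) h(2)] by blast
  moreover have "g = h"
    by (rule fn_eqI[OF codesD(5)[OF g]]) (use codesD(5)[OF h] codes_agree[OF g h] ab in blast)+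
  ultimately show ?thesis by blast
qed

lemma codes_ex:
  assumes "cble a" "Ord a" shows "\<exists>g R. codes g a R \<and> E R (pow (prd W W))"
proof -
  obtain g where g: "fn g a" "inj_W g a" using assms(1) unfolding cble_def by blast
  let ?P = "\<lambda>p. \<exists>x y. E y a \<and> E x (sc y) \<and> p = pr (ap g x) (ap g y)"
  have p: "pd (\<lambda>s. ?P (s 0))" by (intro dfi)
  have "E (pr (ap g x) (ap g y)) (prd W W)" if "E y a" "E x (sc y)" for x y
    using that g(2) Ord_le_trans[OF assms(2) that(2,1)] unfolding inj_W_def by simp
  then have "E p (sep (prd W W) ?P) \<longleftrightarrow> ?P p" for p unfolding mem_sep[OF p] by blast
  then have "codes g a (sep (prd W W) ?P)" unfolding codes_def using g by blast
  moreover have "E (sep (prd W W) ?P) (pow (prd W W))" unfolding mem_pow mem_sep[OF p] by blast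
  ultimately show ?thesis by blast
qed

text \<open>Hartogs' argument: if all ordinals were countable, mapping each relation on \<omega> to
  the ordinal that it codes would collect all ordinals in one set by replacement.\<close>

lemma uncountable_Ord_ex: "\<exists>a. Ord a \<and> \<not> cble a"
proof (rule ccontr)
  assume "\<not> ?thesis"
  then have c: "cble a" if "Ord a" for a using that by blast
  define T where "T R = dd (\<lambda>a. Ord a \<and> (\<exists>g. codes g a R))" for R
  have ftT: "ft (\<lambda>s. T (s 0))" unfolding T_def by (intro dfi)
  have "E a (rep (pow (prd W W)) T)" if o: "Ord a" for a
  proof -
    obtain g R where g: "codes g a R" "E R (pow (prd W W))" using codes_ex[OF c[OF o] o] by blast
    have "T R = a" unfolding T_def
      by (rule dd_eq) (use g(1) o codes_unique in blast)+
    then show ?thesis unfolding mem_rep[OF ftT] using g(2) by blast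
  qed
  then show False using no_set_of_all_Ord by blast
qed

abbreviation "w1 \<equiv> omega1 E"

lemma w1_props: "Ord w1" "\<not> cble w1" "E b w1 \<Longrightarrow> cble b"
proof -
  obtain a where a: "Ord a" "\<not> cble a" using uncountable_Ord_ex by blast
  have p: "pd (\<lambda>s. \<not> cble (s 0))" by (intro dfi)
  note m = mu_props[of "\<lambda>a. \<not> cble a", OF p a]
  have "w1 = mu (\<lambda>a. \<not> cble a)" unfolding omega1_def countable_iff
  proof (rule the_equality)
    show "Ord (mu (\<lambda>a. \<not> cble a)) \<and> \<not> cble (mu (\<lambda>a. \<not> cble a)) \<and> (\<forall>b. E b (mu (\<lambda>a. \<not> cble a)) \<longrightarrow> cble b)"
      using m by blast
    fix c assume "Ord c \<and> \<not> cble c \<and> (\<forall>b. E b c \<longrightarrow> cble b)"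
    then show "c = mu (\<lambda>a. \<not> cble a)" using m Ord_lin[of c "mu (\<lambda>a. \<not> cble a)"] by blast
  qed
  then show "Ord w1" "\<not> cble w1" "E b w1 \<Longrightarrow> cble b" using m by simp_all
qed

lemma w1_Ord: "E a w1 \<Longrightarrow> Ord a"
  using Ord_mem w1_props(1) by blast

lemma w1I: "Ord a \<Longrightarrow> cble a \<Longrightarrow> E a w1"
proof (rule ccontr)
  assume a: "Ord a" "cble a" "\<not> E a w1"
  then have "E w1 (sc a)" using Ord_not_mem w1_props(1) by blast
  then have "E x a" if "E x w1" for x using that a(1) by (auto dest: Ord_trans)
  then show False using cble_subset[OF a(2)] w1_props(2) by blast
qed

lemma cble_sc: "cble a \<Longrightarrow> cble (sc a)"
proof -
  assume "cble a"
  then obtain g where g: "inj_W g a" unfolding cble_def by blast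
  have "ft (\<lambda>s. if s 0 = a then zero else sc (ap g (s 0)))" by (intro dfi)
  then show ?thesis
  proof (rule cbleI[where F = "\<lambda>x. if x = a then zero else sc (ap g x)"])
    fix x assume x: "E x (sc a)"
    then show "E (if x = a then zero else sc (ap g x)) W" using g unfolding inj_W_def by auto
    fix y assume "E y (sc a)"
      and "(if x = a then zero else sc (ap g x)) = (if y = a then zero else sc (ap g y))"
    moreover have "E x a \<Longrightarrow> E y a \<Longrightarrow> ap g x = ap g y \<Longrightarrow> x = y" using g unfolding inj_W_def by blast
    ultimately show "x = y" using x by (auto split: if_splits)
  qed
qed

lemma w1_sc: "E a w1 \<Longrightarrow> E (sc a) w1"
  using w1I cble_sc w1_props(3) w1_Ord by simp

lemma w1_zero: "E zero w1"
  using w1I[OF Ord_zero] cble_mem_W[OF W_zero] by blast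

lemma bun_absorb: "Ord a \<Longrightarrow> Ord b \<Longrightarrow> bun a b = a \<or> bun a b = b"
proof -
  assume o: "Ord a" "Ord b"
  consider "E a b" | "a = b" | "E b a" using Ord_lin[OF o] by blast
  then show ?thesis
  proof cases
    case 1
    then have "bun a b = b" by (intro ext) (auto dest: Ord_trans[OF o(2)])
    then show ?thesis by simp
  next
    case 2
    then have "bun a b = b" by (intro ext) auto
    then show ?thesis by simp
  next
    case 3
    then have "bun a b = a" by (intro ext) (auto dest: Ord_trans[OF o(1)])
    then show ?thesis by simp
  qed
qed

lemma w1_bun: "E a w1 \<Longrightarrow> E b w1 \<Longrightarrow> E (bun a b) w1"
  using bun_absorb[of a b] w1_Ord by metis

lemma bun_ge: "Ord a \<Longrightarrow> Ord b \<Longrightarrow> E a (sc (bun a b)) \<and> E b (sc (bun a b))"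
  using Ord_sub_iff[of a "bun a b"] Ord_sub_iff[of b "bun a b"] by simp

end

section \<open>Regularity of the first uncountable ordinal\<close>

context zf_ad
begin

text \<open>Enumerating a countable union of countable ordinals requires enumerations chosen
  simultaneously. Codes of ordinals are relations on \<omega>, so countable choice for reals
  provides them. With a relation \<open>P\<close> in place of a function, the least witnesses are
  taken inside the proof.\<close>

lemma w1_regular:
  assumes P0: "pd (\<lambda>s. P (s 0) (s 1))" and ex: "\<And>n. E n W \<Longrightarrow> \<exists>d. E d w1 \<and> P n d"
  shows "\<exists>d. E d w1 \<and> (\<forall>n. E n W \<longrightarrow> (\<exists>c. E c (sc d) \<and> P n c))"
proof -
  note pdP = pd_2[where R = P, OF P0]
  define D where "D n = mu (P n)" for n
  have ftD0: "ft (\<lambda>s. D (s 0))" unfolding D_def by (intro dfi pdP)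
  note ftD = ft_1[where F = D, OF ftD0]
  have D: "Ord (D n)" "P n (D n)" "cble (D n)" if n: "E n W" for n
  proof -
    obtain d where d: "E d w1" "P n d" using ex[OF n] by blast
    have p: "pd (\<lambda>s. P n (s 0))" by (intro dfi pdP)
    note m = mu_props[where P = "P n", OF p w1_Ord[OF d(1)] d(2), folded D_def]
    show "Ord (D n)" "P n (D n)" using m by blast+
    have "E (D n) w1" using Ord_le_trans[OF w1_props(1) m(4) d(1)] .
    then show "cble (D n)" by (rule w1_props(3))
  qed
  \<comment> \<open>Functions into \<omega> stand for relations: \<open>S x\<close> is the set of
    pairs at which \<open>x\<close> is nonzero.\<close>
  define S where "S x = sep (prd W W) (\<lambda>p. ap x p \<noteq> zero)" for x
  have mS: "E p (S x) \<longleftrightarrow> E p (prd W W) \<and> ap x p \<noteq> zero" for p x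
    unfolding S_def by (rule mem_sep) (intro dfi)
  have ftS0: "ft (\<lambda>s. S (s 0))" unfolding S_def by (intro dfi)
  note ftS = ft_1[where F = S, OF ftS0]
  have "pd (\<lambda>s. \<exists>g. codes g (D (s 0)) (S (s 1)))" by (intro dfi ftD ftS)
  moreover have "\<exists>x. is_fun E x (prd W W) W \<and> (\<exists>g. codes g (D n) (S x))" if n: "E n W" for n
  proof -
    obtain g R where g: "codes g (D n) R" "E R (pow (prd W W))" using codes_ex D[OF n] by blast
    let ?F = "\<lambda>p. if E p R then sc zero else zero"
    have ftF: "ft (\<lambda>s. ?F (s 0))" by (intro dfi)
    have "S (lam (prd W W) ?F) = R"
    proof (rule ext)
      fix p
      have "E p (prd W W) \<Longrightarrow> ap (lam (prd W W) ?F) p = ?F p" by (rule ap_lam[OF ftF])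
      then show "E p (S (lam (prd W W) ?F)) \<longleftrightarrow> E p R" unfolding mS using g(2) by (auto split: if_splits)
    qed
    moreover have "is_fun E (lam (prd W W) ?F) (prd W W) W" by (rule is_fun_lam[OF ftF]) simp
    ultimately show ?thesis using g(1) by metis
  qed
  ultimately obtain F where ftF: "ft (\<lambda>s. F (s 0))"
    and F: "\<And>n. E n W \<Longrightarrow> \<exists>g. codes g (D n) (S (F n))"
    using countable_choice[OF cble_prd[OF cble_W cble_W], where P = "\<lambda>n x. \<exists>g. codes g (D n) (S x)"]
    by blast
  note ftF' = ft_1[where F = F, OF ftF]
  \<comment> \<open>A code determines its injection uniquely, so no further choice is made.\<close>
  define G where "G n = dd (\<lambda>g. codes g (D n) (S (F n)))" for n
  have ftG0: "ft (\<lambda>s. G (s 0))" unfolding G_def by (intro dfi ftD ftS ftF')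
  note ftG = ft_1[where F = G, OF ftG0]
  have G: "codes (G n) (D n) (S (F n))" if n: "E n W" for n
    unfolding G_def by (rule dd_prop) (use F[OF n] codes_unique D(1)[OF n] in blast)
  define U where "U = un (rep W D)"
  have U: "E a U \<longleftrightarrow> (\<exists>n. E n W \<and> E a (D n))" for a unfolding U_def mem_un mem_rep[OF ftD0] by blast
  have oU: "Ord U" unfolding U_def by (rule Ord_un) (use D(1) in \<open>unfold mem_rep[OF ftD0], blast\<close>)
  define N where "N a = mu (\<lambda>n. E n W \<and> E a (D n))" for a
  have ftN0: "ft (\<lambda>s. N (s 0))" unfolding N_def by (intro dfi ftD)
  note ftN = ft_1[where F = N, OF ftN0]
  have N: "E (N a) W" "E a (D (N a))" if a: "E a U" for a
  proof -
    obtain n where n: "E n W" "E n W \<and> E a (D n)" using a unfolding U by blast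
    have p: "pd (\<lambda>s. E (s 0) W \<and> E a (D (s 0)))" by (intro dfi ftD)
    from mu_W[of "\<lambda>n. E n W \<and> E a (D n)", OF p n, folded N_def]
    show "E (N a) W" "E a (D (N a))" by blast+
  qed
  have "cble U"
  proof (rule cbleI[where F = "\<lambda>a. npair (N a) (ap (G (N a)) a)"])
    show "ft (\<lambda>s. npair (N (s 0)) (ap (G (N (s 0))) (s 0)))" by (intro dfi ftN ftG)
    fix a assume a: "E a U"
    have wa: "E (N a) W" "E (ap (G (N a)) a) W"
      using N[OF a] codesD(4)[OF G D(1)] by blast+
    then show "E (npair (N a) (ap (G (N a)) a)) W" by simp
    fix b assume b: "E b U" and e: "npair (N a) (ap (G (N a)) a) = npair (N b) (ap (G (N b)) b)"
    have wb: "E (N b) W" "E (ap (G (N b)) b) W"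
      using N[OF b] codesD(4)[OF G D(1)] by blast+
    have "N a = N b" "ap (G (N a)) a = ap (G (N b)) b" using npair_inj[OF wa wb] e by blast+
    then show "a = b" using codesD(3)[OF G[OF N(1)[OF a]] D(1)[OF N(1)[OF a]]] N[OF a] N[OF b] by simp
  qed
  then have "E U w1" using w1I oU by blast
  moreover have "E (D n) (sc U)" if n: "E n W" for n
    using Ord_sub_iff[OF D(1)[OF n] oU] n U by blast
  ultimately show ?thesis using D(2) by blast
qed

lemma w1_sup:
  assumes "ft (\<lambda>s. F (s 0))" "\<And>n. E n W \<Longrightarrow> E (F n) w1"
  shows "E (un (rep W F)) w1"
proof -
  have "pd (\<lambda>s. s 1 = F (s 0))" by (intro dfi ft_1[where F = F, OF assms(1)])
  from w1_regular[where P = "\<lambda>n d. d = F n", OF this] assms(2)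
  obtain d where d: "E d w1" "\<And>n. E n W \<Longrightarrow> E (F n) (sc d)" by blast
  have o: "Ord (un (rep W F))"
    by (rule Ord_un) (use assms(2) w1_Ord in \<open>unfold mem_rep[OF assms(1)], blast\<close>)
  have "E x d" if x: "E x (un (rep W F))" for x
  proof -
    obtain n where "E n W" "E x (F n)" using x unfolding mem_un mem_rep[OF assms(1)] by blast
    then show ?thesis using d(2)[of n] Ord_trans[OF w1_Ord[OF d(1)]] by auto
  qed
  then have "E (un (rep W F)) (sc d)" using Ord_sub_iff[OF o w1_Ord[OF d(1)]] by blast
  then show ?thesis using Ord_le_trans[OF w1_props(1) _ d(1)] by blast
qed

end

context zf
begin

section \<open>Ranks of well-founded relations\<close>

lemma W_bound3:
  assumes "E u W" "E v W" "E w W" shows "\<exists>n. E n W \<and> E u n \<and> E v n \<and> E w n"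
proof -
  have o: "Ord u" "Ord v" "Ord w" using assms W_Ord by blast+
  have "E (bun u v) W" using bun_absorb[OF o(1,2)] assms by metis
  then have "E (bun (bun u v) w) W" using bun_absorb[OF Ord_bun[OF o(1,2)] o(3)] assms by metis
  moreover have "E w (sc (bun (bun u v) w))" "E (bun u v) (sc (bun (bun u v) w))"
    using bun_ge[OF Ord_bun[OF o(1,2)] o(3)] by blast+
  moreover have "E u (sc (bun u v))" "E v (sc (bun u v))" using bun_ge[OF o(1,2)] by blast+
  moreover have "Ord (sc (bun (bun u v) w))" using o by simp
  ultimately have "E u (sc (bun (bun u v) w))" "E v (sc (bun (bun u v) w))"
    using Ord_le_trans[of "sc (bun (bun u v) w)"] by blast+
  moreover have "E (sc (bun (bun u v) w)) W" using \<open>E (bun (bun u v) w) W\<close> by (simp only: W_sc)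
  ultimately show ?thesis using \<open>E w (sc (bun (bun u v) w))\<close> by blast
qed

text \<open>The ranks form a transitive set of ordinals, hence an ordinal, and it is countable as an
  image of \<open>T\<close>; this range is the bound \<open>d\<close>.\<close>

lemma countable_rank:
  assumes wf: "wfon T R" and pdR0: "pd (\<lambda>s. R (s 0) (s 1))" and c: "cble T"
  shows "\<exists>\<rho> d. E d w1 \<and> (\<forall>v. E v T \<longrightarrow> E (ap \<rho> v) d \<and> (\<forall>u. E u T \<and> R u v \<longrightarrow> E (ap \<rho> u) (ap \<rho> v)))"
proof -
  note pdR = pd_2[where R = R, OF pdR0]
  let ?G = "\<lambda>v p. un (rep (pred T R v) (\<lambda>u. sc (ap p u)))"
  have ftG: "ft (\<lambda>s. ?G (s 0) (s 1))" unfolding pred_def by (intro dfi pdR)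
  have mp: "E u (pred T R v) \<longleftrightarrow> E u T \<and> R u v" for u v
    unfolding pred_def by (rule mem_sep) (intro dfi pdR)
  obtain \<rho> where \<rho>: "\<And>v. E v T \<Longrightarrow> ap \<rho> v = ?G v (lam (pred T R v) (ap \<rho>))"
    using wf_recursion[where G = ?G, OF wf pdR0 ftG] by blast
  have r: "ft (\<lambda>s. sc (ap p (s 0)))" for p by (intro dfi)
  have m: "E x (ap \<rho> v) \<longleftrightarrow> (\<exists>u. E u T \<and> R u v \<and> E x (sc (ap \<rho> u)))" if v: "E v T" for x v
  proof -
    have "E x (ap \<rho> v) \<longleftrightarrow> (\<exists>u. E u (pred T R v) \<and> E x (sc (ap (lam (pred T R v) (ap \<rho>)) u)))"
      unfolding \<rho>[OF v] mem_un mem_rep[where F = "\<lambda>u. sc (ap p u)" for p, OF r] by blast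
    also have "\<dots> \<longleftrightarrow> (\<exists>u. E u (pred T R v) \<and> E x (sc (ap \<rho> u)))"
      using ap_lam[OF ft_apc] by auto
    finally show ?thesis unfolding mp by blast
  qed
  have o: "Ord (ap \<rho> v)" if v: "E v T" for v
  proof (rule wfon_induct[where P = "\<lambda>v. Ord (ap \<rho> v)", OF wf _ _ v])
    show "pd (\<lambda>s. Ord (ap \<rho> (s 0)))" by (intro dfi)
    fix v assume v: "E v T" and IH: "\<And>u. E u T \<Longrightarrow> R u v \<Longrightarrow> Ord (ap \<rho> u)"
    show "Ord (ap \<rho> v)"
    proof (rule OrdI)
      fix x assume "E x (ap \<rho> v)"
      then obtain u where u: "E u T" "R u v" "E x (sc (ap \<rho> u))" unfolding m[OF v] by blast
      then show "Ord x" using IH[OF u(1,2)] Ord_mem[of "sc (ap \<rho> u)" x] by simp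
      fix y assume "E y x"
      then have "E y (sc (ap \<rho> u))" using u IH[OF u(1,2)] Ord_trans[of "sc (ap \<rho> u)" x y] by simp
      then show "E y (ap \<rho> v)" unfolding m[OF v] using u by blast
    qed
  qed
  define d where "d = rep T (ap \<rho>)"
  have d: "E x d \<longleftrightarrow> (\<exists>v. E v T \<and> x = ap \<rho> v)" for x unfolding d_def by (rule mem_rep[OF ft_apc])
  have tr: "\<forall>x. E x (ap \<rho> v) \<longrightarrow> E x d" if v: "E v T" for v
  proof (rule wfon_induct[where P = "\<lambda>v. \<forall>x. E x (ap \<rho> v) \<longrightarrow> E x d", OF wf _ _ v])
    show "pd (\<lambda>s. \<forall>x. E x (ap \<rho> (s 0)) \<longrightarrow> E x d)" by (intro dfi)
    fix v assume v: "E v T" and IH: "\<And>u. E u T \<Longrightarrow> R u v \<Longrightarrow> \<forall>x. E x (ap \<rho> u) \<longrightarrow> E x d"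
    show "\<forall>x. E x (ap \<rho> v) \<longrightarrow> E x d"
    proof (intro allI impI)
      fix x assume "E x (ap \<rho> v)"
      then obtain u where u: "E u T" "R u v" "E x (sc (ap \<rho> u))" unfolding m[OF v] by blast
      then have "E x (ap \<rho> u) \<or> x = ap \<rho> u" by simp
      then show "E x d" using IH[OF u(1,2)] u(1) d by blast
    qed
  qed
  have "Ord d"
  proof (rule OrdI)
    show "Ord x" if "E x d" for x using that o unfolding d by blast
    show "E x d" if xy: "E x y" "E y d" for x y
    proof -
      obtain v where "E v T" "y = ap \<rho> v" using xy(2) unfolding d by blast
      then show ?thesis using tr xy(1) by simp
    qed
  qed
  moreover have "cble d" unfolding d_def by (rule cble_rep[OF c ft_apc])
  ultimately have "E d w1" by (rule w1I)
  moreover have "E (ap \<rho> u) (ap \<rho> v)" if "E v T" "E u T" "R u v" for u v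
    unfolding m[OF that(1)] using that by (metis mem_sc)
  ultimately show ?thesis using d by blast
qed

section \<open>Relations coded by a run\<close>

text \<open>Player I describes a relation on \<omega> at the even stages, player II at the odd ones;
  a nonzero move puts the pair into the relation.\<close>

definition cpos where "cpos b u w = (if b then dbl (npair u w) else sc (dbl (npair u w)))"
definition edge where "edge b z u w \<longleftrightarrow> ap z (cpos b u w) \<noteq> zero"
definition lexle where "lexle k' j' k j \<longleftrightarrow> E k' k \<or> k' = k \<and> E j' (sc j)"
text \<open>The value \<open>a\<close> is a mark for nodes without a rank; the ranked nodes are
  closed downwards and their values decrease strictly. Each single condition concerns finitely many
  values only, so, unlike a rank function, such a map can be approximated by finite
  sequences.\<close>

definition emap where
  "emap b z e a \<longleftrightarrow> is_fun E e W (sc a) \<and>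
    (\<forall>u w. E u W \<and> E w W \<and> edge b z u w \<and> ap e w \<noteq> a \<longrightarrow> E (ap e u) (ap e w))"
text \<open>\<open>v\<close> lies in the well-founded part of the relation and has rank less than
  \<open>a\<close>.\<close>

definition rklt where "rklt b z v a \<longleftrightarrow> (\<exists>e. emap b z e a \<and> ap e v \<noteq> a)"
text \<open>A single map ranks all nodes up to \<open>(k, j)\<close>, so that no maps have to be
  selected node by node.\<close>

definition JR where
  "JR b z k j a \<longleftrightarrow> (\<exists>e. emap b z e a \<and>
    (\<forall>k' j'. E k' W \<and> E j' W \<and> lexle k' j' k j \<longrightarrow> ap e (npair k' j') \<noteq> a))"
definition OK where "OK b z k j \<longleftrightarrow> (\<exists>a. Ord a \<and> JR b z k j a)"

lemma ft_cpos [dfi]: "ft u \<Longrightarrow> ft w \<Longrightarrow> ft (\<lambda>s. cpos b (u s) (w s))"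
  unfolding cpos_def by (intro dfi)
lemma pd_edge [dfi]: "ft z \<Longrightarrow> ft u \<Longrightarrow> ft w \<Longrightarrow> pd (\<lambda>s. edge b (z s) (u s) (w s))"
  unfolding edge_def by (intro dfi)
lemma pd_lexle [dfi]: "ft k' \<Longrightarrow> ft j' \<Longrightarrow> ft k \<Longrightarrow> ft j \<Longrightarrow> pd (\<lambda>s. lexle (k' s) (j' s) (k s) (j s))"
  unfolding lexle_def by (intro dfi)
lemma pd_emap0: "pd (\<lambda>s. emap b (s 0) (s 1) (s 2))" unfolding emap_def by (intro dfi)
lemmas pd_emap [dfi] = pd_3[where R = "emap b" for b, OF pd_emap0]
lemma pd_rklt0: "pd (\<lambda>s. rklt b (s 0) (s 1) (s 2))" unfolding rklt_def by (intro dfi)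
lemmas pd_rklt [dfi] = pd_3[where R = "rklt b" for b, OF pd_rklt0]
lemma pd_JR0: "pd (\<lambda>s. JR b (s 0) (s 1) (s 2) (s 3))" unfolding JR_def by (intro dfi)
lemmas pd_JR [dfi] = pd_4[where R = "JR b" for b, OF pd_JR0]
lemma pd_OK0: "pd (\<lambda>s. OK b (s 0) (s 1) (s 2))" unfolding OK_def by (intro dfi)
lemmas pd_OK [dfi] = pd_3[where R = "OK b" for b, OF pd_OK0]

lemma cpos_W [simp]: "E u W \<Longrightarrow> E w W \<Longrightarrow> E (cpos b u w) W"
  unfolding cpos_def by simp

lemma own_cpos: "E u W \<Longrightarrow> E w W \<Longrightarrow> own b (cpos c u w) \<longleftrightarrow> b = c"
  unfolding own_def cpos_def using Even_dbl[of "npair u w"] not_Even_sc_dbl[of "npair u w"] by auto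

lemma cpos_inj:
  "E u W \<Longrightarrow> E w W \<Longrightarrow> E u' W \<Longrightarrow> E w' W \<Longrightarrow> cpos b u w = cpos b u' w' \<longleftrightarrow> u = u' \<and> w = w'"
  unfolding cpos_def by (simp add: dbl_inj npair_inj)

lemma lexle_refl [simp]: "lexle k j k j"
  unfolding lexle_def by simp

lemma JR_rklt: "E k W \<Longrightarrow> E j W \<Longrightarrow> JR b z k j a \<Longrightarrow> rklt b z (npair k j) a"
  unfolding JR_def rklt_def using lexle_refl by blast

lemma emapD:
  assumes "emap b z e a"
  shows "E u W \<Longrightarrow> E (ap e u) (sc a)"
    "E u W \<Longrightarrow> E w W \<Longrightarrow> edge b z u w \<Longrightarrow> ap e w \<noteq> a \<Longrightarrow> E (ap e u) (ap e w)" "fn e W"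
  using assms unfolding emap_def is_fun_iff by blast+

text \<open>Only the mark for unranked nodes moves, from \<open>a\<close> to \<open>c\<close>; the
  ranks stay as they are.\<close>

lemma emap_mono:
  assumes e: "emap b z e a" and le: "E a (sc c)" "Ord c"
  shows "\<exists>e'. emap b z e' c \<and> (\<forall>v. E v W \<longrightarrow> (ap e' v = c \<longleftrightarrow> ap e v = a))"
proof -
  have oa: "Ord a" using le Ord_mem[of "sc c" a] by simp
  have sub: "E x c" if "E x a" for x using that le Ord_sub_iff[OF oa le(2)] by blast
  let ?F = "\<lambda>u. if ap e u = a then c else ap e u"
  have ftF: "ft (\<lambda>s. ?F (s 0))" by (intro dfi)
  note F = ap_lam[of ?F, OF ftF]
  have ea: "E (ap e u) a" if "E u W" "ap e u \<noteq> a" for u using emapD(1)[OF e that(1)] that(2) by simp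
  have ne: "?F u = c \<longleftrightarrow> ap e u = a" if "E u W" for u
  proof (cases "ap e u = a")
    case False
    then have "E (ap e u) c" using sub ea[OF that] by blast
    then have "ap e u \<noteq> c" by auto
    then show ?thesis using False by simp
  qed simp
  have "emap b z (lam W ?F) c" unfolding emap_def
  proof (intro conjI allI impI)
    show "is_fun E (lam W ?F) W (sc c)"
      by (rule is_fun_lam[OF ftF]) (use ea sub in auto)
    fix u w assume h: "E u W \<and> E w W \<and> edge b z u w \<and> ap (lam W ?F) w \<noteq> c"
    then have w: "ap e w \<noteq> a" using F[of w W] ne by auto
    have 1: "E (ap e u) (ap e w)" using emapD(2)[OF e] h w by blast
    then have "ap e u \<noteq> a" using ea[of w] w h mem_asym by blast
    then show "E (ap (lam W ?F) u) (ap (lam W ?F) w)" using F[of u W] F[of w W] h 1 w by simp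
  qed
  moreover have "\<forall>v. E v W \<longrightarrow> (ap (lam W ?F) v = c \<longleftrightarrow> ap e v = a)" using F[of _ W] ne by simp
  ultimately show ?thesis by blast
qed

lemma rklt_mono: "rklt b z v a \<Longrightarrow> E a (sc c) \<Longrightarrow> Ord c \<Longrightarrow> E v W \<Longrightarrow> rklt b z v c"
  unfolding rklt_def using emap_mono by metis

lemma JR_mono:
  assumes "JR b z k j a" "E a (sc c)" "Ord c" shows "JR b z k j c"
proof -
  obtain e where e: "emap b z e a"
    "\<And>k' j'. E k' W \<Longrightarrow> E j' W \<Longrightarrow> lexle k' j' k j \<Longrightarrow> ap e (npair k' j') \<noteq> a"
    using assms(1) unfolding JR_def by blast
  obtain e' where e': "emap b z e' c" "\<And>v. E v W \<Longrightarrow> ap e' v = c \<longleftrightarrow> ap e v = a"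
    using emap_mono[OF e(1) assms(2,3)] by blast
  show ?thesis unfolding JR_def
    by (rule exI[of _ e']) (use e(2) e' npair_W in blast)
qed

section \<open>The boundedness lemma\<close>

text \<open>An entry of a tree sequence is a triple: a move of the run, a value of the ranking, a
  node of the path.\<close>

definition zc where "zc t i = pfst (ap t i)"
definition ec where "ec t i = pfst (psnd (ap t i))"
definition ac where "ac t i = psnd (psnd (ap t i))"

lemma ft_zc [dfi]: "ft t \<Longrightarrow> ft i \<Longrightarrow> ft (\<lambda>s. zc (t s) (i s))" unfolding zc_def by (intro dfi)
lemma ft_ec [dfi]: "ft t \<Longrightarrow> ft i \<Longrightarrow> ft (\<lambda>s. ec (t s) (i s))" unfolding ec_def by (intro dfi)
lemma ft_ac [dfi]: "ft t \<Longrightarrow> ft i \<Longrightarrow> ft (\<lambda>s. ac (t s) (i s))" unfolding ac_def by (intro dfi)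

text \<open>\<open>Loc \<tau> b k j a t n\<close>: as far as its first \<open>n\<close> entries can tell, \<open>t\<close> lists a run of \<open>\<tau>\<close>, a map
  into \<open>a + 1\<close> ranking the opponent's relation, and a path through the own relation that descends
  from the node \<open>(k, j)\<close>.\<close>

definition Loc where
  "Loc \<tau> b k j a t n \<longleftrightarrow>
    (\<forall>i. E i n \<and> own b i \<longrightarrow> zc t i = ap \<tau> (lam i (zc t))) \<and>
    (\<forall>u w. E u n \<and> E w n \<and> E (cpos (\<not> b) u w) n \<and> zc t (cpos (\<not> b) u w) \<noteq> zero \<and> ec t w \<noteq> a \<longrightarrow>
      E (ec t u) (ec t w)) \<and>
    (\<forall>k' j'. E k' W \<and> E j' W \<and> lexle k' j' k j \<and> E (npair k' j') n \<longrightarrow> ec t (npair k' j') \<noteq> a) \<and>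
    (E zero n \<longrightarrow> ac t zero = npair k j) \<and>
    (\<forall>i. E (sc i) n \<and> E (cpos b (ac t (sc i)) (ac t i)) n \<longrightarrow>
      zc t (cpos b (ac t (sc i)) (ac t i)) \<noteq> zero)"

lemma pd_Loc0: "pd (\<lambda>s. Loc \<tau> b k j a (s 0) (s 1))" unfolding Loc_def by (intro dfi)
lemmas pd_Loc [dfi] = pd_2[where R = "Loc \<tau> b k j a" for \<tau> b k j a, OF pd_Loc0]

lemma LocD:
  assumes "Loc \<tau> b k j a t n"
  shows "E i n \<Longrightarrow> own b i \<Longrightarrow> zc t i = ap \<tau> (lam i (zc t))"
    "E u n \<Longrightarrow> E w n \<Longrightarrow> E (cpos (\<not> b) u w) n \<Longrightarrow> zc t (cpos (\<not> b) u w) \<noteq> zero \<Longrightarrow> ec t w \<noteq> a \<Longrightarrow>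
      E (ec t u) (ec t w)"
    "E k' W \<Longrightarrow> E j' W \<Longrightarrow> lexle k' j' k j \<Longrightarrow> E (npair k' j') n \<Longrightarrow> ec t (npair k' j') \<noteq> a"
    "E zero n \<Longrightarrow> ac t zero = npair k j"
    "E (sc i) n \<Longrightarrow> E (cpos b (ac t (sc i)) (ac t i)) n \<Longrightarrow> zc t (cpos b (ac t (sc i)) (ac t i)) \<noteq> zero"
proof -
  note * = assms[unfolded Loc_def]
  show "E i n \<Longrightarrow> own b i \<Longrightarrow> zc t i = ap \<tau> (lam i (zc t))" using *[THEN conjunct1] by blast
  note * = *[THEN conjunct2]
  show "E u n \<Longrightarrow> E w n \<Longrightarrow> E (cpos (\<not> b) u w) n \<Longrightarrow> zc t (cpos (\<not> b) u w) \<noteq> zero \<Longrightarrow> ec t w \<noteq> a \<Longrightarrow>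
      E (ec t u) (ec t w)" using *[THEN conjunct1] by blast
  note * = *[THEN conjunct2]
  show "E k' W \<Longrightarrow> E j' W \<Longrightarrow> lexle k' j' k j \<Longrightarrow> E (npair k' j') n \<Longrightarrow> ec t (npair k' j') \<noteq> a"
    using *[THEN conjunct1] by blast
  note * = *[THEN conjunct2]
  show "E zero n \<Longrightarrow> ac t zero = npair k j" using *[THEN conjunct1] by blast
  show "E (sc i) n \<Longrightarrow> E (cpos b (ac t (sc i)) (ac t i)) n \<Longrightarrow> zc t (cpos b (ac t (sc i)) (ac t i)) \<noteq> zero"
    using *[THEN conjunct2] by blast
qed

text \<open>Longer sequences count as smaller, so that well-foundedness excludes infinite
  branches.\<close>

definition ext_of where "ext_of u t \<longleftrightarrow> (\<forall>p. E p t \<longrightarrow> E p u) \<and> u \<noteq> t"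

lemma pd_ext_of [dfi]: "ft u \<Longrightarrow> ft t \<Longrightarrow> pd (\<lambda>s. ext_of (u s) (t s))"
  by (rule pd_2[where R = ext_of]) (unfold ext_of_def, intro dfi)

lemma sub_ap:
  assumes "fn s n" "fn t m" "\<And>p. E p s \<Longrightarrow> E p t" "E i n" shows "E i m \<and> ap s i = ap t i"
proof -
  have "E (pr i (ap s i)) s" using assms(1,4) mem_fn by blast
  then have "E (pr i (ap s i)) t" by (rule assms(3))
  then show ?thesis unfolding mem_fn[OF assms(2)] by simp
qed

text \<open>Dependent choice is not needed, because \<open>FS A\<close> is countable.\<close>

lemma infinite_branch:
  assumes A: "cble A" and S: "\<And>t. E t S \<Longrightarrow> E t (FS A)" "E t0 S"
    and ex: "\<And>t. E t S \<Longrightarrow> \<exists>u. E u S \<and> ext_of u t"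
  shows "\<exists>f. is_fun E f W A \<and> (\<forall>n. E n W \<longrightarrow> (\<exists>t l. E t S \<and> E l W \<and> E n l \<and> fn t l \<and>
    (\<forall>i. E i l \<longrightarrow> ap t i = ap f i)))"
proof -
  obtain g where g: "\<And>t. E t (FS A) \<Longrightarrow> E (ap g t) W"
    "\<And>t u. E t (FS A) \<Longrightarrow> E u (FS A) \<Longrightarrow> ap g t = ap g u \<Longrightarrow> t = u"
    using cble_FS[OF A] unfolding cble_def inj_W_def by blast
  let ?M = "\<lambda>t n. \<exists>u. E u S \<and> ext_of u t \<and> n = ap g u"
  \<comment> \<open>Among the proper extensions in \<open>S\<close>, the one with the least code is
    taken.\<close>
  define nx where "nx t = dd (\<lambda>u. E u S \<and> ext_of u t \<and> ap g u = mu (?M t))" for t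
  have nx: "E (nx t) S \<and> ext_of (nx t) t" if t: "E t S" for t
  proof -
    obtain u where u: "E u S" "ext_of u t" using ex[OF t] by blast
    have p: "pd (\<lambda>s. ?M t (s 0))" by (intro dfi)
    have "?M t (mu (?M t))"
      by (rule mu_W(2)[where P = "?M t", OF p g(1)[OF S(1)[OF u(1)]]]) (use u in blast)
    then obtain v where v: "E v S" "ext_of v t" "ap g v = mu (?M t)" by metis
    have "nx t = v" unfolding nx_def
    proof (rule dd_eq)
      show "E v S \<and> ext_of v t \<and> ap g v = mu (?M t)" using v by blast
      fix w assume "E w S \<and> ext_of w t \<and> ap g w = mu (?M t)"
      then show "w = v" using v g(2)[OF S(1) S(1), of w v] by simp
    qed
    then show ?thesis using v by simp
  qed
  have ftn0: "ft (\<lambda>s. nx (s 0))" unfolding nx_def by (intro dfi)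
  have "ft (\<lambda>s. nx (s 1))" by (rule ft_1[where F = nx, OF ftn0]) (intro dfi)
  from nat_recursion[of "\<lambda>n x. nx x", OF this, of t0] obtain c
    where c0: "ap c zero = t0" and cs: "\<And>n. E n W \<Longrightarrow> ap c (sc n) = nx (ap c n)" by blast
  have cS: "E (ap c n) S" if n: "E n W" for n
  proof -
    have p: "pd (\<lambda>s. E (ap c (s 0)) S)" by (intro dfi)
    from n p show ?thesis by (induction n rule: W_induct) (use c0 S(2) cs nx in simp_all)
  qed
  have step: "ext_of (ap c (sc n)) (ap c n)" if "E n W" for n
    using cs[OF that] nx[OF cS[OF that]] by simp
  have mono: "E p (ap c n)" if n: "E n W" and "E m (sc n)" "E p (ap c m)" for m n p
  proof -
    have q: "pd (\<lambda>s. \<forall>m. E m (sc (s 0)) \<longrightarrow> (\<forall>p. E p (ap c m) \<longrightarrow> E p (ap c (s 0))))" by (intro dfi)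
    from n q have "\<forall>m. E m (sc n) \<longrightarrow> (\<forall>p. E p (ap c m) \<longrightarrow> E p (ap c n))"
    proof (induction n rule: W_induct)
      case zero
      then show ?case by simp
    next
      case (sc n)
      have "E p (ap c (sc n))" if "E p (ap c n)" for p using step[OF sc(1)] that unfolding ext_of_def by blast
      then show ?case using sc(2) by auto
    qed
    then show ?thesis using that by blast
  qed
  \<comment> \<open>Each step extends properly, so the sequence at stage \<open>n\<close> has length
    at least \<open>n\<close>; entry \<open>i\<close> can therefore be read at stage
    \<open>sc i\<close>.\<close>
  have len: "\<exists>l. E l W \<and> is_fun E (ap c n) l A \<and> E n (sc l)" if n: "E n W" for n
  proof -
    have p: "pd (\<lambda>s. \<exists>l. E l W \<and> is_fun E (ap c (s 0)) l A \<and> E (s 0) (sc l))" by (intro dfi)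
    from n p show ?thesis
    proof (induction n rule: W_induct)
      case zero
      obtain l where "E l W" "is_fun E (ap c zero) l A" using S(1)[OF cS[OF W_zero]] unfolding mem_FS by blast
      moreover have "E zero (sc l)" using Ord_zero_mem[of "sc l"] W_Ord[OF \<open>E l W\<close>] by simp
      ultimately show ?case by blast
    next
      case (sc n)
      obtain l where l: "E l W" "is_fun E (ap c n) l A" "E n (sc l)" using sc(2) by blast
      obtain m where m: "E m W" "is_fun E (ap c (sc n)) m A"
        using S(1)[OF cS, of "sc n"] sc(1) unfolding mem_FS by auto
      have sb: "E p (ap c (sc n))" if "E p (ap c n)" for p using step[OF sc(1)] that unfolding ext_of_def by blast
      note sa = sub_ap[OF is_fun_fn[OF l(2)] is_fun_fn[OF m(2)] sb]
      have "E l (sc m)" using Ord_sub_iff[OF W_Ord[OF l(1)] W_Ord[OF m(1)]] sa by blast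
      moreover have "l \<noteq> m"
      proof
        assume "l = m"
        then have "ap c n = ap c (sc n)"
          using fn_eqI[OF is_fun_fn[OF l(2)]] is_fun_fn[OF m(2)] sa by blast
        then show False using step[OF sc(1)] unfolding ext_of_def by simp
      qed
      ultimately have "E l m" by simp
      then have "E n m" using Ord_le_trans[OF W_Ord[OF m(1)] l(3)] by blast
      then have "E (sc n) (sc m)" using sc_mem_sc[OF W_Ord[OF m(1)]] by blast
      then show ?case using m by blast
    qed
  qed
  let ?F = "\<lambda>i. ap (ap c (sc i)) i"
  have ftF: "ft (\<lambda>s. ?F (s 0))" by (intro dfi)
  define f where "f = lam W ?F"
  have f: "ap f i = ?F i" if "E i W" for i unfolding f_def by (rule ap_lam[OF ftF that])
  have agree: "ap (ap c n) i = ap f i" if n: "E n W" and l: "fn (ap c n) l" "E i l" "E l W" for n l i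
  proof -
    have i: "E i W" using W_trans l by blast
    then obtain m where m: "E m W" "is_fun E (ap c (sc i)) m A" "E (sc i) (sc m)" using len[of "sc i"] by auto
    have im: "E i m" using m(3) sc_mem_sc[OF W_Ord[OF m(1)]] by blast
    consider "E n (sc (sc i))" | "E (sc i) (sc n)"
      using Ord_lin[of n "sc i"] W_Ord n i by auto
    then have "ap (ap c n) i = ap (ap c (sc i)) i"
    proof cases
      case 1
      show ?thesis using sub_ap[OF l(1) is_fun_fn[OF m(2)] mono[OF _ 1] l(2)] i by simp
    next
      case 2
      show ?thesis using sub_ap[OF is_fun_fn[OF m(2)] l(1) mono[OF n 2] im] by simp
    qed
    then show ?thesis using f[OF i] by simp
  qed
  have "is_fun E f W A" unfolding f_def
  proof (rule is_fun_lam[OF ftF])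
    fix i assume i: "E i W"
    then obtain m where m: "E m W" "is_fun E (ap c (sc i)) m A" "E (sc i) (sc m)" using len[of "sc i"] by auto
    have im: "E i m" using m(3) sc_mem_sc[OF W_Ord[OF m(1)]] by blast
    show "E (?F i) A" by (rule is_fun_ap[OF m(2) im])
  qed
  moreover have "\<exists>t l. E t S \<and> E l W \<and> E n l \<and> fn t l \<and> (\<forall>i. E i l \<longrightarrow> ap t i = ap f i)" if n: "E n W" for n
  proof -
    obtain m where m: "E m W" "is_fun E (ap c (sc n)) m A" "E (sc n) (sc m)" using len[of "sc n"] n by auto
    have "E n m" using m(3) sc_mem_sc[OF W_Ord[OF m(1)]] by blast
    moreover have "E (ap c (sc n)) S" using cS n by simp
    moreover have "\<forall>i. E i m \<longrightarrow> ap (ap c (sc n)) i = ap f i"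
      using agree[OF _ is_fun_fn[OF m(2)] _ m(1)] n by simp
    ultimately show ?thesis using m(1) is_fun_fn[OF m(2)] by blast
  qed
  ultimately show ?thesis by blast
qed

text \<open>The bound is uniform: \<open>d\<close> may depend on the bound \<open>a\<close> for the
  opponent's ranks, but not on the run.\<close>

definition Good where
  "Good \<tau> b k j a d \<longleftrightarrow> (\<forall>z. run \<tau> b z \<and> JR (\<not> b) z k j a \<longrightarrow> rklt b z (npair k j) d)"

text \<open>The attempts to build a run of \<open>\<tau>\<close>, a ranking of the opponent's relation below \<open>(k, j)\<close>, and
  a descending path through the own relation from \<open>(k, j)\<close> form a well-founded tree on a countable
  set; its rank bounds the rank of \<open>(k, j)\<close>.\<close>

lemma boundedness:
  assumes \<tau>: "is_fun E \<tau> (FS W) W"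
    and win: "\<And>z k j. run \<tau> b z \<Longrightarrow> E k W \<Longrightarrow> E j W \<Longrightarrow> OK (\<not> b) z k j \<Longrightarrow> OK b z k j"
    and k: "E k W" and j: "E j W" and a: "E a w1"
  shows "\<exists>d. E d w1 \<and> Good \<tau> b k j a d"
proof -
  define A where "A = prd W (prd (sc a) W)"
  have oa: "Ord a" using w1_Ord[OF a] .
  have cA: "cble A" unfolding A_def
    using cble_prd[OF cble_W cble_prd[OF cble_sc[OF w1_props(3)[OF a]] cble_W]] .
  have Ac: "E (pfst x) W" "E (pfst (psnd x)) (sc a)" "E (psnd (psnd x)) W" if "E x A" for x
    using that unfolding A_def mem_prd by force+
  define T where "T = sep (FS A) (\<lambda>t. \<exists>n. E n W \<and> fn t n \<and> Loc \<tau> b k j a t n)"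
  have pdT: "pd (\<lambda>s. \<exists>n. E n W \<and> fn (s 0) n \<and> Loc \<tau> b k j a (s 0) n)" by (intro dfi)
  have T: "E t T \<longleftrightarrow> E t (FS A) \<and> (\<exists>n. E n W \<and> fn t n \<and> Loc \<tau> b k j a t n)" for t
    unfolding T_def by (rule mem_sep[OF pdT])
  have cT: "cble T" by (rule cble_subset[OF cble_FS[OF cA]]) (simp add: T)
  \<comment> \<open>An infinite branch yields a run in which the opponent's relation is ranked up to
    \<open>(k, j)\<close>. The strategy then has its own relation ranked at \<open>(k, j)\<close>
    too, against the infinite descending path from there.\<close>
  have wf: "wfon T ext_of" unfolding wfon_def
  proof (intro allI impI, rule ccontr)
    fix S assume S: "(\<forall>x. E x S \<longrightarrow> E x T) \<and> (\<exists>x. E x S)"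
      and "\<nexists>m. E m S \<and> (\<forall>u. E u S \<longrightarrow> \<not> ext_of u m)"
    then have ex: "\<exists>u. E u S \<and> ext_of u t" if "E t S" for t using that by blast
    obtain t0 where t0: "E t0 S" using S by blast
    have ST: "E t T" if "E t S" for t using S that by blast
    have SF: "E t (FS A)" if "E t S" for t using ST[OF that] T by blast
    obtain f where f: "is_fun E f W A" and seg: "\<And>n. E n W \<Longrightarrow> \<exists>t l. E t S \<and> E l W \<and> E n l \<and> fn t l \<and>
      (\<forall>i. E i l \<longrightarrow> ap t i = ap f i)"
      using infinite_branch[OF cA SF t0 ex] by blast
    have loc: "\<exists>t l. E l W \<and> E n l \<and> Loc \<tau> b k j a t l \<and> (\<forall>i. E i l \<longrightarrow> ap t i = ap f i)" if n: "E n W" for n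
    proof -
      obtain t l where t: "E t S" "E l W" "E n l" "fn t l" "\<forall>i. E i l \<longrightarrow> ap t i = ap f i"
        using seg[OF n] by blast
      obtain m where m: "fn t m" "Loc \<tau> b k j a t m" using ST[OF t(1)] T by blast
      have "m = l" using fn_dom_unique[OF m(1) t(4)] .
      then show ?thesis using t m by blast
    qed
    have fA: "E (zc f i) W" "E (ec f i) (sc a)" "E (ac f i) W" if "E i W" for i
      using Ac[OF is_fun_ap[OF f that]] unfolding zc_def ec_def ac_def by blast+
    have ftz: "ft (\<lambda>s. zc f (s 0))" and fte: "ft (\<lambda>s. ec f (s 0))" and fta: "ft (\<lambda>s. ac f (s 0))"
      by (intro dfi)+
    define z e where "z = lam W (zc f)" and "e = lam W (ec f)"
    have z: "ap z i = zc f i" and e: "ap e i = ec f i" if "E i W" for i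
      unfolding z_def e_def using ap_lam[OF ftz that] ap_lam[OF fte that] .
    have zf: "is_fun E z W W" unfolding z_def by (rule is_fun_lam[OF ftz fA(1)])
    have comp: "zc t i = zc f i" "ec t i = ec f i" "ac t i = ac f i" if "ap t i = ap f i" for t i
      unfolding zc_def ec_def ac_def using that by simp_all
    have r: "run \<tau> b z" unfolding run_def
    proof (intro conjI allI impI)
      fix i assume i: "E i W \<and> own b i"
      obtain t l where t: "E l W" "E i l" "Loc \<tau> b k j a t l" "\<And>i. E i l \<Longrightarrow> ap t i = ap f i"
        using loc[of i] i by blast
      have "lam i (zc t) = lam i (ap z)"
      proof (rule lam_cong)
        show "ft (\<lambda>s. zc t (s 0))" "ft (\<lambda>s. ap z (s 0))" by (intro dfi)+
        fix m assume m: "E m i"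
        then have "E m l" using Ord_trans[OF W_Ord[OF t(1)] t(2)] by blast
        then show "zc t m = ap z m" using comp(1)[OF t(4)] z[OF W_trans[of i m]] i m by simp
      qed
      then show "ap z i = ap \<tau> (lam i (ap z))"
        using LocD(1)[OF t(3,2)] comp(1)[OF t(4)[OF t(2)]] z i by simp
    qed (rule zf)
    have em: "emap (\<not> b) z e a" unfolding emap_def
    proof (intro conjI allI impI)
      show "is_fun E e W (sc a)" unfolding e_def by (rule is_fun_lam[OF fte fA(2)])
      fix u w assume h: "E u W \<and> E w W \<and> edge (\<not> b) z u w \<and> ap e w \<noteq> a"
      then have cW: "E (cpos (\<not> b) u w) W" and uw: "E u W" "E w W" by simp_all
      \<comment> \<open>The condition mentions three places, so it is already decided on a segment
        longer than all of them.\<close>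
      then obtain n where n: "E n W" "E u n" "E w n" "E (cpos (\<not> b) u w) n"
        using W_bound3 h by blast
      obtain t l where t: "E l W" "E n l" "Loc \<tau> b k j a t l" "\<And>i. E i l \<Longrightarrow> ap t i = ap f i"
        using loc[OF n(1)] by blast
      have l: "E u l" "E w l" "E (cpos (\<not> b) u w) l" using n Ord_trans[OF W_Ord[OF t(1)] t(2)] by blast+
      have "zc t (cpos (\<not> b) u w) \<noteq> zero" "ec t w \<noteq> a"
        using h comp(1)[OF t(4)[OF l(3)]] comp(2)[OF t(4)[OF l(2)]] z[OF cW] e[OF uw(2)] unfolding edge_def by simp_all
      from LocD(2)[OF t(3) l this] show "E (ap e u) (ap e w)"
        using comp(2)[OF t(4)[OF l(1)]] comp(2)[OF t(4)[OF l(2)]] e[OF uw(1)] e[OF uw(2)] by simp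
    qed
    have "JR (\<not> b) z k j a" unfolding JR_def
    proof (intro exI conjI allI impI)
      fix k' j' assume h: "E k' W \<and> E j' W \<and> lexle k' j' k j"
      have nW: "E (npair k' j') W" using h by simp
      obtain t l where t: "E l W" "E (npair k' j') l" "Loc \<tau> b k j a t l" "\<And>i. E i l \<Longrightarrow> ap t i = ap f i"
        using loc[OF nW] by blast
      show "ap e (npair k' j') \<noteq> a"
        using LocD(3)[OF t(3) _ _ _ t(2)] h comp(2)[OF t(4)[OF t(2)]] e[OF nW] by simp
    qed (rule em)
    then have "OK b z k j" using win[OF r k j] oa unfolding OK_def by blast
    then obtain c e' where c: "Ord c" "emap b z e' c" "ap e' (npair k j) \<noteq> c"
      unfolding OK_def using JR_rklt[OF k j] unfolding rklt_def by blast
    have a0: "ac f zero = npair k j"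
    proof -
      obtain t l where t: "E l W" "E zero l" "Loc \<tau> b k j a t l" "\<And>i. E i l \<Longrightarrow> ap t i = ap f i"
        using loc[OF W_zero] by blast
      then show ?thesis using LocD(4)[OF t(3,2)] comp(3)[OF t(4)[OF t(2)]] by simp
    qed
    have ed: "edge b z (ac f (sc i)) (ac f i)" if i: "E i W" for i
    proof -
      have cW: "E (cpos b (ac f (sc i)) (ac f i)) W" using fA(3) i by simp
      obtain n where n: "E n W" "E i n" "E (sc i) n" "E (cpos b (ac f (sc i)) (ac f i)) n"
        using W_bound3[OF i _ cW, of "sc i"] i by auto
      obtain t l where t: "E l W" "E n l" "Loc \<tau> b k j a t l" "\<And>i. E i l \<Longrightarrow> ap t i = ap f i"
        using loc[OF n(1)] by blast
      have l: "E i l" "E (sc i) l" "E (cpos b (ac f (sc i)) (ac f i)) l"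
        using n Ord_trans[OF W_Ord[OF t(1)] t(2)] by blast+
      have "ac t i = ac f i" "ac t (sc i) = ac f (sc i)" using comp(3) t(4) l by blast+
      then have "zc t (cpos b (ac f (sc i)) (ac f i)) \<noteq> zero" using LocD(5)[OF t(3) l(2)] l(3) by simp
      then show ?thesis unfolding edge_def using comp(1)[OF t(4)[OF l(3)]] z[OF cW] by simp
    qed
    have desc: "ap e' (ac f i) \<noteq> c" if i: "E i W" for i
    proof -
      have p: "pd (\<lambda>s. ap e' (ac f (s 0)) \<noteq> c)" by (intro dfi)
      from i p show ?thesis
      proof (induction i rule: W_induct)
        case zero
        then show ?case using a0 c by simp
      next
        case (sc i)
        have aW: "E (ac f (sc i)) W" "E (ac f i) W" using fA(3) sc(1) by simp_all
        have "E (ap e' (ac f (sc i))) (ap e' (ac f i))"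
          by (rule emapD(2)[OF c(2) aW ed[OF sc(1)] sc(2)])
        moreover have "E (ap e' (ac f i)) c" using emapD(1)[OF c(2) aW(2)] sc(2) by simp
        ultimately show ?case using mem_asym by blast
      qed
    qed
    \<comment> \<open>The ranks along the path form a set without an \<open>E\<close>-minimal
      element.\<close>
    have ftr: "ft (\<lambda>s. ap e' (ac f (s 0)))" by (intro dfi)
    note rr = mem_rep[of "\<lambda>i. ap e' (ac f i)", OF ftr, of _ W]
    have "E (ap e' (ac f zero)) (rep W (\<lambda>i. ap e' (ac f i)))" unfolding rr using W_zero by blast
    from foundation[OF this] obtain i where i: "E i W"
      "\<And>x. E x (rep W (\<lambda>i. ap e' (ac f i))) \<Longrightarrow> \<not> E x (ap e' (ac f i))" unfolding rr by blast
    have "E (ap e' (ac f (sc i))) (ap e' (ac f i))"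
      by (rule emapD(2)[OF c(2) _ _ ed[OF i(1)] desc[OF i(1)]]) (use fA(3) i(1) in simp_all)
    moreover have "E (ap e' (ac f (sc i))) (rep W (\<lambda>i. ap e' (ac f i)))"
      unfolding rr using i(1) W_sc by blast
    ultimately show False using i(2) by blast
  qed
  have "pd (\<lambda>s. ext_of (s 0) (s 1))" by (intro dfi)
  from countable_rank[OF wf this cT] obtain \<rho> d where d: "E d w1"
    and \<rho>: "\<And>v. E v T \<Longrightarrow> E (ap \<rho> v) d"
    "\<And>u v. E v T \<Longrightarrow> E u T \<Longrightarrow> ext_of u v \<Longrightarrow> E (ap \<rho> u) (ap \<rho> v)" by blast
  have od: "Ord d" using w1_Ord[OF d] .
  have "rklt b z (npair k j) d" if r: "run \<tau> b z" and J: "JR (\<not> b) z k j a" for z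
  proof -
    obtain e where e: "emap (\<not> b) z e a"
      "\<And>k' j'. E k' W \<Longrightarrow> E j' W \<Longrightarrow> lexle k' j' k j \<Longrightarrow> ap e (npair k' j') \<noteq> a"
      using J unfolding JR_def by blast
    have zf: "is_fun E z W W" using r unfolding run_def by blast
    \<comment> \<open>Once the run \<open>z\<close> and the ranking \<open>e\<close> are fixed, only
      the path is free: each finite descending path from \<open>(k, j)\<close> gives a node of the
      tree.\<close>
    define Fol where "Fol t n \<longleftrightarrow> is_fun E t n A \<and> (\<forall>i. E i n \<longrightarrow> zc t i = ap z i \<and> ec t i = ap e i) \<and>
      ac t zero = npair k j \<and> (\<forall>i. E (sc i) n \<longrightarrow> edge b z (ac t (sc i)) (ac t i))" for t n
    have pdFol0: "pd (\<lambda>s. Fol (s 0) (s 1))" unfolding Fol_def by (intro dfi)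
    note pdFol = pd_2[where R = Fol, OF pdFol0]
    have FolT: "E t T" if F: "Fol t n" and n: "E n W" for t n
    proof -
      have tf: "is_fun E t n A" and te: "\<And>i. E i n \<Longrightarrow> zc t i = ap z i" "\<And>i. E i n \<Longrightarrow> ec t i = ap e i"
        and t0: "ac t zero = npair k j" and ts: "\<And>i. E (sc i) n \<Longrightarrow> edge b z (ac t (sc i)) (ac t i)"
        using F unfolding Fol_def by blast+
      have "Loc \<tau> b k j a t n" unfolding Loc_def
      proof (intro conjI allI impI)
        fix i assume i: "E i n \<and> own b i"
        have "lam i (zc t) = lam i (ap z)"
        proof (rule lam_cong)
          show "ft (\<lambda>s. zc t (s 0))" "ft (\<lambda>s. ap z (s 0))" by (intro dfi)+
          fix m assume "E m i"
          then show "zc t m = ap z m" using te(1) Ord_trans[OF W_Ord[OF n]] i by blast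
        qed
        then show "zc t i = ap \<tau> (lam i (zc t))" using r i te(1) W_trans[OF n] unfolding run_def by simp
      next
        fix u w assume h: "E u n \<and> E w n \<and> E (cpos (\<not> b) u w) n \<and> zc t (cpos (\<not> b) u w) \<noteq> zero \<and> ec t w \<noteq> a"
        then have "edge (\<not> b) z u w" "ap e w \<noteq> a" using te unfolding edge_def by auto
        then show "E (ec t u) (ec t w)" using emapD(2)[OF e(1)] te(2) h W_trans[OF n] by simp
      next
        fix k' j' assume "E k' W \<and> E j' W \<and> lexle k' j' k j \<and> E (npair k' j') n"
        then show "ec t (npair k' j') \<noteq> a" using te(2) e(2) by simp
      next
        show "ac t zero = npair k j" by (rule t0)
      next
        fix i assume h: "E (sc i) n \<and> E (cpos b (ac t (sc i)) (ac t i)) n"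
        then show "zc t (cpos b (ac t (sc i)) (ac t i)) \<noteq> zero" using ts te(1) unfolding edge_def by simp
      qed
      then show ?thesis unfolding T mem_FS using tf n is_fun_fn[OF tf] by blast
    qed
    \<comment> \<open>A node \<open>v\<close> will be ranked by the least tree rank of a sequence
      whose path ends in \<open>v\<close>. Prolonging the path extends the sequence and lowers its
      tree rank, as a ranking requires. Nodes that no path reaches get the mark
      \<open>d\<close>.\<close>
    define V where "V v x \<longleftrightarrow> (\<exists>t n. E n W \<and> Fol t (sc n) \<and> ac t n = v \<and> x = ap \<rho> t)" for v x
    have pdV0: "pd (\<lambda>s. V (s 0) (s 1))" unfolding V_def by (intro dfi pdFol)
    note pdV = pd_2[where R = V, OF pdV0]
    have Vd: "E x d" if "V v x" for v x using that \<rho>(1) FolT unfolding V_def by (metis W_sc)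
    have pdVv: "pd (\<lambda>s. V v (s 0))" for v by (intro dfi pdV)
    have Vmu: "V v (mu (V v))" "E (mu (V v)) (sc x)" if "V v x" for v x
      using mu_props[where P = "V v", OF pdVv _ that] Ord_mem[OF od Vd[OF that]] by blast+
    let ?F = "\<lambda>v. if \<exists>x. V v x then mu (V v) else d"
    have ftF: "ft (\<lambda>s. ?F (s 0))" by (intro dfi pdV)
    note F = ap_lam[of ?F, OF ftF]
    have Fne: "?F v \<noteq> d" if "V v x" for v x using Vd[OF Vmu(1)[OF that]] that by auto
    have em: "emap b z (lam W ?F) d" unfolding emap_def
    proof (intro conjI allI impI)
      show "is_fun E (lam W ?F) W (sc d)" by (rule is_fun_lam[OF ftF]) (use Vd Vmu(1) in auto)
      fix u w assume h: "E u W \<and> E w W \<and> edge b z u w \<and> ap (lam W ?F) w \<noteq> d"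
      then have "\<exists>x. V w x" using F[of w W] by (auto split: if_splits)
      then have Fw: "ap (lam W ?F) w = mu (V w)" "V w (mu (V w))" using F[of w W] h Vmu(1) by auto
      obtain t n where t: "E n W" "Fol t (sc n)" "ac t n = w" "mu (V w) = ap \<rho> t"
        using Fw(2) unfolding V_def by blast
      have tf: "is_fun E t (sc n) A" and te: "\<And>i. E i (sc n) \<Longrightarrow> zc t i = ap z i \<and> ec t i = ap e i"
        and t0: "ac t zero = npair k j"
        and ts: "\<And>i. E (sc i) (sc n) \<Longrightarrow> edge b z (ac t (sc i)) (ac t i)"
        using t(2) unfolding Fol_def by blast+
      \<comment> \<open>The path is prolonged by \<open>u\<close> at the new place
        \<open>sc n\<close>; run and ranking continue with \<open>z\<close> and
        \<open>e\<close>.\<close>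
      let ?H = "\<lambda>i. if i = sc n then pr (ap z i) (pr (ap e i) u) else ap t i"
      have ftH: "ft (\<lambda>s. ?H (s 0))" by (intro dfi)
      define t' where "t' = lam (sc (sc n)) ?H"
      have t': "ap t' i = ?H i" if "E i (sc (sc n))" for i unfolding t'_def by (rule ap_lam[OF ftH that])
      have nn: "i \<noteq> sc n" if "E i (sc n)" for i using that by (metis mem_irrefl)
      have old: "zc t' i = zc t i" "ec t' i = ec t i" "ac t' i = ac t i" "ap t' i = ap t i" if "E i (sc n)" for i
        using t'[of i] nn[OF that] that unfolding zc_def ec_def ac_def by simp_all
      have new: "zc t' (sc n) = ap z (sc n)" "ec t' (sc n) = ap e (sc n)" "ac t' (sc n) = u"
        using t'[of "sc n"] unfolding zc_def ec_def ac_def by simp_all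
      have zn: "E zero (sc n)" using Ord_zero_mem[of "sc n"] W_Ord[OF t(1)] by simp
      have Fol': "Fol t' (sc (sc n))" unfolding Fol_def
      proof (intro conjI allI impI)
        show "is_fun E t' (sc (sc n)) A" unfolding t'_def
        proof (rule is_fun_lam[OF ftH])
          fix i assume i: "E i (sc (sc n))"
          show "E (?H i) A"
          proof (cases "i = sc n")
            case True
            have "E (ap z (sc n)) W" "E (ap e (sc n)) (sc a)"
              using is_fun_ap[OF zf] emapD(1)[OF e(1)] t(1) by simp_all
            then show ?thesis using True h unfolding A_def by simp
          next
            case False
            then have "E i (sc n)" using i mem_sc[of i "sc n"] by blast
            then show ?thesis using is_fun_ap[OF tf] False by simp
          qed
        qed
        show "ac t' zero = npair k j" using old(3)[OF zn] t0 by simp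
      next
        fix i assume "E i (sc (sc n))"
        then consider "E i (sc n)" | "i = sc n" using mem_sc[of i "sc n"] by blast
        then have "zc t' i = ap z i \<and> ec t' i = ap e i" using te old new by cases simp_all
        then show "zc t' i = ap z i" "ec t' i = ap e i" by blast+
      next
        fix i assume "E (sc i) (sc (sc n))"
        then consider "E (sc i) (sc n)" | "i = n" using mem_sc[of "sc i" "sc n"] sc_inj by blast
        then show "edge b z (ac t' (sc i)) (ac t' i)"
        proof cases
          case 1
          then have "E i (sc n)" using Ord_trans[of "sc n" "sc i" i] W_Ord[OF t(1)] by simp
          then show ?thesis using old(3) 1 ts by simp
        next
          case 2
          then show ?thesis using new(3) old(3)[of n] t(3) h by simp
        qed
      qed
      have "ext_of t' t" unfolding ext_of_def
      proof (intro conjI allI impI)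
        have f': "fn t' (sc (sc n))" unfolding t'_def by (rule fn_lam[OF ftH])
        show "t' \<noteq> t"
        proof
          assume "t' = t"
          then have "sc (sc n) = sc n" using fn_dom_unique[OF f'] is_fun_fn[OF tf] by simp
          then show False using mem_irrefl[of "sc n"] mem_sc[of "sc n" "sc n"] by metis
        qed
        fix p assume "E p t"
        then obtain i where "E i (sc n)" "p = pr i (ap t i)" unfolding mem_fn[OF is_fun_fn[OF tf]] by blast
        then show "E p t'" unfolding mem_fn[OF f'] using old(4) mem_sc[of i "sc n"] by auto
      qed
      then have lt: "E (ap \<rho> t') (ap \<rho> t)" using \<rho>(2) FolT[OF t(2)] FolT[OF Fol'] t(1) by simp
      have Vu: "V u (ap \<rho> t')" unfolding V_def using Fol' new(3) t(1) W_sc by blast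
      then have Fu: "ap (lam W ?F) u = mu (V u)" using F[of u W] h by auto
      have "Ord (ap \<rho> t)" using Ord_mem[OF od \<rho>(1)[OF FolT[OF t(2)]]] t(1) by simp
      then have "E (mu (V u)) (ap \<rho> t)" using Ord_le_trans[OF _ Vmu(2)[OF Vu] lt] by blast
      then show "E (ap (lam W ?F) u) (ap (lam W ?F) w)" using Fu Fw(1) t(4) by simp
    qed
    let ?H0 = "\<lambda>i. pr (ap z i) (pr (ap e i) (npair k j))"
    have ftH0: "ft (\<lambda>s. ?H0 (s 0))" by (intro dfi)
    define t where "t = lam (sc zero) ?H0"
    have t: "ap t zero = ?H0 zero" unfolding t_def by (rule ap_lam[OF ftH0]) simp
    have "Fol t (sc zero)" unfolding Fol_def
    proof (intro conjI allI impI)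
      show "is_fun E t (sc zero) A" unfolding t_def
        by (rule is_fun_lam[OF ftH0])
          (use is_fun_ap[OF zf W_zero] emapD(1)[OF e(1) W_zero] k j in \<open>simp add: A_def\<close>)
      show "ac t zero = npair k j" using t unfolding ac_def by simp
    qed (use t in \<open>auto simp: zc_def ec_def\<close>)
    moreover have "ac t zero = npair k j" using t unfolding ac_def by simp
    ultimately have "V (npair k j) (ap \<rho> t)" unfolding V_def using W_zero by blast
    then have "ap (lam W ?F) (npair k j) \<noteq> d" using Fne F[of "npair k j" W] k j by simp
    then show ?thesis unfolding rklt_def using em by blast
  qed
  then show ?thesis using d unfolding Good_def by blast
qed

section \<open>The partition game\<close>

lemma lexle_trans:
  "Ord k \<Longrightarrow> Ord j \<Longrightarrow> lexle x y k' j' \<Longrightarrow> lexle k' j' k j \<Longrightarrow> lexle x y k j"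
  unfolding lexle_def using Ord_trans[of k] Ord_trans[of "sc j" "j'" y] by auto

lemma lexle_linear: "E k W \<Longrightarrow> E j W \<Longrightarrow> E k' W \<Longrightarrow> E j' W \<Longrightarrow> \<not> lexle k' j' k j \<Longrightarrow> lexle k j k' j'"
  unfolding lexle_def using Ord_lin[of k k'] Ord_lin[of j j'] W_Ord by auto

lemma OK_antimono:
  assumes "OK b z k j" "E k W" "E j W" "lexle k' j' k j" shows "OK b z k' j'"
  using assms lexle_trans[OF W_Ord W_Ord] unfolding OK_def JR_def by metis

text \<open>As \<open>rklt\<close> is a strict bound, the value at \<open>k\<close> is the supremum
  of the ranks in row \<open>k\<close>, each increased by one. Nodes of all ranks below
  \<open>f(k)\<close> thus produce exactly \<open>f(k)\<close>.\<close>

definition fz where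
  "fz z = lam W (\<lambda>k. mu (\<lambda>a. \<forall>j. E j W \<longrightarrow> rklt True z (npair k j) a \<and> rklt False z (npair k j) a))"

text \<open>The second alternative is decided by the sequence \<open>fz z\<close> that the two players produce together;
  at a node where both relations fail, player I loses.\<close>

definition wins where
  "wins C z \<longleftrightarrow> (\<exists>k j. E k W \<and> E j W \<and> \<not> OK False z k j \<and> OK True z k j) \<or>
    ((\<forall>k j. E k W \<and> E j W \<longrightarrow> OK True z k j \<and> OK False z k j) \<and> C (fz z))"

definition strat where
  "strat C \<tau> b \<longleftrightarrow> is_fun E \<tau> (FS W) W \<and> (\<forall>z. run \<tau> b z \<longrightarrow> (wins C z \<longleftrightarrow> b))"

lemma ft_fz0: "ft (\<lambda>s. fz (s 0))" unfolding fz_def by (intro dfi)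
lemmas ft_fz [dfi] = ft_1[where F = fz, OF ft_fz0]

text \<open>There is one game for each \<open>q\<close>. The index has to be a variable of the
  formula, so that strategies for all games can be chosen at once.\<close>

lemma pd_wins:
  assumes "pd (\<lambda>s. C (s 0) (s 1))" "ft q" "ft z" shows "pd (\<lambda>s. wins (C (q s)) (z s))"
  by (rule pd_2[where R = "\<lambda>q. wins (C q)", OF _ assms(2,3)])
    (unfold wins_def, intro dfi pd_2[where R = C, OF assms(1)])

lemma pd_strat:
  assumes "pd (\<lambda>s. C (s 0) (s 1))" "ft q" "ft t" shows "pd (\<lambda>s. strat (C (q s)) (t s) b)"
  by (rule pd_2[where R = "\<lambda>q t. strat (C q) t b", OF _ assms(2,3)])
    (unfold strat_def, intro dfi pd_wins[OF assms(1)])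

text \<open>This provides the assumption \<open>win\<close> of the boundedness lemma. For player I,
  a node at which only the opponent fails lies beyond \<open>(k, j)\<close>, and success up to the
  later node includes the earlier one. For player II, a failure would make \<open>(k, j)\<close> a
  witness for the first alternative of \<open>wins\<close>.\<close>

lemma strat_OK:
  assumes s: "strat C \<tau> b" and r: "run \<tau> b z" and kj: "E k W" "E j W" and ok: "OK (\<not> b) z k j"
  shows "OK b z k j"
proof -
  have w: "wins C z \<longleftrightarrow> b" using s r unfolding strat_def by blast
  show ?thesis
  proof (cases b)
    case True
    then consider k' j' where "E k' W" "E j' W" "\<not> OK False z k' j'" "OK True z k' j'"
      | "\<forall>k j. E k W \<and> E j W \<longrightarrow> OK True z k j \<and> OK False z k j"
      using w unfolding wins_def by blast
    then show ?thesis
    proof cases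
      case 1
      have "\<not> lexle k' j' k j" using OK_antimono[of False z k j k' j'] ok kj 1(3) True by auto
      then have "lexle k j k' j'" using lexle_linear kj 1 by blast
      then show ?thesis using OK_antimono[OF 1(4)] 1 True by simp
    qed (use kj True in simp)
  next
    case False
    then show ?thesis using w ok kj unfolding wins_def by auto
  qed
qed

lemma strat_outcome:
  assumes s: "strat C \<tau> b" and r: "run \<tau> b z" and ok: "\<And>k j. E k W \<Longrightarrow> E j W \<Longrightarrow> OK (\<not> b) z k j"
  shows "C (fz z) \<longleftrightarrow> b"
proof -
  have "OK b z k j" if "E k W" "E j W" for k j using strat_OK[OF s r that ok[OF that]] .
  then have "OK True z k j \<and> OK False z k j" if "E k W" "E j W" for k j
    using ok[OF that] that by (cases b) simp_all
  then have "wins C z \<longleftrightarrow> C (fz z)" unfolding wins_def by blast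
  then show ?thesis using s r unfolding strat_def by blast
qed

text \<open>The opponent can produce exactly \<open>f\<close>: he plays the well-orders \<open>f(k)\<close> themselves, coded by an injection
  \<open>g\<close> of \<open>sup f\<close> into \<open>\<omega>\<close>.\<close>

lemma strat_homogeneous:
  assumes s: "strat C \<tau> b"
    and f: "is_fun E f W w1" and inc: "\<And>m n. E n W \<Longrightarrow> E m n \<Longrightarrow> E (ap f m) (ap f n)"
    and sup: "E c0 w1" "\<And>k. E k W \<Longrightarrow> E (ap f k) (sc c0)"
    and nz: "\<And>k. E k W \<Longrightarrow> ap f k \<noteq> zero"
    and lim: "\<And>k x. E k W \<Longrightarrow> E x (ap f k) \<Longrightarrow> E (sc x) (ap f k)"
    and closed: "\<And>l k j a. E l W \<Longrightarrow> E k W \<Longrightarrow> E j W \<Longrightarrow> E a (ap f l) \<Longrightarrow> \<exists>d. E d (ap f l) \<and> Good \<tau> b k j a d"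
  shows "C f \<longleftrightarrow> b"
proof -
  have fw: "E (ap f k) w1" "Ord (ap f k)" if "E k W" for k
    using is_fun_ap[OF f that] w1_Ord by blast+
  have oc: "Ord c0" using w1_Ord[OF sup(1)] .
  have fc: "E x c0" if "E k W" "E x (ap f k)" for k x
    using sup(2)[OF that(1)] that(2) Ord_trans[OF oc] by auto
  obtain g where gW: "\<And>x. E x c0 \<Longrightarrow> E (ap g x) W"
    and gi: "\<And>x y. E x c0 \<Longrightarrow> E y c0 \<Longrightarrow> ap g x = ap g y \<Longrightarrow> x = y"
    using w1_props(3)[OF sup(1)] unfolding cble_def inj_W_def by blast
  \<comment> \<open>Row \<open>k\<close> of the opponent's relation contains a copy of the order of
    \<open>f(k)\<close>, with \<open>x\<close> in column \<open>ap g x\<close>. One injection of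
    \<open>c0\<close> serves all rows, so none is chosen row by row.\<close>
  define nd where "nd k x = npair k (ap g x)" for k x
  have ft_nd: "ft k \<Longrightarrow> ft x \<Longrightarrow> ft (\<lambda>s. nd (k s) (x s))" for k x unfolding nd_def by (intro dfi)
  have ndW: "E (nd k x) W" if "E k W" "E x c0" for k x unfolding nd_def using that gW by simp
  have nd_inj: "k = k' \<and> x = x'" if "E k W" "E k' W" "E x c0" "E x' c0" "nd k x = nd k' x'" for k k' x x'
    using that npair_inj[of k "ap g x" k' "ap g x'"] gW gi unfolding nd_def by metis
  let ?Y = "\<lambda>p. \<exists>k x x'. E k W \<and> E x' (ap f k) \<and> E x x' \<and> p = cpos (\<not> b) (nd k x) (nd k x')"
  define y where "y p = (if ?Y p then sc zero else zero)" for p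
  have fty: "ft (\<lambda>s. y (s 0))" unfolding y_def by (intro dfi ft_nd)
  obtain z where z: "follow \<tau> b y z" using follow_ex1[OF fty] by blast
  have \<tau>: "is_fun E \<tau> (FS W) W" using s unfolding strat_def by blast
  have r: "run \<tau> b z" by (rule follow_run[OF \<tau> z]) (simp add: y_def)
  have edge: "edge (\<not> b) z u w \<longleftrightarrow> (\<exists>k x x'. E k W \<and> E x' (ap f k) \<and> E x x' \<and> u = nd k x \<and> w = nd k x')"
    if uw: "E u W" "E w W" for u w
  proof -
    have "ap z (cpos (\<not> b) u w) = y (cpos (\<not> b) u w)"
      using z own_cpos[OF uw, of b "\<not> b"] cpos_W[OF uw] unfolding follow_def by simp
    then have "edge (\<not> b) z u w \<longleftrightarrow> ?Y (cpos (\<not> b) u w)" unfolding edge_def y_def by simp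
    moreover have "cpos (\<not> b) u w = cpos (\<not> b) (nd k x) (nd k x') \<longleftrightarrow> u = nd k x \<and> w = nd k x'"
      if "E k W" "E x' (ap f k)" "E x x'" for k x x'
    proof -
      have "E x (ap f k)" using Ord_trans[OF fw(2)[OF that(1)] that(2,3)] .
      then show ?thesis using cpos_inj[OF uw] ndW fc that by blast
    qed
    ultimately show ?thesis by blast
  qed
  let ?N = "\<lambda>u x. \<exists>k. E k W \<and> E x (ap f k) \<and> u = nd k x"
  have Nu: "x = x'" if "?N u x" "?N u x'" for u x x'
    using that fc nd_inj by metis
  \<comment> \<open>The natural ranking truncated at \<open>c\<close>: the copy of \<open>x\<close>
    has rank \<open>x\<close> if this is below \<open>c\<close>, and the mark \<open>c\<close>
    otherwise. Nodes outside the copies have no predecessors and get 0.\<close>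
  define e where "e c u = (if \<exists>x. ?N u x then (if E (dd (?N u)) c then dd (?N u) else c) else zero)" for c u
  have eN: "e c u = (if E x c then x else c)" if "?N u x" for c u x
  proof -
    have "dd (?N u) = x" by (rule dd_eq) (use that Nu in blast)+
    then show ?thesis unfolding e_def using that by auto
  qed
  have ft_e: "ft (\<lambda>s. e c (s 0))" for c unfolding e_def by (intro dfi ft_nd)
  have em: "emap (\<not> b) z (lam W (e c)) c" if c: "Ord c" for c
    unfolding emap_def
  proof (intro conjI allI impI)
    show "is_fun E (lam W (e c)) W (sc c)"
    proof (rule is_fun_lam[OF ft_e])
      fix u
      show "E (e c u) (sc c)"
        using Ord_zero_mem[of "sc c"] c unfolding e_def by auto
    qed
    fix u w assume h: "E u W \<and> E w W \<and> edge (\<not> b) z u w \<and> ap (lam W (e c)) w \<noteq> c"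
    then obtain k x x' where k: "E k W" "E x' (ap f k)" "E x x'" "u = nd k x" "w = nd k x'"
      using edge by blast
    have x: "E x (ap f k)" using Ord_trans[OF fw(2)[OF k(1)] k(2,3)] .
    have ew: "e c w = (if E x' c then x' else c)" by (rule eN) (use k in blast)
    have eu: "e c u = (if E x c then x else c)" by (rule eN) (use k x in blast)
    have lw: "ap (lam W (e c)) w = e c w" "ap (lam W (e c)) u = e c u"
      using ap_lam[OF ft_e] h by blast+
    then have x'c: "E x' c" using h ew by (auto split: if_splits)
    then have "E x c" using Ord_trans[OF c] k(3) by blast
    then show "E (ap (lam W (e c)) u) (ap (lam W (e c)) w)" using lw ew eu x'c k(3) by simp
  qed
  have e_ne: "ap (lam W (e c)) u \<noteq> c" if "c \<noteq> zero" "E u W" "\<And>x. ?N u x \<Longrightarrow> E x c" for c u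
  proof -
    have "e c u \<noteq> c"
    proof (cases "\<exists>x. ?N u x")
      case True
      then obtain x where x: "?N u x" by blast
      then have "E x c" using that(3) by blast
      then show ?thesis using eN[OF x] by auto
    next
      case False
      then have "e c u = zero" unfolding e_def by (rule if_not_P)
      then show ?thesis using that(1) by simp
    qed
    then show ?thesis using ap_lam[OF ft_e that(2)] by simp
  qed
  have JRI: "JR (\<not> b) z k j c" if "Ord c" "c \<noteq> zero" and
    below: "\<And>k' x. E k' W \<Longrightarrow> E x (ap f k') \<Longrightarrow> lexle k' (ap g x) k j \<Longrightarrow> E x c" for k j c
    unfolding JR_def
  proof (intro exI conjI allI impI)
    fix k' j' assume h: "E k' W \<and> E j' W \<and> lexle k' j' k j"
    show "ap (lam W (e c)) (npair k' j') \<noteq> c"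
    proof (rule e_ne[OF that(2)])
      fix x assume "?N (npair k' j') x"
      then obtain k2 where k2: "E k2 W" "E x (ap f k2)" "npair k' j' = npair k2 (ap g x)"
        unfolding nd_def by blast
      then have "k' = k2" "j' = ap g x" using npair_inj[of k' j' k2 "ap g x"] gW[OF fc] h by blast+
      then show "E x c" using below k2 h by blast
    qed (use h in simp)
  qed (rule em[OF that(1)])
  \<comment> \<open>A strictly increasing map on a well-order never falls below its argument: if the
    copy of \<open>x\<close> had a value \<open>v\<close> below \<open>x\<close>, then the copy of
    \<open>v\<close> would have a value below \<open>v\<close>.\<close>
  have low: "E x c" if kx: "E k W" "E x (ap f k)" and c: "Ord c" and rk: "rklt (\<not> b) z (nd k x) c" for k x c
  proof -
    obtain h where h: "emap (\<not> b) z h c" "ap h (nd k x) \<noteq> c" using rk unfolding rklt_def by blast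
    have hc: "E (ap h (nd k x)) c" if "E x (ap f k)" "ap h (nd k x) \<noteq> c" for x
      using emapD(1)[OF h(1) ndW[OF kx(1) fc[OF kx(1) that(1)]]] that(2) by simp
    let ?P = "\<lambda>x. E x (ap f k) \<longrightarrow> ap h (nd k x) \<noteq> c \<longrightarrow> E x (sc (ap h (nd k x)))"
    have "?P x"
    proof (rule Ord_induct[of ?P])
      show "pd (\<lambda>s. ?P (s 0))" by (intro dfi ft_nd)
      show "Ord x" using Ord_mem[OF fw(2)[OF kx(1)] kx(2)] .
      fix x assume o: "Ord x" and IH: "\<And>v. E v x \<Longrightarrow> ?P v"
      show "?P x"
      proof (intro impI)
        assume x: "E x (ap f k)" and ne: "ap h (nd k x) \<noteq> c"
        let ?v = "ap h (nd k x)"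
        have vc: "E ?v c" using hc[OF x ne] .
        show "E x (sc ?v)"
        proof (rule ccontr)
          assume "\<not> E x (sc ?v)"
          then have vx: "E ?v x" using Ord_not_mem[OF Ord_mem[OF c vc] o] by blast
          have vf: "E ?v (ap f k)" using Ord_trans[OF fw(2)[OF kx(1)] x vx] .
          have nW: "E (nd k ?v) W" "E (nd k x) W" using ndW[OF kx(1)] fc[OF kx(1)] vf x by blast+
          have "edge (\<not> b) z (nd k ?v) (nd k x)" unfolding edge[OF nW] using kx(1) x vx by blast
          then have lt: "E (ap h (nd k ?v)) ?v" using emapD(2)[OF h(1) nW _ ne] by blast
          then have "ap h (nd k ?v) \<noteq> c" using mem_asym[OF vc] by blast
          then have "E ?v (sc (ap h (nd k ?v)))" using IH[OF vx] vf by blast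
          then show False using lt mem_asym[OF lt] by auto
        qed
      qed
    qed
    then have "E x (sc (ap h (nd k x)))" using kx h(2) by blast
    then show ?thesis using Ord_le_trans[OF c] hc[OF kx(2) h(2)] by blast
  qed
  have ok: "OK (\<not> b) z k j" for k j
    unfolding OK_def
  proof (intro exI conjI)
    show "Ord (sc c0)" using oc by simp
    show "JR (\<not> b) z k j (sc c0)" by (rule JRI) (use oc fc in auto)
  qed
  have f0: "E zero (ap f k)" if "E k W" for k using Ord_zero_mem fw(2) nz that by blast
  have fbun: "E (bun x x') (ap f k)" if "E k W" "E x (ap f k)" "E x' (ap f k)" for k x x'
    using bun_absorb[of x x'] Ord_mem[OF fw(2)[OF that(1)]] that by metis
  \<comment> \<open>Up to \<open>(k, j)\<close> the opponent shows the earlier rows, bounded by the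
    value of \<open>f\<close> before \<open>k\<close>, and finitely many points of row
    \<open>k\<close>. Some ordinal below the limit \<open>f(k)\<close> bounds all these ranks, and
    by closure so does one for the strategy's answer.\<close>
  have own: "rklt b z (npair k j) (ap f k)" if k: "E k W" and j: "E j W" for k j
  proof -
    have "\<exists>a1. E a1 (ap f k) \<and> (\<forall>k' x. E k' k \<and> E x (ap f k') \<longrightarrow> E x a1)"
      using k
    proof (cases rule: W_cases)
      case 1
      then show ?thesis using f0[OF k] by auto
    next
      case (2 m)
      have "E x (ap f m)" if h: "E k' k" "E x (ap f k')" for k' x
      proof (cases "k' = m")
        case False
        then have "E k' m" using h 2 by simp
        then show ?thesis using inc[OF 2(1)] Ord_trans[OF fw(2)[OF 2(1)]] h(2) by blast
      qed (use h in simp)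
      moreover have "E (ap f m) (ap f k)" using inc[OF k] 2 by simp
      ultimately show ?thesis by blast
    qed
    then obtain a1 where a1: "E a1 (ap f k)" "\<And>k' x. E k' k \<Longrightarrow> E x (ap f k') \<Longrightarrow> E x a1" by blast
    have fin: "\<exists>a. E a (ap f k) \<and> (\<forall>x. E x (ap f k) \<and> E (ap g x) n \<longrightarrow> E x a)" if n: "E n W" for n
    proof -
      have p: "pd (\<lambda>s. \<exists>a. E a (ap f k) \<and> (\<forall>x. E x (ap f k) \<and> E (ap g x) (s 0) \<longrightarrow> E x a))" by (intro dfi)
      from n p show ?thesis
      proof (induction n rule: W_induct)
        case zero
        then show ?case using f0[OF k] by auto
      next
        case (sc n)
        then obtain a where a: "E a (ap f k)" "\<And>x. E x (ap f k) \<Longrightarrow> E (ap g x) n \<Longrightarrow> E x a" by blast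
        show ?case
        proof (cases "\<exists>x0. E x0 (ap f k) \<and> ap g x0 = n")
          case True
          then obtain x0 where x0: "E x0 (ap f k)" "ap g x0 = n" by blast
          have o: "Ord a" "Ord x0" using Ord_mem[OF fw(2)[OF k]] a x0 by blast+
          have "E (sc (bun a x0)) (ap f k)" using lim[OF k fbun[OF k a(1) x0(1)]] .
          moreover have "E x (sc (bun a x0))" if "E x (ap f k)" "E (ap g x) (sc n)" for x
          proof (cases "E (ap g x) n")
            case True
            then show ?thesis using a(2)[OF that(1)] by simp
          next
            case False
            then have "ap g x = ap g x0" using that x0 by simp
            then have "x = x0" using gi fc[OF k] that(1) x0(1) by blast
            then show ?thesis using bun_ge[OF o] by blast
          qed
          ultimately show ?thesis by blast
        next
          case False
          then have "E x a" if "E x (ap f k)" "E (ap g x) (sc n)" for x using a(2) that by auto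
          then show ?thesis using a(1) by blast
        qed
      qed
    qed
    \<comment> \<open>The bound is strict, hence \<open>sc j\<close>: column \<open>j\<close> itself
      is included.\<close>
    from fin[of "sc j"] j obtain a2 where a2: "E a2 (ap f k)" "\<And>x. E x (ap f k) \<Longrightarrow> E (ap g x) (sc j) \<Longrightarrow> E x a2" by auto
    let ?a = "sc (bun a1 a2)"
    have a: "E ?a (ap f k)" using lim[OF k fbun[OF k a1(1) a2(1)]] .
    have "JR (\<not> b) z k j ?a"
    proof (rule JRI)
      show "Ord ?a" using Ord_mem[OF fw(2)[OF k] a] .
      fix k' x assume h: "E k' W" "E x (ap f k')" "lexle k' (ap g x) k j"
      then show "E x ?a" using a1(2)[of k' x] a2(2)[of x] unfolding lexle_def by auto
    qed simp
    moreover obtain d where d: "E d (ap f k)" "Good \<tau> b k j ?a d" using closed[OF k k j a] by blast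
    ultimately have "rklt b z (npair k j) d" using r unfolding Good_def by blast
    then show ?thesis by (rule rklt_mono) (use d fw(2)[OF k] k j in simp_all)
  qed
  have opp: "rklt (\<not> b) z (npair k j) (ap f k)" if k: "E k W" and j: "E j W" for k j
    unfolding rklt_def
  proof (intro exI conjI)
    show "emap (\<not> b) z (lam W (e (ap f k))) (ap f k)" by (rule em[OF fw(2)[OF k]])
    show "ap (lam W (e (ap f k))) (npair k j) \<noteq> ap f k"
    proof (rule e_ne[OF nz[OF k]])
      fix x assume "?N (npair k j) x"
      then obtain k2 where k2: "E k2 W" "E x (ap f k2)" "npair k j = npair k2 (ap g x)"
        unfolding nd_def by blast
      then have "k = k2" using npair_inj[of k j k2 "ap g x"] gW[OF fc] k j by blast
      then show "E x (ap f k)" using k2 by simp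
    qed (use k j in simp)
  qed
  let ?M = "\<lambda>k a. \<forall>j. E j W \<longrightarrow> rklt True z (npair k j) a \<and> rklt False z (npair k j) a"
  have M: "?M k a \<longleftrightarrow> (\<forall>j. E j W \<longrightarrow> rklt b z (npair k j) a \<and> rklt (\<not> b) z (npair k j) a)" for k a
    by (cases b) auto
  \<comment> \<open>Both relations have ranks below \<open>f(k)\<close> in row \<open>k\<close>, and
    no smaller \<open>c\<close> is a strict bound, because the copy of \<open>c\<close> in the
    opponent's row has rank at least \<open>c\<close>.\<close>
  have mu: "mu (?M k) = ap f k" if k: "E k W" for k
  proof (rule mu_eq)
    show "Ord (ap f k)" by (rule fw(2)[OF k])
    show "?M k (ap f k)" unfolding M using own[OF k] opp[OF k] by blast
    fix c assume c: "E c (ap f k)"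
    show "\<not> ?M k c"
    proof
      assume "?M k c"
      then have "rklt (\<not> b) z (nd k c) c" unfolding M nd_def using gW[OF fc[OF k c]] by blast
      then have "E c c" using low[OF k c] Ord_mem[OF fw(2)[OF k] c] by blast
      then show False by simp
    qed
  qed
  have ftM: "ft (\<lambda>s. mu (?M (s 0)))" by (intro dfi)
  have "fz z = f"
  proof (rule fn_eqI)
    show "fn (fz z) W" unfolding fz_def by (rule fn_lam[OF ftM])
    show "fn f W" by (rule is_fun_fn[OF f])
    fix k assume k: "E k W"
    have "ap (fz z) k = mu (?M k)" unfolding fz_def by (rule ap_lam[OF ftM k])
    then show "ap (fz z) k = ap f k" using mu[OF k] by simp
  qed
  then show ?thesis using strat_outcome[OF s r ok] by simp
qed

lemma Good_mono_bound:
  assumes "Good \<tau> b k j a d" "E d (sc d')" "Ord d'" "E k W" "E j W" shows "Good \<tau> b k j a d'"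
  using assms rklt_mono[OF _ assms(2,3), of b _ "npair k j"] unfolding Good_def by simp

text \<open>A smaller \<open>a\<close> makes \<open>JR\<close> more restrictive, so fewer runs have
  to be bounded.\<close>

lemma Good_antimono:
  assumes "Good \<tau> b k j a' d" "E a (sc a')" "Ord a'" shows "Good \<tau> b k j a d"
  using assms JR_mono[OF _ assms(2,3)] unfolding Good_def by blast

end

context zf_ad
begin

section \<open>Homogeneous sets\<close>

text \<open>An injection into \<omega> lists the elements of \<open>X\<close>; by regularity they
  would have a common bound below \<open>w1\<close>.\<close>

lemma uncountable_if_unbounded:
  assumes X: "\<And>x. E x X \<Longrightarrow> E x w1" and ub: "\<And>a. E a w1 \<Longrightarrow> \<exists>x. E x X \<and> E a x"
  shows "\<not> cble X"
proof
  assume "cble X"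
  then obtain g where g: "\<And>x. E x X \<Longrightarrow> E (ap g x) W"
    "\<And>x y. E x X \<Longrightarrow> E y X \<Longrightarrow> ap g x = ap g y \<Longrightarrow> x = y" unfolding cble_def inj_W_def by blast
  let ?P = "\<lambda>n d. \<forall>x. E x X \<and> ap g x = n \<longrightarrow> E x (sc d)"
  have "pd (\<lambda>s. ?P (s 0) (s 1))" by (intro dfi)
  moreover have "\<exists>d. E d w1 \<and> ?P n d" for n
  proof (cases "\<exists>x. E x X \<and> ap g x = n")
    case True
    then obtain x where x: "E x X" "ap g x = n" by blast
    then have "?P n x" using g(2) by fastforce
    then show ?thesis using X[OF x(1)] by blast
  next
    case False
    then show ?thesis using w1_zero by blast
  qed
  ultimately obtain d where d: "E d w1" "\<And>n. E n W \<Longrightarrow> \<exists>c. E c (sc d) \<and> ?P n c"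
    using w1_regular[where P = ?P] by blast
  obtain x where x: "E x X" "E d x" using ub[OF d(1)] by blast
  obtain c where c: "E c (sc d)" "E x (sc c)" using d(2)[OF g(1)[OF x(1)]] x(1) by blast
  have "E x (sc d)" using c Ord_trans[of "sc d" c x] w1_Ord[OF d(1)] by auto
  then show False using x(2) mem_asym[OF x(2)] by auto
qed

text \<open>Iterate \<omega> times: the next ordinal exceeds the present one and a bound
  \<open>K\<close> for all conditions there. By regularity the supremum stays below
  \<open>w1\<close>. The monotonicity \<open>anti\<close> hands the bound at a stage down to all
  smaller \<open>a\<close>, so no supremum over \<open>a\<close> has to be formed.\<close>

lemma closed_unbounded:
  assumes P0: "pd (\<lambda>s. P (s 0) (s 1) (s 2))"
    and bd: "\<And>a n. E a w1 \<Longrightarrow> E n W \<Longrightarrow> \<exists>d. E d w1 \<and> P n a d"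
    and anti: "\<And>n a a' d. E n W \<Longrightarrow> E a' w1 \<Longrightarrow> E a (sc a') \<Longrightarrow> P n a' d \<Longrightarrow> P n a d"
    and a: "E a w1"
  shows "\<exists>\<xi>. E \<xi> w1 \<and> E a \<xi> \<and> (\<forall>c. E c \<xi> \<longrightarrow> E (sc c) \<xi>) \<and>
    (\<forall>n a. E n W \<and> E a \<xi> \<longrightarrow> (\<exists>d. E d \<xi> \<and> P n a d))"
proof -
  note pdP = pd_3[where R = P, OF P0]
  let ?Q = "\<lambda>a D. \<forall>n. E n W \<longrightarrow> (\<exists>c. E c (sc D) \<and> P n a c)"
  define K where "K a = mu (?Q a)" for a
  have ftK0: "ft (\<lambda>s. K (s 0))" unfolding K_def by (intro dfi pdP)
  note ftK = ft_1[where F = K, OF ftK0]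
  have K: "E (K a) w1" "?Q a (K a)" if a: "E a w1" for a
  proof -
    have "pd (\<lambda>s. P (s 0) a (s 1))" by (intro dfi pdP)
    from w1_regular[where P = "\<lambda>n d. P n a d", OF this bd[OF a]]
    obtain D where D: "E D w1" "?Q a D" by blast
    have "pd (\<lambda>s. ?Q a (s 0))" by (intro dfi pdP)
    note m = mu_props[where P = "?Q a", OF this w1_Ord[OF D(1)] D(2), folded K_def]
    show "?Q a (K a)" by (rule m(2))
    show "E (K a) w1" by (rule Ord_le_trans[OF w1_props(1) m(4) D(1)])
  qed
  have "ft (\<lambda>s. sc (bun (s 1) (K (s 1))))" by (intro dfi ftK)
  from nat_recursion[of "\<lambda>n x. sc (bun x (K x))", OF this, of a] obtain c
    where c0: "ap c zero = a" and cs: "\<And>n. E n W \<Longrightarrow> ap c (sc n) = sc (bun (ap c n) (K (ap c n)))" by blast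
  have c1: "E (ap c n) w1" if n: "E n W" for n
  proof -
    have p: "pd (\<lambda>s. E (ap c (s 0)) w1)" by (intro dfi)
    from n p show ?thesis
    proof (induction n rule: W_induct)
      case zero
      then show ?case using c0 a by simp
    next
      case (sc n)
      then show ?case using cs w1_sc w1_bun K(1) by simp
    qed
  qed
  have up: "E (ap c n) (ap c (sc n))" "E (K (ap c n)) (ap c (sc n))" if n: "E n W" for n
    using bun_ge[OF w1_Ord[OF c1[OF n]] w1_Ord[OF K(1)[OF c1[OF n]]]] cs[OF n] by simp_all
  define \<xi> where "\<xi> = un (rep W (ap c))"
  have \<xi>: "E x \<xi> \<longleftrightarrow> (\<exists>n. E n W \<and> E x (ap c n))" for x unfolding \<xi>_def mem_un mem_rep[OF ft_apc] by blast
  have cn: "E (ap c n) \<xi>" if "E n W" for n unfolding \<xi> using up(1)[OF that] that W_sc by blast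
  have "E \<xi> w1" unfolding \<xi>_def by (rule w1_sup[OF ft_apc c1])
  moreover have "E a \<xi>" using cn[OF W_zero] c0 by simp
  moreover have "E (sc x) \<xi>" if x: "E x \<xi>" for x
  proof -
    obtain n where n: "E n W" "E x (ap c n)" using x unfolding \<xi> by blast
    have "E (sc x) (sc (ap c n))" using sc_mem_sc[OF w1_Ord[OF c1[OF n(1)]]] n(2) by blast
    then have "E (sc x) (ap c (sc n))"
      using Ord_le_trans[OF w1_Ord[OF c1] _ up(1)[OF n(1)]] n(1) by simp
    then show ?thesis unfolding \<xi> using n(1) W_sc by blast
  qed
  moreover have "\<exists>d. E d \<xi> \<and> P n x d" if n: "E n W" and x: "E x \<xi>" for n x
  proof -
    obtain m where m: "E m W" "E x (ap c m)" using x unfolding \<xi> by blast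
    obtain d where d: "E d (sc (K (ap c m)))" "P n (ap c m) d" using K(2)[OF c1[OF m(1)]] n by blast
    have "E d (ap c (sc m))" using Ord_le_trans[OF w1_Ord[OF c1] d(1) up(2)[OF m(1)]] m(1) by simp
    then have "E d \<xi>" unfolding \<xi> using m(1) W_sc by blast
    moreover have "P n x d" by (rule anti[OF n c1[OF m(1)] _ d(2)]) (use m in simp)
    ultimately show ?thesis by blast
  qed
  ultimately show ?thesis by blast
qed

text \<open>The elements of \<open>X\<close> are the ordinals closed under the bounds of all
  strategies at once. The countably many strategies are chosen together, and so one \<open>X\<close>
  serves every \<open>q\<close>.\<close>

lemma homogeneous_set:
  assumes C0: "pd (\<lambda>s. C (s 0) (s 1))"
  shows "\<exists>X. (\<forall>x. E x X \<longrightarrow> E x w1) \<and> \<not> cble X \<and>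
    (\<forall>q f f'. E q W \<and> E f (incseqs E X) \<and> E f' (incseqs E X) \<longrightarrow> (C q f \<longleftrightarrow> C q f'))"
proof -
  have "\<exists>x. is_fun E x (FS W) W \<and> (strat (C q) x True \<or> strat (C q) x False)" for q
  proof -
    have "pd (\<lambda>s. wins (C q) (s 0))" by (intro dfi pd_wins[OF C0])
    from determinacy[where Q = "wins (C q)", OF this] obtain \<tau> b
      where "is_fun E \<tau> (FS W) W" "strat (C q) \<tau> b" unfolding strat_def by blast
    then show ?thesis by (cases b) auto
  qed
  moreover have "pd (\<lambda>s. strat (C (s 0)) (s 1) True \<or> strat (C (s 0)) (s 1) False)"
    by (intro dfi pd_strat[OF C0])
  ultimately obtain F where ftF0: "ft (\<lambda>s. F (s 0))"
    and F: "\<And>q. E q W \<Longrightarrow> strat (C q) (F q) True \<or> strat (C q) (F q) False"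
    using countable_choice[OF cble_FS[OF cble_W],
        where P = "\<lambda>q x. strat (C q) x True \<or> strat (C q) x False"] by blast
  note ftF = ft_1[where F = F, OF ftF0]
  \<comment> \<open>The choice of \<open>F q\<close> does not record the winner, so the bound is
    demanded for whichever player the strategy serves.\<close>
  let ?G = "\<lambda>q k j a d. (strat (C q) (F q) True \<longrightarrow> Good (F q) True k j a d) \<and>
    (strat (C q) (F q) False \<longrightarrow> Good (F q) False k j a d)"
  have GI: "\<exists>d. E d w1 \<and> ?G q k j a d" if h: "E q W" "E k W" "E j W" "E a w1" for q k j a
  proof -
    have ex: "\<exists>d. E d w1 \<and> (strat (C q) (F q) b \<longrightarrow> Good (F q) b k j a d)" for b
    proof (cases "strat (C q) (F q) b")
      case True
      have "is_fun E (F q) (FS W) W" using True unfolding strat_def by blast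
      from boundedness[OF this strat_OK[OF True] h(2,3,4)] show ?thesis by blast
    qed (use w1_zero in blast)
    obtain d where d: "E d w1" "strat (C q) (F q) True \<longrightarrow> Good (F q) True k j a d" using ex by blast
    obtain d' where d': "E d' w1" "strat (C q) (F q) False \<longrightarrow> Good (F q) False k j a d'" using ex by blast
    have o: "Ord d" "Ord d'" "Ord (bun d d')" using w1_Ord[OF d(1)] w1_Ord[OF d'(1)] by simp_all
    have "?G q k j a (bun d d')"
      using d(2) d'(2) Good_mono_bound[of "F q" True k j a d "bun d d'"]
        Good_mono_bound[of "F q" False k j a d' "bun d d'"] bun_ge[OF o(1,2)] o(3) h by blast
    then show ?thesis using w1_bun[OF d(1) d'(1)] by blast
  qed
  \<comment> \<open>A single natural number codes the game and the node, to match the index of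
    \<open>closed_unbounded\<close>.\<close>
  let ?P = "\<lambda>n a d. \<forall>q k j. E q W \<and> E k W \<and> E j W \<and> n = npair q (npair k j) \<longrightarrow> ?G q k j a d"
  have pdP: "pd (\<lambda>s. ?P (s 0) (s 1) (s 2))" unfolding Good_def by (intro dfi pd_strat[OF C0] ftF)
  let ?X = "\<lambda>\<xi>. \<xi> \<noteq> zero \<and> (\<forall>c. E c \<xi> \<longrightarrow> E (sc c) \<xi>) \<and>
    (\<forall>n a. E n W \<and> E a \<xi> \<longrightarrow> (\<exists>d. E d \<xi> \<and> ?P n a d))"
  define X where "X = sep w1 ?X"
  have pdX: "pd (\<lambda>s. ?X (s 0))" by (intro dfi pd_3[where R = ?P, OF pdP])
  have X: "E x X \<longleftrightarrow> E x w1 \<and> ?X x" for x unfolding X_def by (rule mem_sep[OF pdX])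
  have bd: "\<exists>d. E d w1 \<and> ?P n a d" if a: "E a w1" and n: "E n W" for a n
  proof (cases "\<exists>q k j. E q W \<and> E k W \<and> E j W \<and> n = npair q (npair k j)")
    case True
    then obtain q k j where h: "E q W" "E k W" "E j W" "n = npair q (npair k j)" by blast
    obtain d where d: "E d w1" "?G q k j a d" using GI[OF h(1,2,3) a] by blast
    have "q' = q \<and> k' = k \<and> j' = j" if "E q' W" "E k' W" "E j' W" "n = npair q' (npair k' j')" for q' k' j'
      using that h npair_inj[of q "npair k j" q' "npair k' j'"] npair_inj[of k j k' j'] by auto
    then have "?P n a d" using d(2) by blast
    then show ?thesis using d(1) by blast
  next
    case False
    then show ?thesis using w1_zero by blast
  qed
  have "\<exists>\<xi>. E \<xi> X \<and> E a \<xi>" if a: "E a w1" for a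
  proof -
    have "\<exists>\<xi>. E \<xi> w1 \<and> E a \<xi> \<and> (\<forall>c. E c \<xi> \<longrightarrow> E (sc c) \<xi>) \<and>
      (\<forall>n a. E n W \<and> E a \<xi> \<longrightarrow> (\<exists>d. E d \<xi> \<and> ?P n a d))"
    proof (rule closed_unbounded[where P = ?P, OF pdP])
      show "\<exists>d. E d w1 \<and> ?P n a d" if "E a w1" "E n W" for a n by (rule bd[OF that])
      show "?P n a d" if "E n W" "E a' w1" "E a (sc a')" "?P n a' d" for n a a' d
        using that(4) Good_antimono[OF _ that(3) w1_Ord[OF that(2)]] by blast
    qed (rule a)
    then obtain \<xi> where "E \<xi> w1" "E a \<xi>" "\<forall>c. E c \<xi> \<longrightarrow> E (sc c) \<xi>"
        "\<forall>n a. E n W \<and> E a \<xi> \<longrightarrow> (\<exists>d. E d \<xi> \<and> ?P n a d)" by blast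
    moreover from \<open>E a \<xi>\<close> have "\<xi> \<noteq> zero" by auto
    ultimately show ?thesis unfolding X by blast
  qed
  then have unc: "\<not> cble X" using uncountable_if_unbounded[of X] X by blast
  have hom: "C q f \<longleftrightarrow> b" if q: "E q W" and s: "strat (C q) (F q) b" and f: "E f (incseqs E X)" for q b f
  proof -
    have ff: "is_fun E f W X" "\<And>m n. E n W \<Longrightarrow> E m n \<Longrightarrow> E (ap f m) (ap f n)"
      using f unfolding mem_incseqs by blast+
    have fX: "E (ap f k) w1" "?X (ap f k)" if "E k W" for k using is_fun_ap[OF ff(1) that] X by blast+
    have fw: "is_fun E f W w1" using ff(1) fX(1) unfolding is_fun_iff by blast
    have sup: "E (un (rep W (ap f))) w1" by (rule w1_sup[OF ft_apc fX(1)])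
    have le: "E (ap f k) (sc (un (rep W (ap f))))" if k: "E k W" for k
      using Ord_sub_iff[OF w1_Ord[OF fX(1)[OF k]] w1_Ord[OF sup]] k
      unfolding mem_un mem_rep[OF ft_apc] by blast
    show ?thesis
    proof (rule strat_homogeneous[OF s fw ff(2) sup le])
      show "ap f k \<noteq> zero" if "E k W" for k using fX(2)[OF that] by blast
      show "E (sc x) (ap f k)" if "E k W" "E x (ap f k)" for k x using fX(2)[OF that(1)] that(2) by blast
      show "\<exists>d. E d (ap f l) \<and> Good (F q) b k j a d"
        if h: "E l W" "E k W" "E j W" "E a (ap f l)" for l k j a
      proof -
        have "E (npair q (npair k j)) W" using q h by simp
        then obtain d where "E d (ap f l)" "?P (npair q (npair k j)) a d" using fX(2)[OF h(1)] h(4) by blast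
        then show ?thesis using q h s by (cases b) auto
      qed
    qed
  qed
  show ?thesis
  proof (intro exI conjI allI impI)
    show "\<not> cble X" by (rule unc)
    show "E x w1" if "E x X" for x using that X by blast
    fix q f f' assume h: "E q W \<and> E f (incseqs E X) \<and> E f' (incseqs E X)"
    then obtain b where "strat (C q) (F q) b" using F by blast
    then show "C q f \<longleftrightarrow> C q f'" using hom h by blast
  qed
qed

lemma constant_on_homogeneous_set:
  assumes \<Phi>: "is_fun E \<Phi> (incseqs E w1) (reals E)"
  shows "\<exists>X r. (\<forall>x. E x X \<longrightarrow> E x w1) \<and> \<not> cble X \<and> is_fun E r W W \<and>
    (\<forall>f. E f (incseqs E X) \<longrightarrow> E f (incseqs E w1) \<and> ap \<Phi> f = r)"
proof -
  \<comment> \<open>A bit of the value is membership of a pair \<open>(m, n)\<close> in the real,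
    viewed as a set of pairs; \<open>npair\<close> numbers the bits.\<close>
  let ?C = "\<lambda>q f. \<exists>m n. E m W \<and> E n W \<and> q = npair m n \<and> E (pr m n) (ap \<Phi> f)"
  have "pd (\<lambda>s. ?C (s 0) (s 1))" by (intro dfi)
  from homogeneous_set[where C = ?C, OF this] obtain X
    where X: "\<And>x. E x X \<Longrightarrow> E x w1" "\<not> cble X"
      "\<And>q f f'. E q W \<Longrightarrow> E f (incseqs E X) \<Longrightarrow> E f' (incseqs E X) \<Longrightarrow> ?C q f \<longleftrightarrow> ?C q f'"
    by blast
  have sub: "E f (incseqs E w1)" if "E f (incseqs E X)" for f
    using that X(1) unfolding mem_incseqs is_fun_iff by blast
  have \<Phi>f: "is_fun E (ap \<Phi> f) W W" if "E f (incseqs E X)" for f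
    using is_fun_ap[OF \<Phi> sub[OF that]] by simp
  have mem: "E (pr m n) (ap \<Phi> f')" if f: "E f (incseqs E X)" "E f' (incseqs E X)"
    and mn: "E m W" "E n W" "E (pr m n) (ap \<Phi> f)" for f f' m n
  proof -
    have "?C (npair m n) f'" using X(3)[of "npair m n" f f'] f mn npair_W by blast
    then obtain m' n' where "E m' W" "E n' W" "npair m n = npair m' n'" "E (pr m' n') (ap \<Phi> f')" by blast
    then show ?thesis using npair_inj[of m n m' n'] mn by auto
  qed
  have eq: "ap \<Phi> f = ap \<Phi> f'" if f: "E f (incseqs E X)" "E f' (incseqs E X)" for f f'
  proof (rule fn_eqI[OF is_fun_fn[OF \<Phi>f[OF f(1)]] is_fun_fn[OF \<Phi>f[OF f(2)]]])
    fix m assume m: "E m W"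
    have "E (pr m (ap (ap \<Phi> f) m)) (ap \<Phi> f)" unfolding mem_fn[OF is_fun_fn[OF \<Phi>f[OF f(1)]]] using m by blast
    then have "E (pr m (ap (ap \<Phi> f) m)) (ap \<Phi> f')" using mem[OF f m is_fun_ap[OF \<Phi>f[OF f(1)] m]] by blast
    then show "ap (ap \<Phi> f) m = ap (ap \<Phi> f') m" unfolding mem_fn[OF is_fun_fn[OF \<Phi>f[OF f(2)]]] by simp
  qed
  have "\<exists>r. is_fun E r W W \<and> (\<forall>f. E f (incseqs E X) \<longrightarrow> ap \<Phi> f = r)"
  proof (cases "\<exists>f. E f (incseqs E X)")
    case True
    then show ?thesis using eq \<Phi>f by blast
  next
    case False
    \<comment> \<open>With no sequences to consider, any real is a constant value.\<close>
    have "is_fun E (lam W (\<lambda>x. x)) W W" by (rule is_fun_lam) (intro dfi)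
    then show ?thesis using False by blast
  qed
  then show ?thesis using X(1,2) sub by blast
qed

end

context zf
begin

section \<open>Relative constructibility\<close>

definition FN where "FN n A = sep (pow (prd n A)) (\<lambda>s. is_fun E s n A)"

lemma mem_FN [simp]: "E s (FN n A) \<longleftrightarrow> is_fun E s n A"
proof -
  have p: "pd (\<lambda>s. is_fun E (s 0) n A)" by (intro dfi)
  show ?thesis unfolding FN_def mem_sep[OF p] using is_fun_sub_prd by blast
qed

lemma ft_FN0: "ft (\<lambda>s. FN (s 0) (s 1))" unfolding FN_def by (intro dfi)
lemmas ft_FN [dfi] = ft_2[where F = FN, OF ft_FN0]

lemma vset_sep: "pd (\<lambda>s. P (s 0)) \<Longrightarrow> vset E {x. E x a \<and> P x} = sep a P"
  by (rule vset_eq) (simp add: mem_sep)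

lemma vset_FN:
  assumes "pd (\<lambda>s. P (s 0))" "\<And>s. is_fun E s n A \<Longrightarrow> Q s \<longleftrightarrow> P s"
  shows "vset E {s. is_fun E s n A \<and> Q s} = sep (FN n A) P"
  by (rule vset_eq) (use assms in \<open>auto simp: mem_sep\<close>)

definition rs where "rs f A = sep f (\<lambda>p. \<exists>x y. E x A \<and> p = pr x y)"

lemma ft_rs0: "ft (\<lambda>s. rs (s 0) (s 1))" unfolding rs_def by (intro dfi)
lemmas ft_rs [dfi] = ft_2[where F = rs, OF ft_rs0]

lemma restr_rs: "restr E f A = rs f A"
proof -
  have p: "pd (\<lambda>s. \<exists>x y. E x A \<and> s 0 = pr x y)" by (intro dfi)
  show ?thesis unfolding restr_def rs_def by (rule vset_sep[OF p])
qed

text \<open>The terms \<open>sep\<close>, \<open>ap\<close> and \<open>rs\<close> replace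
  \<open>vset\<close>, \<open>app\<close> and \<open>restr\<close>, so that the closure rules for
  definability apply.\<close>

definition dclosed where
  "dclosed as A F \<longleftrightarrow> (\<forall>n. E n W \<longrightarrow>
    (\<forall>i j. E i n \<and> E j n \<longrightarrow> E (pr n (sep (FN n A) (\<lambda>s. E (ap s i) (ap s j)))) F) \<and>
    (\<forall>i j. E i n \<and> E j n \<longrightarrow> E (pr n (sep (FN n A) (\<lambda>s. ap s i = ap s j))) F) \<and>
    (\<forall>a\<in>set as. \<forall>i. E i n \<longrightarrow> E (pr n (sep (FN n A) (\<lambda>s. E (ap s i) a))) F) \<and>
    (\<forall>R. E (pr n R) F \<longrightarrow> E (pr n (sep (FN n A) (\<lambda>s. \<not> E s R))) F) \<and>
    (\<forall>R S. E (pr n R) F \<and> E (pr n S) F \<longrightarrow> E (pr n (sep R (\<lambda>s. E s S))) F) \<and>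
    (\<forall>R. E (pr (sc n) R) F \<longrightarrow> E (pr n (sep (FN n A) (\<lambda>s. \<exists>t. E t R \<and> rs t n = s))) F))"

lemma def_closed_iff: "def_closed E as A F \<longleftrightarrow> dclosed as A F"
proof -
  have 1: "vset E {s. is_fun E s n A \<and> E (app E s i) (app E s j)} = sep (FN n A) (\<lambda>s. E (ap s i) (ap s j))"
    if "E i n" "E j n" for n i j
    by (rule vset_FN) (intro dfi, use app_ap that in simp)
  have 2: "vset E {s. is_fun E s n A \<and> app E s i = app E s j} = sep (FN n A) (\<lambda>s. ap s i = ap s j)"
    if "E i n" "E j n" for n i j
    by (rule vset_FN) (intro dfi, use app_ap that in simp)
  have 3: "vset E {s. is_fun E s n A \<and> E (app E s i) a} = sep (FN n A) (\<lambda>s. E (ap s i) a)"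
    if "E i n" for n i a
    by (rule vset_FN) (intro dfi, use app_ap that in simp)
  have 4: "vset E {s. is_fun E s n A \<and> \<not> E s R} = sep (FN n A) (\<lambda>s. \<not> E s R)" for n R
    by (rule vset_FN) (intro dfi, simp)
  have 5: "vset E (elts E R \<inter> elts E S) = sep R (\<lambda>s. E s S)" for R S
  proof -
    have "pd (\<lambda>s. E (s 0) S)" by (intro dfi)
    then show ?thesis by (intro vset_eq) (simp add: mem_sep elts_def)
  qed
  have 6: "vset E {s. is_fun E s n A \<and> (\<exists>t. E t R \<and> restr E t n = s)} =
    sep (FN n A) (\<lambda>s. \<exists>t. E t R \<and> rs t n = s)" for n R
    by (rule vset_FN) (intro dfi, simp add: restr_rs)
  show ?thesis unfolding def_closed_def dclosed_def 4 5 6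
    by (simp add: 1 2 3 cong: conj_cong imp_cong)
qed

lemma pd_dclosed0: "pd (\<lambda>s. dclosed as (s 0) (s 1))" unfolding dclosed_def by (intro dfi)
lemmas pd_dclosed [dfi] = pd_2[where R = "dclosed as" for as, OF pd_dclosed0]

lemma definable_rel_iff: "definable_rel E as A n R \<longleftrightarrow> (\<forall>F. dclosed as A F \<longrightarrow> E (pr n R) F)"
  unfolding definable_rel_def def_closed_iff ..

lemma pd_definable_rel0: "pd (\<lambda>s. definable_rel E as (s 0) (s 1) (s 2))"
  unfolding definable_rel_iff by (intro dfi)
lemmas pd_definable_rel [dfi] = pd_3[where R = "definable_rel E as" for as, OF pd_definable_rel0]

lemma vset_insert: "vset E (insert p (elts E s)) = bun s (upair p p)"
  by (rule vset_eq) (auto simp: elts_def)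

definition DefX where
  "DefX as A X \<longleftrightarrow> (\<exists>n s R. E n W \<and> is_fun E s n A \<and> definable_rel E as A (sc n) R \<and>
    (\<forall>x. E x X \<longleftrightarrow> E x A \<and> E (bun s (upair (pr n x) (pr n x))) R))"

lemma pd_DefX0: "pd (\<lambda>s. DefX as (s 0) (s 1))" unfolding DefX_def by (intro dfi)
lemmas pd_DefX = pd_2[where R = "DefX as" for as, OF pd_DefX0]

lemma Def_sep: "Def E as A = sep (pow A) (DefX as A)"
proof -
  have e: "elts E X = {x. E x A \<and> E (vset E (insert (pr n x) (elts E s))) R} \<longleftrightarrow>
    (\<forall>x. E x X \<longleftrightarrow> E x A \<and> E (bun s (upair (pr n x) (pr n x))) R)" for X n s R
    unfolding vset_insert unfolding elts_def set_eq_iff mem_Collect_eq by (rule refl)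
  have p: "pd (\<lambda>s. DefX as A (s 0))" by (intro dfi pd_DefX)
  have "DefX as A X \<Longrightarrow> E X (pow A)" for X unfolding DefX_def mem_pow by blast
  then show ?thesis unfolding Def_def e DefX_def[symmetric]
    by (intro vset_eq) (unfold mem_sep[OF p] mem_Collect_eq, blast)
qed

lemma mem_Def: "E X (Def E as A) \<longleftrightarrow> DefX as A X"
proof -
  have p: "pd (\<lambda>s. DefX as A (s 0))" by (intro dfi pd_DefX)
  show ?thesis unfolding Def_sep mem_sep[OF p] mem_pow DefX_def by blast
qed

lemma ft_Def0: "ft (\<lambda>s. Def E as (s 0))" unfolding Def_sep by (intro dfi pd_DefX)
lemmas ft_Def [dfi] = ft_1[where F = "Def E as" for as, OF ft_Def0]

section \<open>Sets that are definable over a given set\<close>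

lemma dclosedD:
  assumes "dclosed as A F" "E n W"
  shows "E i n \<Longrightarrow> E j n \<Longrightarrow> E (pr n (sep (FN n A) (\<lambda>s. E (ap s i) (ap s j)))) F"
    and "E i n \<Longrightarrow> E j n \<Longrightarrow> E (pr n (sep (FN n A) (\<lambda>s. ap s i = ap s j))) F"
    and "a \<in> set as \<Longrightarrow> E i n \<Longrightarrow> E (pr n (sep (FN n A) (\<lambda>s. E (ap s i) a))) F"
    and "E (pr n R) F \<Longrightarrow> E (pr n (sep (FN n A) (\<lambda>s. \<not> E s R))) F"
    and "E (pr n R) F \<Longrightarrow> E (pr n S) F \<Longrightarrow> E (pr n (sep R (\<lambda>s. E s S))) F"
proof -
  note * = assms(1)[unfolded dclosed_def, THEN spec, THEN mp, OF assms(2)]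
  note 1 = *[THEN conjunct1] and * = *[THEN conjunct2]
  note 2 = *[THEN conjunct1] and * = *[THEN conjunct2]
  note 3 = *[THEN conjunct1] and * = *[THEN conjunct2]
  note 4 = *[THEN conjunct1] and 5 = *[THEN conjunct2, THEN conjunct1]
  show "E i n \<Longrightarrow> E j n \<Longrightarrow> E (pr n (sep (FN n A) (\<lambda>s. E (ap s i) (ap s j)))) F" using 1 by simp
  show "E i n \<Longrightarrow> E j n \<Longrightarrow> E (pr n (sep (FN n A) (\<lambda>s. ap s i = ap s j))) F" using 2 by simp
  show "a \<in> set as \<Longrightarrow> E i n \<Longrightarrow> E (pr n (sep (FN n A) (\<lambda>s. E (ap s i) a))) F" using 3 by simp
  show "E (pr n R) F \<Longrightarrow> E (pr n (sep (FN n A) (\<lambda>s. \<not> E s R))) F" using 4 by simp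
  show "E (pr n R) F \<Longrightarrow> E (pr n S) F \<Longrightarrow> E (pr n (sep R (\<lambda>s. E s S))) F" using 5 by simp
qed

text \<open>Two notions of definability meet: \<open>pd\<close> refers to external formulas over the
  structure and gives \<open>sep\<close> its meaning, \<open>definable_rel\<close> to internal,
  possibly nonstandard formulas over \<open>A\<close>.\<close>

definition drp where "drp as A n P \<longleftrightarrow> pd (\<lambda>s. P (s 0)) \<and> definable_rel E as A n (sep (FN n A) P)"

lemma drp_mem: "E n W \<Longrightarrow> E i n \<Longrightarrow> E j n \<Longrightarrow> drp as A n (\<lambda>s. E (ap s i) (ap s j))"
  unfolding drp_def definable_rel_iff by (intro conjI allI impI, intro dfi, rule dclosedD)

lemma drp_eq: "E n W \<Longrightarrow> E i n \<Longrightarrow> E j n \<Longrightarrow> drp as A n (\<lambda>s. ap s i = ap s j)"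
  unfolding drp_def definable_rel_iff by (intro conjI allI impI, intro dfi, rule dclosedD)

lemma drp_par: "E n W \<Longrightarrow> E i n \<Longrightarrow> a \<in> set as \<Longrightarrow> drp as A n (\<lambda>s. E (ap s i) a)"
  unfolding drp_def definable_rel_iff by (intro conjI allI impI, intro dfi, rule dclosedD)

lemma drp_not:
  assumes "E n W" "drp as A n P" shows "drp as A n (\<lambda>s. \<not> P s)"
proof -
  have p1: "pd (\<lambda>s. P (s 0))" using assms(2) unfolding drp_def by blast
  have p2: "pd (\<lambda>s. \<not> P (s 0))" "pd (\<lambda>s. \<not> E (s 0) (sep (FN n A) P))" by (intro dfi p1)+
  have "sep (FN n A) (\<lambda>s. \<not> E s (sep (FN n A) P)) = sep (FN n A) (\<lambda>s. \<not> P s)"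
    by (rule ext) (unfold mem_sep[OF p2(1)] mem_sep[OF p2(2)], unfold mem_sep[OF p1], blast)
  moreover have "definable_rel E as A n (sep (FN n A) (\<lambda>s. \<not> E s (sep (FN n A) P)))"
    using assms(2) dclosedD(4)[OF _ assms(1)] unfolding drp_def definable_rel_iff by simp
  ultimately show ?thesis unfolding drp_def using p2(1) by simp
qed

lemma drp_and:
  assumes "E n W" "drp as A n P" "drp as A n Q" shows "drp as A n (\<lambda>s. P s \<and> Q s)"
proof -
  have p: "pd (\<lambda>s. P (s 0))" "pd (\<lambda>s. Q (s 0))" using assms(2,3) unfolding drp_def by auto
  have pq: "pd (\<lambda>s. P (s 0) \<and> Q (s 0))" by (intro dfi p)
  have q: "pd (\<lambda>s. E (s 0) (sep (FN n A) Q))" by (intro dfi p)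
  have "sep (sep (FN n A) P) (\<lambda>s. E s (sep (FN n A) Q)) = sep (FN n A) (\<lambda>s. P s \<and> Q s)"
    by (rule ext) (unfold mem_sep[OF q] mem_sep[OF pq], unfold mem_sep[OF p(1)] mem_sep[OF p(2)], blast)
  moreover have "definable_rel E as A n (sep (sep (FN n A) P) (\<lambda>s. E s (sep (FN n A) Q)))"
    using assms(2,3) dclosedD(5)[OF _ assms(1)] unfolding drp_def definable_rel_iff by simp
  ultimately show ?thesis unfolding drp_def using pq by simp
qed

lemma drp_or: "E n W \<Longrightarrow> drp as A n P \<Longrightarrow> drp as A n Q \<Longrightarrow> drp as A n (\<lambda>s. P s \<or> Q s)"
  using drp_not[OF _ drp_and[OF _ drp_not drp_not], of n as A P Q] by simp

lemma append_lam:
  assumes "fn s n" shows "bun s (upair (pr n x) (pr n x)) = lam (sc n) (\<lambda>i. if i = n then x else ap s i)"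
proof (rule ext)
  fix p
  have f: "ft (\<lambda>s'. if s' 0 = n then x else ap s (s' 0))" by (intro dfi)
  have ne: "E i n \<Longrightarrow> i \<noteq> n" for i by auto
  have "(\<exists>i. E i n \<and> p = pr i (ap s i)) \<or> p = pr n x \<longleftrightarrow>
    (\<exists>i. E i (sc n) \<and> p = pr i (if i = n then x else ap s i))"
  proof
    assume "(\<exists>i. E i n \<and> p = pr i (ap s i)) \<or> p = pr n x"
    then consider i where "E i n" "p = pr i (ap s i)" | "p = pr n x" by blast
    then show "\<exists>i. E i (sc n) \<and> p = pr i (if i = n then x else ap s i)"
    proof cases
      case (1 i)
      then show ?thesis using ne[of i] by (intro exI[of _ i]) simp
    next
      case 2
      then show ?thesis by (intro exI[of _ n]) simp
    qed
  next
    assume "\<exists>i. E i (sc n) \<and> p = pr i (if i = n then x else ap s i)"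
    then obtain i where i: "E i (sc n)" "p = pr i (if i = n then x else ap s i)" by blast
    then show "(\<exists>i. E i n \<and> p = pr i (ap s i)) \<or> p = pr n x" by (cases "i = n") auto
  qed
  then show "E p (bun s (upair (pr n x) (pr n x))) \<longleftrightarrow> E p (lam (sc n) (\<lambda>i. if i = n then x else ap s i))"
    unfolding mem_bun mem_upair mem_fn[OF assms] mem_lam[of "\<lambda>i. if i = n then x else ap s i", OF f]
    by (simp only: disj_absorb)
qed

lemma Def_I:
  assumes n: "E n W" and s: "is_fun E s n A" and P: "drp as A (sc n) P"
    and X: "\<And>x. E x X \<longleftrightarrow> E x A \<and> P (lam (sc n) (\<lambda>i. if i = n then x else ap s i))"
  shows "E X (Def E as A)"
  unfolding mem_Def DefX_def
proof (intro exI conjI allI)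
  show "definable_rel E as A (sc n) (sep (FN (sc n) A) P)" using P unfolding drp_def by blast
  fix x
  have f: "ft (\<lambda>s'. if s' 0 = n then x else ap s (s' 0))" by (intro dfi)
  have "is_fun E (lam (sc n) (\<lambda>i. if i = n then x else ap s i)) (sc n) A" if "E x A"
    by (rule is_fun_lam[OF f]) (use that is_fun_ap[OF s] in auto)
  moreover have "pd (\<lambda>s. P (s 0))" using P unfolding drp_def by blast
  ultimately show "E x X \<longleftrightarrow> E x A \<and> E (bun s (upair (pr n x) (pr n x))) (sep (FN (sc n) A) P)"
    unfolding append_lam[OF is_fun_fn[OF s]] X by (auto simp: mem_sep)
qed (use n s in auto)

abbreviation "one \<equiv> sc zero"
abbreviation "two \<equiv> sc one"

text \<open>Places 0 and 1 of the tuple hold the parameters, place 2 the element under test.\<close>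

lemma Def_I2:
  assumes x: "E x A" and y: "E y A"
    and Q: "drp as A (sc two) (\<lambda>t. Q (ap t two) (ap t zero) (ap t one))"
    and X: "\<And>u. E u X \<longleftrightarrow> E u A \<and> Q u x y"
  shows "E X (Def E as A)"
proof -
  let ?S = "\<lambda>i. if i = zero then x else y"
  have fS: "ft (\<lambda>s. ?S (s 0))" by (intro dfi)
  define s where "s = lam two ?S"
  have s: "ap s zero = x" "ap s one = y" unfolding s_def using ap_lam[of ?S, OF fS] by simp_all
  have ne: "zero \<noteq> two" "one \<noteq> two" "zero \<noteq> one" by simp_all
  show ?thesis
  proof (rule Def_I[OF _ _ Q, of s])
    show "E two W" by simp
    show "is_fun E s two A" unfolding s_def by (rule is_fun_lam[OF fS]) (use x y in simp)
    fix u
    let ?F = "\<lambda>i. if i = two then u else ap s i"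
    have f: "ft (\<lambda>s. ?F (s 0))" by (intro dfi)
    have "ap (lam (sc two) ?F) two = u" "ap (lam (sc two) ?F) zero = x" "ap (lam (sc two) ?F) one = y"
      using ap_lam[of ?F, OF f] ne s by simp_all
    then show "E u X \<longleftrightarrow> E u A \<and> Q (ap (lam (sc two) ?F) two) (ap (lam (sc two) ?F) zero) (ap (lam (sc two) ?F) one)"
      using X by simp
  qed
qed

definition trs where "trs A \<longleftrightarrow> (\<forall>x y. E x y \<and> E y A \<longrightarrow> E x A)"

lemma three [simp]: "E (sc two) W" "E two (sc two)" "E one (sc two)" "E zero (sc two)"
  by simp_all

text \<open>A member of a transitive set is also a subset, defined by membership in the parameter
  \<open>x\<close>; the second parameter place repeats \<open>x\<close>.\<close>

lemma Def_self: "trs A \<Longrightarrow> E x A \<Longrightarrow> E x (Def E as A)"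
  by (rule Def_I2[of x A x as "\<lambda>u x y. E u x", OF _ _ drp_mem[OF three(1,2,4)]])
    (unfold trs_def, blast+)

lemma Def_sc: "trs A \<Longrightarrow> E x A \<Longrightarrow> E (sc x) (Def E as A)"
  by (rule Def_I2[of x A x as "\<lambda>u x y. E u x \<or> u = x",
        OF _ _ drp_or[OF three(1) drp_mem[OF three(1,2,4)] drp_eq[OF three(1,2,4)]]])
    (unfold trs_def mem_sc, blast+)

lemma Def_upair: "E x A \<Longrightarrow> E y A \<Longrightarrow> E (upair x y) (Def E as A)"
  by (rule Def_I2[of x A y as "\<lambda>u x y. u = x \<or> u = y",
        OF _ _ drp_or[OF three(1) drp_eq[OF three(1,2,4)] drp_eq[OF three(1,2,3)]]])
    (unfold mem_upair, blast+)

text \<open>The entries of \<open>as\<close> enter the hierarchy as predicates on \<open>A\<close>;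
  one that is included in \<open>A\<close> thereby becomes a definable subset.\<close>

lemma Def_par: "r \<in> set as \<Longrightarrow> (\<And>x. E x r \<Longrightarrow> E x A) \<Longrightarrow> E r (Def E as A)"
proof (rule Def_I[of zero zero A as "\<lambda>t. E (ap t zero) r"])
  assume r: "r \<in> set as" and sub: "\<And>x. E x r \<Longrightarrow> E x A"
  show "is_fun E zero zero A" unfolding is_fun_def by simp
  show "drp as A one (\<lambda>t. E (ap t zero) r)" by (rule drp_par) (use r in simp_all)
  fix x
  have f: "ft (\<lambda>s. if s 0 = zero then x else ap zero (s 0))" by (intro dfi)
  show "E x r \<longleftrightarrow> E x A \<and> E (ap (lam one (\<lambda>i. if i = zero then x else ap zero i)) zero) r"
    using ap_lam[of "\<lambda>i. if i = zero then x else ap zero i", OF f, of zero one] sub by auto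
qed simp

lemma Def_zero: "E zero (Def E as zero)"
proof (rule Def_I)
  show "E zero W" by simp
  show "is_fun E zero zero zero" unfolding is_fun_def by simp
  show "drp as zero one (\<lambda>t. ap t zero = ap t zero)" by (rule drp_eq) simp_all
qed simp

lemma trs_Def:
  assumes "trs A" shows "trs (Def E as A)"
proof -
  have "E x A" if "E x y" "E y (Def E as A)" for x y
    using that unfolding mem_Def DefX_def by blast
  then show ?thesis unfolding trs_def using Def_self[OF assms] by blast
qed

text \<open>Each natural number appears at a finite level and pairs two levels later, so
  \<open>r\<close> is a subset of level \<omega>. The predicate \<open>r\<close> then makes it an
  element of level \<omega> + 1.\<close>

theorem real_in_L:
  assumes r: "is_fun E r W W" "r \<in> set as" shows "r \<in> L E as"
proof -
  \<comment> \<open>The recursion has to reach the level \<omega> + 1 itself, so its domain is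
    \<omega> + 2.\<close>
  define D where "D = sc (sc W)"
  have oD: "Ord D" unfolding D_def by simp
  \<comment> \<open>The union clause covers the limits and also 0, where it gives the empty
    set.\<close>
  let ?G = "\<lambda>v p. if \<exists>u. v = sc u then Def E as (ap p (un v)) else un (rep v (ap p))"
  have "ft (\<lambda>s. ?G (s 0) (s 1))" by (intro dfi)
  from ord_recursion[where G = ?G, OF oD this] obtain g
    where fg: "fn g D" and g: "\<And>v. E v D \<Longrightarrow> ap g v = ?G v (lam v (ap g))" by blast
  have D_trans: "E v D" if "E v u" "E u D" for u v using Ord_trans[OF oD that(2,1)] .
  have gs: "ap g (sc u) = Def E as (ap g u)" if "E (sc u) D" for u
  proof -
    have "Ord u" using Ord_mem[OF oD that] by simp
    then show ?thesis unfolding g[OF that] using ap_lam[OF ft_apc, of u "sc u" g] by auto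
  qed
  have gl: "E x (ap g v) \<longleftrightarrow> (\<exists>u. E u v \<and> E x (ap g u))" if v: "E v D" "\<And>u. v \<noteq> sc u" for v x
  proof -
    have "ap g v = un (rep v (ap (lam v (ap g))))" unfolding g[OF v(1)] using v(2) by auto
    then have "E x (ap g v) \<longleftrightarrow> (\<exists>u. E u v \<and> E x (ap (lam v (ap g)) u))"
      unfolding \<open>ap g v = _\<close> mem_un mem_rep[OF ft_apc] by blast
    then show ?thesis using ap_lam[OF ft_apc] by auto
  qed
  have WD: "E W D" "E (sc W) D" unfolding D_def by simp_all
  have nD: "E n D" if "E n W" for n using D_trans[OF that WD(1)] .
  have W_ns: "W \<noteq> sc u" for u using W_props(1) unfolding is_Limit_def by blast
  have g0: "ap g zero = zero" by (rule zero_eqI) (use gl[OF nD[OF W_zero]] in auto)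
  have gn: "ap g (sc n) = Def E as (ap g n)" if "E n W" for n using gs[of n] nD that by simp
  have tr: "trs (ap g n)" if n: "E n W" for n
  proof -
    have p: "pd (\<lambda>s. trs (ap g (s 0)))" unfolding trs_def by (intro dfi)
    from n p show ?thesis
    proof (induction n rule: W_induct)
      case zero
      then show ?case unfolding g0 trs_def by simp
    next
      case (sc n)
      then show ?case using gn trs_Def by simp
    qed
  qed
  have step: "E x (ap g (sc n))" if "E n W" "E x (ap g n)" for n x
    using gn[OF that(1)] Def_self[OF tr[OF that(1)] that(2)] by simp
  have mono: "E x (ap g n)" if n: "E n W" and mx: "E m (sc n)" "E x (ap g m)" for m n x
  proof -
    have p: "pd (\<lambda>s. \<forall>m. E m (sc (s 0)) \<longrightarrow> (\<forall>x. E x (ap g m) \<longrightarrow> E x (ap g (s 0))))" by (intro dfi)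
    from n p have "\<forall>m. E m (sc n) \<longrightarrow> (\<forall>x. E x (ap g m) \<longrightarrow> E x (ap g n))"
    proof (induction n rule: W_induct)
      case zero
      then show ?case by simp
    next
      case (sc n)
      then show ?case using step[OF sc(1)] by auto
    qed
    then show ?thesis using mx by blast
  qed
  have nat: "E n (ap g (sc n))" if n: "E n W" for n
  proof -
    have p: "pd (\<lambda>s. E (s 0) (ap g (sc (s 0))))" by (intro dfi)
    from n p show ?thesis
    proof (induction n rule: W_induct)
      case zero
      then show ?case using gn[OF W_zero] g0 Def_zero by simp
    next
      case (sc n)
      have "E (sc n) W" using sc(1) by simp
      from gn[OF this] Def_sc[OF tr[OF this] sc(2)] show ?case by simp
    qed
  qed
  have pairs: "E (pr m n) (ap g W)" if mn: "E m W" "E n W" for m n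
  proof -
    obtain N where N: "E N W" "E m N" "E n N" using W_bound3[OF mn mn(1)] by blast
    have o: "Ord N" using W_Ord[OF N(1)] .
    have "E m (ap g N)" "E n (ap g N)"
      using mono[OF N(1)] nat mn sc_mem_sc[OF o] N(2,3) by blast+
    then have "E (upair m m) (ap g (sc N))" "E (upair m n) (ap g (sc N))"
      using gn[OF N(1)] Def_upair by simp_all
    then have "E (pr m n) (ap g (sc (sc N)))" unfolding pr_upair using gn[of "sc N"] N(1) Def_upair by simp
    then show ?thesis unfolding gl[OF WD(1) W_ns] using N(1) W_sc by blast
  qed
  have "E x (ap g W)" if "E x r" for x
    using that pairs is_fun_ap[OF r(1)] unfolding mem_fn[OF is_fun_fn[OF r(1)]] by blast
  then have "E r (Def E as (ap g W))" by (rule Def_par[OF r(2)])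
  then have rg: "E r (ap g (sc W))" using gs[OF WD(2)] by simp
  have gf: "is_fun E g D (rep D (ap g))" unfolding is_fun_iff mem_rep[OF ft_apc] using fg by blast
  note aps = app_ap[OF gf]
  have "is_level E as (sc W) (ap g (sc W))" unfolding is_level_def D_def[symmetric]
  proof (intro conjI exI)
    show "is_fun E g D (rep D (ap g))" by (rule gf)
    show "app E g zero = zero" using aps[OF nD[OF W_zero]] g0 by simp
    show "app E g (sc W) = ap g (sc W)" by (rule aps[OF WD(2)])
    show "\<forall>\<beta>. E \<beta> (sc W) \<longrightarrow> app E g (sc \<beta>) = Def E as (app E g \<beta>)"
    proof (intro allI impI)
      fix u assume u: "E u (sc W)"
      have "E (sc u) D" unfolding D_def using sc_mem_sc[of "sc W" u] u Ord_W Ord_sc by blast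
      moreover have "E u D" using D_trans[OF u WD(2)] .
      ultimately show "app E g (sc u) = Def E as (app E g u)" using aps gs by simp
    qed
    show "\<forall>\<beta>. E \<beta> D \<and> is_Limit E \<beta> \<longrightarrow> elts E (app E g \<beta>) = (\<Union>\<gamma>\<in>elts E \<beta>. elts E (app E g \<gamma>))"
    proof (intro allI impI)
      fix v assume v: "E v D \<and> is_Limit E v"
      then have ns: "v \<noteq> sc u" for u unfolding is_Limit_def by blast
      have "app E g u = ap g u" if "E u v" for u using aps D_trans that v by blast
      then have "(\<Union>\<gamma>\<in>elts E v. elts E (app E g \<gamma>)) = {x. \<exists>u. E u v \<and> E x (ap g u)}"
        unfolding elts_def by auto
      then show "elts E (app E g v) = (\<Union>\<gamma>\<in>elts E v. elts E (app E g \<gamma>))"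
        using aps[of v] v gl[of v] ns unfolding elts_def by simp
    qed
  qed simp
  then show ?thesis unfolding L_def using rg by blast
qed

end

theorem theorem7p6:
  fixes E :: "'v \<Rightarrow> 'v \<Rightarrow> bool" and \<Phi> :: 'v
  assumes "ZF E" and "AD E"
    and "is_fun E \<Phi> (incseqs E (omega1 E)) (reals E)"
  shows "\<exists>X \<sigma> w \<phi>.
    elts E X \<subseteq> elts E (omega1 E) \<and> \<not> is_countable E X \<and>
    E \<sigma> (reals E) \<and> E w (reals E) \<and> fv \<phi> \<subseteq> {0, 1, 2, 3} \<and>
    (\<forall>f. E f (incseqs E X) \<longrightarrow>
      app E \<Phi> f \<in> L E [\<sigma>, w, f] \<and>
      (\<forall>z. E z (reals E) \<longrightarrow>
        (z = app E \<Phi> f \<longleftrightarrow> sat E (L E [\<sigma>, w, f, z]) ((!) [\<sigma>, w, f, z]) \<phi>)))"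
proof -
  interpret zf_ad E by unfold_locales (use assms in simp_all)
  obtain X r where X: "\<And>x. E x X \<Longrightarrow> E x w1" "\<not> cble X" and r: "is_fun E r W W"
    and c: "\<And>f. E f (incseqs E X) \<Longrightarrow> E f (incseqs E w1) \<and> ap \<Phi> f = r"
    using constant_on_homogeneous_set[OF assms(3)] by blast
  have app: "app E \<Phi> f = r" if "E f (incseqs E X)" for f
    using app_ap[OF assms(3)] c[OF that] by simp
  \<comment> \<open>Variable 3 is \<open>z\<close> and variable 0 is \<open>\<sigma>\<close>. An
    equation has the same truth value in every class, so only membership of the constant value in
    \<open>L\<close> remains to be supplied.\<close>
  show ?thesis
  proof (rule exI[of _ X], rule exI[of _ r], rule exI[of _ r], rule exI[of _ "Eq 3 0"],
      intro conjI allI impI)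
    show "elts E X \<subseteq> elts E w1" using X(1) by (auto simp: elts_def)
    show "\<not> is_countable E X" using X(2) unfolding countable_iff .
    show "E r (reals E)" "E r (reals E)" using r by simp_all
    show "fv (Eq 3 0) \<subseteq> {0, 1, 2, 3}" by simp
    fix f assume f: "E f (incseqs E X)"
    show "app E \<Phi> f \<in> L E [r, r, f]" unfolding app[OF f] by (rule real_in_L[OF r]) simp
    fix z assume "E z (reals E)"
    show "(z = app E \<Phi> f) \<longleftrightarrow> sat E (L E [r, r, f, z]) ((!) [r, r, f, z]) (Eq 3 0)"
      unfolding app[OF f] by simp
  qed
qed

end
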